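(* Let $X=\Sigma_{\boldsymbol a}$ be an $\boldsymbol a$-adic solenoid satisfying the condition: there is a unique prime number $p$ such that the group $X$ contains no elements of order $p$. Let $n\ge 2$ and let $\alpha_1,\dots,\alpha_n$ be topological automorphisms of $X$ such that $\alpha_1^2+\dots+\alpha_n^2=I$. Let $\xi_1,\dots,\xi_n$ be independent identically distributed random variables with values in $X$ and distribution $\mu$. If $\xi_j$ and $\alpha_1\xi_1+\dots+\alpha_n\xi_n$ are identically distributed, then $\mu=\gamma*m_K$, where $\gamma\in\Gamma(X)$ and $K$ is a compact subgroup of $X$; moreover, $f_p(K)=K$.
   Context: $\boldsymbol a$-adic solenoid: let $\boldsymbol a=(a_0,a_1,a_2,\dots)$ with all $a_j\in\mathbb Z$, $a_j>1$. Let $\Delta_{\boldsymbol a}$ be the compact group of $\boldsymbol a$-adic integers (as a set $\prod_{n\ge 0}\{0,1,\dots,a_n-1\}$, with the product topology and addition with carrying), and let $\mathbf u=(1,0,0,\dots)\in\Delta_{\boldsymbol a}$. Then $\Sigma_{\boldsymbol a}=(\mathbb R\times\Delta_{\boldsymbol a})/B$, where $B=\{(n,n\mathbf u):n\in\mathbb Z\}$. It is a compact connected Abelian group of dimension 1, and its character group is topologically isomorphic to the discrete additive group of rational numbers $H_{\boldsymbol a}=\left\{\frac{m}{a_0a_1\cdots a_n}: n=0,1,\dots;\ m\in\mathbb Z\right\}$. Notation: $I$ is the identity automorphism; $\alpha^2=\alpha\circ\alpha$, and sums of automorphisms are taken pointwise (in the endomorphism ring of $X$). For a nonzero integer $n$,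 $f_n:X\to X$ is the endomorphism $f_nx=nx$. $Y$ denotes the character group of $X$ and $(x,y)$ the value of the character $y\in Y$ at $x\in X$. The characteristic function of a Borel probability distribution $\mu$ on $X$ is $\hat\mu(y)=\int_X(x,y)\,d\mu(x)$, $y\in Y$. $\Gamma(X)$ is the set of Gaussian distributions on $X$: a probability distribution $\gamma$ on $X$ is Gaussian if $\hat\gamma(y)=(x,y)\exp\{-\varphi(y)\}$ for all $y\in Y$, where $x\in X$ and $\varphi$ is a continuous non-negative function on $Y$ satisfying $\varphi(u+v)+\varphi(u-v)=2[\varphi(u)+\varphi(v)]$ for all $u,v\in Y$ (degenerate distributions are Gaussian). $m_K$ is the Haar probability distribution of the compact subgroup $K$, regarded as a distribution on $X$, and $*$ is convolution. *)

theory Defs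
  imports
    "HOL-Probability.Probability"
    "HOL-Algebra.Algebra"
begin

text \<open>\<open>adic_carry a x y n\<close> is the carry into position \<open>n\<close> when \<open>x\<close> and \<open>y\<close> are added digit by
  digit, so position \<open>n\<close> satisfies
  \<open>x n + y n + carry n = carry (n + 1) * a n + (x + y) n\<close>.\<close>

primrec adic_carry :: "(nat \<Rightarrow> nat) \<Rightarrow> (nat \<Rightarrow> nat) \<Rightarrow> (nat \<Rightarrow> nat) \<Rightarrow> nat \<Rightarrow> nat" where
  "adic_carry a x y 0 = 0"
| "adic_carry a x y (Suc n) = (x n + y n + adic_carry a x y n) div a n"

definition adic_integers :: "(nat \<Rightarrow> nat) \<Rightarrow> (nat \<Rightarrow> nat) monoid" where
  "adic_integers a =
     \<lparr>carrier = (\<Pi>\<^sub>E n\<in>UNIV. {..<a n}),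
      monoid.mult = (\<lambda>x y n. (x n + y n + adic_carry a x y n) mod a n),
      one = (\<lambda>n. 0)\<rparr>"

definition adic_topology :: "(nat \<Rightarrow> nat) \<Rightarrow> (nat \<Rightarrow> nat) topology" where
  "adic_topology a = product_topology (\<lambda>n. discrete_topology {..<a n}) UNIV"

definition adic_unit :: "nat \<Rightarrow> nat" where
  "adic_unit = (\<lambda>n. if n = 0 then 1 else 0)"

text \<open>Abelian groups are written multiplicatively: \<open>x [^] n\<close> is \<open>n x\<close> and
  \<open>finprod\<close> is the finite sum.\<close>

definition real_group :: "real monoid" where
  "real_group = \<lparr>carrier = UNIV, monoid.mult = (+), one = 0\<rparr>"

definition solenoid_kernel :: "(nat \<Rightarrow> nat) \<Rightarrow> (real \<times> (nat \<Rightarrow> nat)) set" where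
  "solenoid_kernel a = {(of_int n, adic_unit [^]\<^bsub>adic_integers a\<^esub> n) | n :: int. True}"

definition solenoid :: "(nat \<Rightarrow> nat) \<Rightarrow> (real \<times> (nat \<Rightarrow> nat)) set monoid" where
  "solenoid a = (real_group \<times>\<times> adic_integers a) Mod solenoid_kernel a"

definition quotient_topology :: "'a topology \<Rightarrow> ('a \<Rightarrow> 'b) \<Rightarrow> 'b topology" where
  "quotient_topology T q =
     topology (\<lambda>U. U \<subseteq> q ` topspace T \<and> openin T {x \<in> topspace T. q x \<in> U})"

lemma openin_quotient_topology:
  "openin (quotient_topology T q) U \<longleftrightarrow>
     U \<subseteq> q ` topspace T \<and> openin T {x \<in> topspace T. q x \<in> U}"
proof -
  have "istopology (\<lambda>U. U \<subseteq> q ` topspace T \<and> openin T {x \<in> topspace T. q x \<in> U})"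
    unfolding istopology_def
  proof (intro conjI allI impI)
    fix S U
    assume S: "S \<subseteq> q ` topspace T \<and> openin T {x \<in> topspace T. q x \<in> S}"
      and U: "U \<subseteq> q ` topspace T \<and> openin T {x \<in> topspace T. q x \<in> U}"
    show "S \<inter> U \<subseteq> q ` topspace T" using S by blast
    have "{x \<in> topspace T. q x \<in> S \<inter> U} =
        {x \<in> topspace T. q x \<in> S} \<inter> {x \<in> topspace T. q x \<in> U}" by blast
    then show "openin T {x \<in> topspace T. q x \<in> S \<inter> U}" using S U by auto
  next
    fix \<K>
    assume K: "\<forall>K\<in>\<K>. K \<subseteq> q ` topspace T \<and> openin T {x \<in> topspace T. q x \<in> K}"
    show "\<Union>\<K> \<subseteq> q ` topspace T" using K by blast
    have "{x \<in> topspace T. q x \<in> \<Union>\<K>} = (\<Union>K\<in>\<K>. {x \<in> topspace T. q x \<in> K})" by blast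
    then show "openin T {x \<in> topspace T. q x \<in> \<Union>\<K>}" using K by auto
  qed
  then show ?thesis
    unfolding quotient_topology_def by (simp add: topology_inverse')
qed

lemma topspace_quotient_topology: "topspace (quotient_topology T q) = q ` topspace T"
proof
  show "topspace (quotient_topology T q) \<subseteq> q ` topspace T"
    using openin_topspace[of "quotient_topology T q"] unfolding openin_quotient_topology by blast
  have "openin (quotient_topology T q) (q ` topspace T)"
    unfolding openin_quotient_topology by (simp add: Collect_conj_eq Int_absorb2 image_subset_iff subsetI)
  then show "q ` topspace T \<subseteq> topspace (quotient_topology T q)"
    by (rule openin_subset)
qed

lemma quotient_map_quotient_topology: "quotient_map T (quotient_topology T q) q"
  unfolding quotient_map_def by (simp add: topspace_quotient_topology openin_quotient_topology)

definition solenoid_topology :: "(nat \<Rightarrow> nat) \<Rightarrow> (real \<times> (nat \<Rightarrow> nat)) set topology" where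
  "solenoid_topology a =
     quotient_topology (prod_topology euclideanreal (adic_topology a))
       (\<lambda>x. solenoid_kernel a #>\<^bsub>real_group \<times>\<times> adic_integers a\<^esub> x)"

text \<open>In what follows a topological group is a group \<open>G\<close> together with a topology \<open>T\<close> with
  \<open>topspace T = carrier G\<close>.\<close>

definition topological_automorphism :: "('a, 'm) monoid_scheme \<Rightarrow> 'a topology \<Rightarrow> ('a \<Rightarrow> 'a) \<Rightarrow> bool" where
  "topological_automorphism G T \<alpha> \<longleftrightarrow> \<alpha> \<in> iso G G \<and> homeomorphic_map T T \<alpha>"

definition compact_subgroup :: "('a, 'm) monoid_scheme \<Rightarrow> 'a topology \<Rightarrow> 'a set \<Rightarrow> bool" where
  "compact_subgroup G T K \<longleftrightarrow> subgroup K G \<and> compactin T K"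

definition circle_group :: "complex monoid" where
  "circle_group = \<lparr>carrier = sphere 0 1, monoid.mult = (*), one = 1\<rparr>"

text \<open>Characters are made extensional so that each of them is a single HOL function.\<close>

definition character_group :: "('a, 'm) monoid_scheme \<Rightarrow> 'a topology \<Rightarrow> ('a \<Rightarrow> complex) monoid" where
  "character_group G T =
     \<lparr>carrier = {y \<in> hom G circle_group. continuous_map T euclidean y} \<inter> extensional (carrier G),
      monoid.mult = (\<lambda>u v. \<lambda>x\<in>carrier G. u x * v x),
      one = (\<lambda>x\<in>carrier G. 1)\<rparr>"

text \<open>The compact-open topology, generated by its usual subbasis.\<close>

definition character_topology :: "('a, 'm) monoid_scheme \<Rightarrow> 'a topology \<Rightarrow> ('a \<Rightarrow> complex) topology" where
  "character_topology G T =
     topology_generated_by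
       {{y \<in> carrier (character_group G T). y ` C \<subseteq> U} | C U. compactin T C \<and> open U}"

definition borel_algebra :: "'a topology \<Rightarrow> 'a measure" where
  "borel_algebra T = sigma (topspace T) {U. openin T U}"

definition distribution_on :: "'a topology \<Rightarrow> 'a measure \<Rightarrow> bool" where
  "distribution_on T \<mu> \<longleftrightarrow> prob_space \<mu> \<and> sets \<mu> = sets (borel_algebra T)"

definition char_function :: "'a measure \<Rightarrow> ('a \<Rightarrow> complex) \<Rightarrow> complex" where
  "char_function \<mu> y = (\<integral>x. y x \<partial>\<mu>)"

definition gaussian_distribution :: "('a, 'm) monoid_scheme \<Rightarrow> 'a topology \<Rightarrow> 'a measure \<Rightarrow> bool" where
  "gaussian_distribution G T \<gamma> \<longleftrightarrow>
     distribution_on T \<gamma> \<and>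
     (\<exists>x\<in>carrier G. \<exists>\<phi> :: ('a \<Rightarrow> complex) \<Rightarrow> real.
        continuous_map (character_topology G T) euclideanreal \<phi> \<and>
        (\<forall>y\<in>carrier (character_group G T). 0 \<le> \<phi> y) \<and>
        (\<forall>u\<in>carrier (character_group G T). \<forall>v\<in>carrier (character_group G T).
           \<phi> (u \<otimes>\<^bsub>character_group G T\<^esub> v) +
           \<phi> (u \<otimes>\<^bsub>character_group G T\<^esub> inv\<^bsub>character_group G T\<^esub> v) = 2 * (\<phi> u + \<phi> v)) \<and>
        (\<forall>y\<in>carrier (character_group G T).
           char_function \<gamma> y = y x * of_real (exp (- \<phi> y))))"

text \<open>Invariance under translations by elements of the compact group \<open>K\<close>. On a compact second
  countable Hausdorff group every Borel probability measure is regular, so this describes the Haar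
  probability distribution of \<open>K\<close> uniquely.\<close>

definition haar_distribution :: "('a, 'm) monoid_scheme \<Rightarrow> 'a topology \<Rightarrow> 'a measure \<Rightarrow> bool" where
  "haar_distribution K T m \<longleftrightarrow>
     distribution_on T m \<and>
     (\<forall>k\<in>carrier K. distr m (borel_algebra T) (\<lambda>x. k \<otimes>\<^bsub>K\<^esub> x) = m)"

text \<open>\<open>m\<close> is the Haar distribution of the subgroup \<open>K\<close>, regarded as a distribution on \<open>G\<close>, that
  is, pushed forward along the inclusion of \<open>K\<close> into \<open>G\<close>.\<close>

definition subgroup_haar_distribution ::
    "('a, 'm) monoid_scheme \<Rightarrow> 'a topology \<Rightarrow> 'a set \<Rightarrow> 'a measure \<Rightarrow> bool" where
  "subgroup_haar_distribution G T K m \<longleftrightarrow>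
     (\<exists>m0. haar_distribution (G\<lparr>carrier := K\<rparr>) (subtopology T K) m0 \<and>
           m = distr m0 (borel_algebra T) (\<lambda>x. x))"

definition group_convolution ::
    "('a, 'm) monoid_scheme \<Rightarrow> 'a topology \<Rightarrow> 'a measure \<Rightarrow> 'a measure \<Rightarrow> 'a measure" where
  "group_convolution G T \<mu> \<nu> =
     distr (\<mu> \<Otimes>\<^sub>M \<nu>) (borel_algebra T) (\<lambda>(x, y). x \<otimes>\<^bsub>G\<^esub> y)"

end

theory Submission
  imports Defs
begin

text \<open>The characters of \<open>G\<close> form a subgroup \<open>H\<close> of \<open>\<rat>\<close>. Since \<open>p\<close> is the only prime for which \<open>G\<close> has
  no element of order \<open>p\<close>, it is the only prime by which \<open>H\<close> is divisible, so an automorphism acts on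
  \<open>H\<close> as multiplication by some \<open>\<lambda> = \<plusminus> p\<^sup>m\<close>; as \<open>\<Sum>\<lambda>\<^sub>j\<^sup>2 = 1\<close>, here \<open>\<lambda>\<^sub>j = \<epsilon>\<^sub>j / p ^ m\<^sub>j\<close> with \<open>m\<^sub>j \<ge> 1\<close>. The
  characteristic function \<open>f\<close> of \<open>\<mu>\<close> then satisfies \<open>f u = \<Prod>f (\<lambda>\<^sub>j u)\<close>, and its support \<open>N\<close> satisfies
  \<open>p N = N\<close>.

  For \<open>u \<in> N\<close> the quantity \<open>p ^ (2 s) (1 - \<bar>f (u / p ^ s)\<bar>\<^sup>2)\<close> increases with \<open>s\<close> and has the limit
  \<open>- ln \<bar>f u\<bar>\<^sup>2\<close>, while its increments control the second moments of \<open>1 - Re\<close> of the symmetrized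
  characters. In the limit \<open>- ln \<bar>f\<bar>\<^sup>2\<close> satisfies the parallelogram law, so it is quadratic and \<open>N\<close> is
  a group. The deviation of \<open>f / \<bar>f\<bar>\<close> from multiplicativity at \<open>(u / p ^ s, v / p ^ s)\<close> is
  \<open>o (p ^ (- 2 s))\<close>; iterating the equation for \<open>f\<close>, whose weights \<open>\<lambda>\<^sub>j\<^sup>2\<close> sum to 1, shows that it
  vanishes. So \<open>f\<close> is a Gaussian characteristic function on \<open>N\<close> and 0 elsewhere, and \<open>\<mu> = \<gamma> * m\<^sub>K\<close>
  for the annihilator \<open>K\<close> of \<open>N\<close>.\<close>

section \<open>Families of unimodular characters\<close>

text \<open>The characters form a discrete group, so \<open>u / p ^ s\<close> does not approach 0
  there, and neither a Taylor expansion nor a moment of \<open>\<mu>\<close> is available. Limits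
  have to come out of the functional equation itself: it bounds a scaled quantity at
  \<open>s\<close> by an average of the same quantity at later indices, so a bound valid for large
  \<open>s\<close> travels back to \<open>s = 0\<close>. The factor p^(2 s) makes this averaging
  neutral, neither gaining nor losing; for the phase an estimate O(p^(-2 s)) would therefore return
  only a bound, and the little o is indispensable. Its source is the inequality 1 - Re z^p <= p^2 (1
  - Re z), whose gap dominates 2 (1 - Re z)^2: a bounded increasing sequence has vanishing
  increments. The quantity 1 - |f|^2 is preferred to the logarithm because it is an integral, hence
  open to pointwise inequalities, and because it makes sense where \<open>f\<close> vanishes; that
  \<open>f\<close> is nonzero at \<open>u + v\<close> whenever it is so at \<open>u\<close> and
  \<open>v\<close> is itself part of what has to be proved.\<close>

lemma one_minus_Re_square_le:
  assumes "norm (z::complex) \<le> 1"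
  shows "(Im z)\<^sup>2 \<le> 2 * (1 - Re z)" "norm (z - 1) ^ 2 \<le> 2 * (1 - Re z)"
proof -
  have 1: "(Re z)\<^sup>2 + (Im z)\<^sup>2 \<le> 1"
    using assms by (simp add: cmod_def)
  have "0 \<le> (1 - Re z)\<^sup>2" by simp
  with 1 show "(Im z)\<^sup>2 \<le> 2 * (1 - Re z)"
    by (simp add: power2_eq_square algebra_simps)
  from 1 show "norm (z - 1) ^ 2 \<le> 2 * (1 - Re z)"
    by (simp add: cmod_power2) (simp add: power2_eq_square algebra_simps)
qed

text \<open>From Re (u v) + Re (u cnj v) = 2 Re u Re v: the function 1 - Re obeys the parallelogram
  law up to a product of two such terms, and this product is the defect that later has to be
  negligible.\<close>

lemma Re_mult_unit_parallelogram:
  assumes "norm u = 1" "norm v = 1"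
  shows "(1 - Re (u * v)) + (1 - Re (u * cnj v)) =
    2 * (1 - Re u) + 2 * (1 - Re v) - 2 * (1 - Re u) * (1 - Re v)"
  by (simp add: algebra_simps)

text \<open>The gap \<open>e k\<close> between k^2 (1 - Re z) and 1 - Re z^k vanishes at k = 0 and k
  = 1 and has second difference \<open>2 * d (Suc k) * d 1\<close>, which is nonnegative. So it is
  convex, and its step from 1 to 2, equal to \<open>2 * (d 1)\<^sup>2\<close>, bounds every later
  step from below.\<close>

lemma one_minus_Re_power_le:
  assumes "norm (z::complex) = 1" "2 \<le> k"
  shows "2 * (1 - Re z)\<^sup>2 \<le> real k ^ 2 * (1 - Re z) - (1 - Re (z ^ k))"
proof -
  define d where "d k = 1 - Re (z ^ k)" for k
  define e where "e k = real k ^ 2 * d 1 - d k" for k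
  have d0: "d k \<ge> 0" for k
  proof -
    have "norm (z ^ k) = 1" using assms by (simp add: norm_power)
    then show ?thesis unfolding d_def using complex_Re_le_cmod[of "z ^ k"] by simp
  qed
  have rec: "e (Suc (Suc k)) - e (Suc k) = e (Suc k) - e k + 2 * d (Suc k) * d 1" for k
  proof -
    have n: "norm (z ^ Suc k) = 1" using assms by (simp add: norm_mult norm_power)
    have zz: "z * cnj z = 1" using complex_norm_square[of z] assms by simp
    have "z ^ Suc k * cnj z = z ^ k" unfolding power_Suc2 mult.assoc zz by simp
    from Re_mult_unit_parallelogram[OF n assms(1), unfolded this]
    have "d (Suc (Suc k)) + d k = 2 * d (Suc k) + 2 * d 1 - 2 * d (Suc k) * d 1"
      unfolding d_def power_Suc2[of z "Suc k"] by simp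
    then show ?thesis by (simp add: e_def algebra_simps power2_eq_square)
  qed
  have "e (Suc k) \<ge> e k \<and> (1 \<le> k \<longrightarrow> e (Suc k) - e k \<ge> 2 * (d 1)\<^sup>2)" for k
  proof (induction k)
    case 0
    have "e 0 = 0" "e 1 = 0" by (simp_all add: e_def d_def)
    then show ?case by simp
  next
    case (Suc k)
    have *: "2 * d (Suc k) * d 1 \<ge> 0" using d0 by simp
    show ?case
    proof (cases k)
      case 0
      show ?thesis using rec[of k] conjunct1[OF Suc.IH] *
        unfolding 0 One_nat_def power2_eq_square by (intro conjI impI; linarith)
    next
      case (Suc l)
      then have "1 \<le> k" by simp
      with Suc.IH have "2 * (d 1)\<^sup>2 \<le> e (Suc k) - e k" by blast
      then show ?thesis using rec[of k] * zero_le_power2[of "d 1"]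
        by (intro conjI impI; linarith)
    qed
  qed note inc = this
  have "e k \<ge> 2 * (d 1)\<^sup>2"
    using assms(2)
  proof (induction k rule: nat_induct_at_least)
    case base
    have "e 1 = 0" by (simp add: e_def)
    with inc[of 1] show ?case by (simp add: numeral_2_eq_2)
  next
    case (Suc k)
    then show ?case using inc[of k] by linarith
  qed
  then show ?thesis by (simp add: e_def d_def)
qed

section \<open>Propagation of asymptotic bounds back to the start of a sequence\<close>

text \<open>Each \<open>m j\<close> is at least 1, so \<open>P s\<close> is reduced to strictly
  later indices and the distance to the threshold \<open>N\<close> shrinks.\<close>

lemma eventually_all_backwards:
  fixes P :: "nat \<Rightarrow> bool"
  assumes "eventually P sequentially"
    and "\<And>s. (\<And>j. j \<in> J \<Longrightarrow> P (s + m j)) \<Longrightarrow> P s" and "\<And>j. j \<in> J \<Longrightarrow> 1 \<le> m j"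
  shows "P s"
proof -
  obtain N where N: "\<And>s. s \<ge> N \<Longrightarrow> P s"
    using assms(1) by (auto simp: eventually_sequentially)
  show ?thesis
  proof (induction "N - s" arbitrary: s rule: less_induct)
    case less
    show ?case
    proof (cases "s \<ge> N")
      case False
      show ?thesis
      proof (rule assms(2))
        fix j assume "j \<in> J"
        then show "P (s + m j)" using less[of "s + m j"] assms(3)[of j] False by linarith
      qed
    qed (rule N)
  qed
qed

text \<open>A maximum principle: a weighted mean of values at most \<open>C\<close> is at most
  \<open>C\<close>. It is applied to the modulus of the characteristic function, with a bound just
  above a limit, and to its phase, with an arbitrarily small bound.\<close>

lemma average_le_backwards:
  fixes \<theta> :: "nat \<Rightarrow> real"
  assumes "eventually (\<lambda>s. \<theta> s \<le> C) sequentially"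
    and "\<And>s. \<theta> s \<le> (\<Sum>j\<in>J. q j * \<theta> (s + m j))" and "\<And>j. j \<in> J \<Longrightarrow> 1 \<le> m j"
    and "\<And>j. j \<in> J \<Longrightarrow> 0 \<le> q j" "(\<Sum>j\<in>J. q j) = 1"
  shows "\<theta> s \<le> C"
proof (rule eventually_all_backwards[where P = "\<lambda>s. \<theta> s \<le> C" and J = J and m = m])
  fix s assume "\<And>j. j \<in> J \<Longrightarrow> \<theta> (s + m j) \<le> C"
  then have "(\<Sum>j\<in>J. q j * \<theta> (s + m j)) \<le> (\<Sum>j\<in>J. q j * C)"
    using assms(4) by (intro sum_mono mult_left_mono) auto
  also have "\<dots> = C" using assms(5) by (simp add: sum_distrib_right[symmetric])
  finally show "\<theta> s \<le> C" using assms(2)[of s] by linarith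
qed (use assms in auto)

text \<open>On the unit circle |d - 1|^2 = 2 (1 - Re d), and inserting the factor 1 + Re d >= 1
  makes this at most 2 (Im d)^2. So a phase deviation can be estimated through an imaginary part
  alone.\<close>

lemma unit_close_1:
  assumes "norm (d::complex) = 1" "0 \<le> Re d"
  shows "norm (d - 1) \<le> 2 * \<bar>Im d\<bar>"
proof -
  have a: "(Re d)\<^sup>2 + (Im d)\<^sup>2 = 1" using assms by (simp add: cmod_def)
  have b: "Re d \<le> 1" using complex_Re_le_cmod[of d] assms by simp
  have "norm (d - 1) ^ 2 = 2 * (1 - Re d)"
    using a by (simp add: cmod_power2) (simp add: power2_eq_square algebra_simps)
  also have "\<dots> \<le> 2 * ((1 - Re d) * (1 + Re d))"
    using mult_left_mono[of 1 "1 + Re d" "1 - Re d"] assms b by simp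
  also have "\<dots> = 2 * (Im d)\<^sup>2" using a by (simp add: power2_eq_square algebra_simps)
  also have "\<dots> \<le> (2 * \<bar>Im d\<bar>)\<^sup>2" by (simp add: power_mult_distrib)
  finally show ?thesis by (rule power2_le_imp_le) simp
qed

text \<open>The law at \<open>k u\<close> and \<open>u\<close> is a two-term recurrence in
  \<open>k\<close>, hence the induction on pairs of neighbouring values; evenness settles negative
  integers.\<close>

lemma parallelogram_imp_homogeneous:
  fixes \<psi> :: "real \<Rightarrow> real"
  assumes "0 \<in> N" "\<And>u v. u \<in> N \<Longrightarrow> v \<in> N \<Longrightarrow> u + v \<in> N" "\<And>u. u \<in> N \<Longrightarrow> - u \<in> N"
    and par: "\<And>u v. u \<in> N \<Longrightarrow> v \<in> N \<Longrightarrow> \<psi> (u + v) + \<psi> (u - v) = 2 * \<psi> u + 2 * \<psi> v"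
    and u: "u \<in> N"
  shows "\<psi> (of_int k * u) = of_int k ^ 2 * \<psi> u"
proof -
  have z: "\<psi> 0 = 0" using par[OF assms(1,1)] by simp
  have m: "\<psi> (- v) = \<psi> v" if "v \<in> N" for v
    using par[OF assms(1) that] z by simp
  have mem: "of_nat k * u \<in> N" for k :: nat
    by (induction k) (use assms in \<open>auto simp: algebra_simps\<close>)
  have n: "\<psi> (of_nat k * u) = of_nat k ^ 2 * \<psi> u \<and> \<psi> (of_nat (Suc k) * u) = of_nat (Suc k) ^ 2 * \<psi> u"
    for k :: nat
  proof (induction k)
    case 0
    then show ?case using z by simp
  next
    case (Suc k)
    have "\<psi> (of_nat (Suc k) * u + u) + \<psi> (of_nat (Suc k) * u - u) = 2 * \<psi> (of_nat (Suc k) * u) + 2 * \<psi> u"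
      by (rule par[OF mem u])
    moreover have "of_nat (Suc k) * u + u = of_nat (Suc (Suc k)) * u" "of_nat (Suc k) * u - u = of_nat k * u"
      by (simp_all add: algebra_simps)
    ultimately have "\<psi> (of_nat (Suc (Suc k)) * u) = 2 * \<psi> (of_nat (Suc k) * u) + 2 * \<psi> u - \<psi> (of_nat k * u)"
      by simp
    then show ?case using Suc by (simp add: algebra_simps power2_eq_square)
  qed
  show ?thesis
  proof (cases "k \<ge> 0")
    case True
    then show ?thesis using n[of "nat k"] by simp
  next
    case False
    then have e: "of_int k * u = - (of_nat (nat (-k)) * u)" by simp
    show ?thesis unfolding e m[OF mem] using n[of "nat (-k)"] False by simp
  qed
qed

text \<open>Two nonzero rationals have a common nonzero integer multiple, so homogeneity carries the
  value at a single \<open>r\<close> to all of \<open>N\<close>. It is rank one that leaves just one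
  constant \<open>c\<close>.\<close>

lemma parallelogram_on_rational_subgroup:
  fixes \<psi> :: "real \<Rightarrow> real"
  assumes N: "0 \<in> N" "\<And>u v. u \<in> N \<Longrightarrow> v \<in> N \<Longrightarrow> u + v \<in> N" "\<And>u. u \<in> N \<Longrightarrow> - u \<in> N" "N \<subseteq> \<rat>"
    and par: "\<And>u v. u \<in> N \<Longrightarrow> v \<in> N \<Longrightarrow> \<psi> (u + v) + \<psi> (u - v) = 2 * \<psi> u + 2 * \<psi> v"
    and nonneg: "\<And>u. u \<in> N \<Longrightarrow> 0 \<le> \<psi> u"
  obtains c where "0 \<le> c" "\<And>u. u \<in> N \<Longrightarrow> \<psi> u = c * u\<^sup>2"
proof (cases "N \<subseteq> {0}")
  case True
  have "\<psi> 0 = 0" using par[OF N(1,1)] by simp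
  with True show ?thesis by (intro that[of 0]) auto
next
  case False
  then obtain r where r: "r \<in> N" "r \<noteq> 0" by auto
  have hom: "\<psi> (of_int k * v) = of_int k ^ 2 * \<psi> v" if "v \<in> N" for k v
    using parallelogram_imp_homogeneous[of N \<psi> v k] N par that by blast
  show ?thesis
  proof (rule that[of "\<psi> r / r\<^sup>2"])
    show "0 \<le> \<psi> r / r\<^sup>2" using nonneg[OF r(1)] by simp
    fix u assume u: "u \<in> N"
    have "u / r \<in> \<rat>" using u r N(4) by (auto intro!: Rats_divide)
    then obtain k l where kl: "u / r = of_int k / of_int l" "l > 0"
      by (auto elim!: Rats_cases')
    then have e: "of_int l * u = of_int k * r" using r by (simp add: field_simps)
    have "of_int l ^ 2 * \<psi> u = of_int k ^ 2 * \<psi> r"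
      using hom[OF u, of l] hom[OF r(1), of k] e by simp
    then have "\<psi> u = (of_int k / of_int l) ^ 2 * \<psi> r" using kl by (simp add: field_simps)
    also have "\<dots> = \<psi> r / r\<^sup>2 * u\<^sup>2" unfolding kl(1)[symmetric] by (simp add: field_simps)
    finally show "\<psi> u = \<psi> r / r\<^sup>2 * u\<^sup>2" .
  qed
qed

lemma borel_measurable_cnj' [measurable]: "cnj \<in> borel_measurable borel"
  by (intro borel_measurable_continuous_onI continuous_intros)

text \<open>The sample space stays abstract so that the estimates apply twice: to \<open>M\<close>
  itself and, on \<open>M \<Otimes>\<^sub>M M\<close>, to the symmetrized characters.\<close>

locale character_family = prob_space M for M :: "'a measure" +
  fixes H :: "real set" and \<zeta> :: "real \<Rightarrow> 'a \<Rightarrow> complex" and p :: nat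
  assumes H_zero: "0 \<in> H" and H_add: "u \<in> H \<Longrightarrow> v \<in> H \<Longrightarrow> u + v \<in> H"
    and H_uminus: "u \<in> H \<Longrightarrow> - u \<in> H" and H_divide: "u \<in> H \<Longrightarrow> u / p \<in> H"
    and p: "2 \<le> p"
    and zeta_meas [measurable]: "u \<in> H \<Longrightarrow> \<zeta> u \<in> borel_measurable M"
    and zeta_norm: "u \<in> H \<Longrightarrow> \<omega> \<in> space M \<Longrightarrow> norm (\<zeta> u \<omega>) = 1"
    and zeta_add: "u \<in> H \<Longrightarrow> v \<in> H \<Longrightarrow> \<omega> \<in> space M \<Longrightarrow> \<zeta> (u + v) \<omega> = \<zeta> u \<omega> * \<zeta> v \<omega>"
begin

definition f where "f u = (\<integral>\<omega>. \<zeta> u \<omega> \<partial>M)"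

text \<open>This second moment is the common error term: it controls the parallelogram defect, and
  in its symmetrized form the phase deviation as well.\<close>

definition V where "V u = (\<integral>\<omega>. (1 - Re (\<zeta> u \<omega>))\<^sup>2 \<partial>M)"

lemma H_diff: "u \<in> H \<Longrightarrow> v \<in> H \<Longrightarrow> u - v \<in> H"
  using H_add[OF _ H_uminus, of u v] by simp

lemma H_of_nat_mult: "u \<in> H \<Longrightarrow> of_nat k * u \<in> H"
  by (induction k) (auto simp: algebra_simps H_zero H_add)

lemma H_divide_power: "u \<in> H \<Longrightarrow> u / real p ^ s \<in> H"
proof (induction s)
  case (Suc s)
  then have "u / real p ^ s / real p \<in> H" by (intro H_divide)
  then show ?case by (simp add: mult.commute)
qed simp

lemma zeta_zero: "\<omega> \<in> space M \<Longrightarrow> \<zeta> 0 \<omega> = 1"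
  using zeta_add[OF H_zero H_zero, of \<omega>] zeta_norm[OF H_zero, of \<omega>] by auto

lemma zeta_uminus:
  assumes "u \<in> H" "\<omega> \<in> space M"
  shows "\<zeta> (- u) \<omega> = cnj (\<zeta> u \<omega>)"
proof -
  have 1: "\<zeta> u \<omega> * \<zeta> (- u) \<omega> = 1"
    using zeta_add[OF assms(1) H_uminus[OF assms(1)] assms(2)] zeta_zero assms by simp
  have 2: "\<zeta> u \<omega> * cnj (\<zeta> u \<omega>) = 1"
    using complex_norm_square[of "\<zeta> u \<omega>"] zeta_norm[OF assms] by simp
  have "\<zeta> u \<omega> \<noteq> 0" using zeta_norm[OF assms] by auto
  then show ?thesis using 1 2 by (metis mult_left_cancel)
qed

lemma zeta_power: "u \<in> H \<Longrightarrow> \<omega> \<in> space M \<Longrightarrow> \<zeta> (of_nat k * u) \<omega> = \<zeta> u \<omega> ^ k"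
proof (induction k)
  case (Suc k)
  have e: "of_nat (Suc k) * u = u + of_nat k * u" by (simp add: algebra_simps)
  show ?case unfolding e using Suc by (simp add: zeta_add H_of_nat_mult)
qed (simp add: zeta_zero)

lemma zeta_integrable: "u \<in> H \<Longrightarrow> integrable M (\<zeta> u)"
  by (rule integrable_const_bound[where B = 1]) (auto simp: zeta_norm)

lemma Re_zeta_bound: "u \<in> H \<Longrightarrow> \<omega> \<in> space M \<Longrightarrow> \<bar>Re (\<zeta> u \<omega>)\<bar> \<le> 1"
  using abs_Re_le_cmod[of "\<zeta> u \<omega>"] zeta_norm[of u \<omega>] by simp

lemma prod_bound: "\<bar>a\<bar> \<le> 1 \<Longrightarrow> \<bar>b\<bar> \<le> 1 \<Longrightarrow> \<bar>(1 - a) * (1 - b)\<bar> \<le> (4::real)"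
  using mult_mono[of "\<bar>1-a\<bar>" 2 "\<bar>1-b\<bar>" 2] by (simp add: abs_mult)

lemma integrable_prod:
  "u \<in> H \<Longrightarrow> v \<in> H \<Longrightarrow> integrable M (\<lambda>\<omega>. (1 - Re (\<zeta> u \<omega>)) * (1 - Re (\<zeta> v \<omega>)))"
  by (rule integrable_const_bound[where B = 4])
     (auto intro!: AE_I2 prod_bound Re_zeta_bound simp del: abs_mult)

lemma integrable_square: "u \<in> H \<Longrightarrow> integrable M (\<lambda>\<omega>. (1 - Re (\<zeta> u \<omega>))\<^sup>2)"
  using integrable_prod[of u u] by (simp add: power2_eq_square)

lemma Re_integral: "u \<in> H \<Longrightarrow> (\<integral>\<omega>. Re (\<zeta> u \<omega>) \<partial>M) = Re (f u)"
  unfolding f_def using zeta_integrable by (simp add: integral_Re)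

lemma integrable_Re: "u \<in> H \<Longrightarrow> integrable M (\<lambda>\<omega>. Re (\<zeta> u \<omega>))"
  using zeta_integrable by (simp add: integrable_Re)

lemma f_uminus: "u \<in> H \<Longrightarrow> f (- u) = cnj (f u)"
proof -
  assume "u \<in> H"
  then have "f (- u) = (\<integral>\<omega>. cnj (\<zeta> u \<omega>) \<partial>M)"
    unfolding f_def by (intro Bochner_Integration.integral_cong) (auto simp: zeta_uminus)
  then show ?thesis by (simp add: f_def)
qed

lemma f_zero: "f 0 = 1"
proof -
  have "f 0 = (\<integral>\<omega>. 1 \<partial>M)" unfolding f_def
    by (intro Bochner_Integration.integral_cong) (auto simp: zeta_zero)
  then show ?thesis by (simp add: prob_space)
qed

lemma f_le_1: "u \<in> H \<Longrightarrow> norm (f u) \<le> 1"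
proof -
  assume u: "u \<in> H"
  have "norm (f u) \<le> (\<integral>\<omega>. norm (\<zeta> u \<omega>) \<partial>M)" unfolding f_def by (rule integral_norm_bound)
  also have "\<dots> = (\<integral>\<omega>. 1 \<partial>M)"
    by (intro Bochner_Integration.integral_cong) (auto simp: zeta_norm u)
  finally show ?thesis by (simp add: prob_space)
qed

lemma V_nonneg: "0 \<le> V u"
  unfolding V_def by simp

text \<open>Since \<open>\<zeta> (p * u)\<close> is the p-th power of \<open>\<zeta> u\<close>, this
  is the pointwise power inequality with \<open>k = p\<close>, integrated.\<close>

lemma V_le_increment:
  assumes "u \<in> H"
  shows "2 * V u \<le> real p ^ 2 * (1 - Re (f u)) - (1 - Re (f (real p * u)))"
proof -
  have i: "integrable M (\<lambda>\<omega>. real p ^ 2 * (1 - Re (\<zeta> u \<omega>)) - (1 - Re (\<zeta> (real p * u) \<omega>)))"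
    using assms H_of_nat_mult by (intro Bochner_Integration.integrable_diff integrable_mult_right integrable_Re) auto
  have "2 * V u = (\<integral>\<omega>. 2 * (1 - Re (\<zeta> u \<omega>))\<^sup>2 \<partial>M)" by (simp add: V_def)
  also have "\<dots> \<le> (\<integral>\<omega>. real p ^ 2 * (1 - Re (\<zeta> u \<omega>)) - (1 - Re (\<zeta> (real p * u) \<omega>)) \<partial>M)"
  proof (rule integral_mono[OF _ i])
    show "integrable M (\<lambda>\<omega>. 2 * (1 - Re (\<zeta> u \<omega>))\<^sup>2)"
      using integrable_square[OF assms] by simp
    fix \<omega> assume "\<omega> \<in> space M"
    then show "2 * (1 - Re (\<zeta> u \<omega>))\<^sup>2 \<le> real p ^ 2 * (1 - Re (\<zeta> u \<omega>)) - (1 - Re (\<zeta> (real p * u) \<omega>))"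
      using one_minus_Re_power_le[OF zeta_norm[OF assms, of \<omega>] p] zeta_power[OF assms, of \<omega> p] by simp
  qed
  also have "\<dots> = real p ^ 2 * (1 - Re (f u)) - (1 - Re (f (real p * u)))"
    using assms H_of_nat_mult[OF assms, of p] 
    by (simp add: integrable_Re Re_integral prob_space)
  finally show ?thesis .
qed

text \<open>The defect is -2 times the mean of (1 - Re \<zeta> u)(1 - Re \<zeta> v). Both factors
  are nonnegative, which gives the sign, and 2 a b <= a^2 + b^2 gives the other bound.\<close>

lemma parallelogram_defect:
  assumes "u \<in> H" "v \<in> H"
  defines "D \<equiv> (1 - Re (f (u + v))) + (1 - Re (f (u - v))) - 2 * (1 - Re (f u)) - 2 * (1 - Re (f v))"
  shows "D \<le> 0" "- D \<le> V u + V v"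
proof -
  let ?P = "\<lambda>\<omega>. (1 - Re (\<zeta> u \<omega>)) * (1 - Re (\<zeta> v \<omega>))"
  have mem: "u + v \<in> H" "u - v \<in> H" using assms H_add H_diff by auto
  have "D = (\<integral>\<omega>. (1 - Re (\<zeta> (u + v) \<omega>)) + (1 - Re (\<zeta> (u - v) \<omega>)) - 2 * (1 - Re (\<zeta> u \<omega>)) - 2 * (1 - Re (\<zeta> v \<omega>)) \<partial>M)"
    unfolding D_def using assms(1,2) mem by (simp add: integrable_Re Re_integral prob_space)
  also have "\<dots> = (\<integral>\<omega>. - 2 * ?P \<omega> \<partial>M)"
  proof (rule Bochner_Integration.integral_cong[OF refl])
    fix \<omega> assume w: "\<omega> \<in> space M"
    have "\<zeta> (u - v) \<omega> = \<zeta> u \<omega> * cnj (\<zeta> v \<omega>)"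
      using zeta_add[OF assms(1) H_uminus[OF assms(2)] w] zeta_uminus[OF assms(2) w] by simp
    then show "(1 - Re (\<zeta> (u + v) \<omega>)) + (1 - Re (\<zeta> (u - v) \<omega>)) - 2 * (1 - Re (\<zeta> u \<omega>)) - 2 * (1 - Re (\<zeta> v \<omega>)) = - 2 * ?P \<omega>"
      using Re_mult_unit_parallelogram[OF zeta_norm[OF assms(1) w] zeta_norm[OF assms(2) w]]
        zeta_add[OF assms(1,2) w] by (simp add: algebra_simps)
  qed
  also have "\<dots> = - 2 * (\<integral>\<omega>. ?P \<omega> \<partial>M)" by simp
  finally have D: "D = - 2 * (\<integral>\<omega>. ?P \<omega> \<partial>M)" .
  have "0 \<le> (\<integral>\<omega>. ?P \<omega> \<partial>M)"
  proof (rule Bochner_Integration.integral_nonneg)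
    fix \<omega> assume "\<omega> \<in> space M"
    then show "0 \<le> ?P \<omega>" using Re_zeta_bound[of u \<omega>] Re_zeta_bound[of v \<omega>] assms by auto
  qed
  then show "D \<le> 0" using D by simp
  have "2 * (\<integral>\<omega>. ?P \<omega> \<partial>M) = (\<integral>\<omega>. 2 * ?P \<omega> \<partial>M)" by simp
  also have "\<dots> \<le> (\<integral>\<omega>. (1 - Re (\<zeta> u \<omega>))\<^sup>2 + (1 - Re (\<zeta> v \<omega>))\<^sup>2 \<partial>M)"
  proof (rule integral_mono)
    show "integrable M (\<lambda>\<omega>. 2 * ?P \<omega>)"
      using integrable_prod[OF assms(1,2)] by (rule integrable_mult_right)
    show "integrable M (\<lambda>\<omega>. (1 - Re (\<zeta> u \<omega>))\<^sup>2 + (1 - Re (\<zeta> v \<omega>))\<^sup>2)"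
      using assms by (intro Bochner_Integration.integrable_add integrable_square)
    fix \<omega>
    show "2 * ?P \<omega> \<le> (1 - Re (\<zeta> u \<omega>))\<^sup>2 + (1 - Re (\<zeta> v \<omega>))\<^sup>2"
      using sum_squares_bound[of "1 - Re (\<zeta> u \<omega>)" "1 - Re (\<zeta> v \<omega>)"] by (simp only: mult.assoc)
  qed
  also have "\<dots> = V u + V v" unfolding V_def
    by (rule Bochner_Integration.integral_add) (use assms in \<open>auto intro!: integrable_square\<close>)
  finally show "- D \<le> V u + V v" using D by simp
qed

end

section \<open>Symmetrization and the phase of a triple product\<close>

context character_family
begin

text \<open>The characters at the difference of two independent copies, so that the characteristic
  function becomes |f|^2.\<close>

definition symm where "symm u = (\<lambda>(\<omega>, \<omega>'). \<zeta> u \<omega> * cnj (\<zeta> u \<omega>'))"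

sublocale P: pair_prob_space M M ..

lemma character_family_symm: "character_family (M \<Otimes>\<^sub>M M) H symm p"
proof
  show "symm u \<in> borel_measurable (M \<Otimes>\<^sub>M M)" if [measurable]: "u \<in> H" for u
    unfolding symm_def by measurable
  show "symm (u + v) \<omega> = symm u \<omega> * symm v \<omega>"
    if "u \<in> H" "v \<in> H" "\<omega> \<in> space (M \<Otimes>\<^sub>M M)" for u v \<omega>
    using that by (cases \<omega>) (auto simp: symm_def space_pair_measure zeta_add)
  show "norm (symm u \<omega>) = 1" if "u \<in> H" "\<omega> \<in> space (M \<Otimes>\<^sub>M M)" for u \<omega>
    using that by (cases \<omega>) (auto simp: symm_def space_pair_measure zeta_norm norm_mult)
qed (use p H_zero H_add H_uminus H_divide in auto)

end

locale symmetrized_family = character_family M H \<zeta> p +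
    S: character_family "M \<Otimes>\<^sub>M M" H symm p
  for M :: "'a measure" and H \<zeta> p
begin

lemma symm_f:
  assumes [measurable]: "u \<in> H"
  shows "S.f u = of_real (norm (f u) ^ 2)"
proof -
  have "S.f u = (\<integral>\<omega>. (\<integral>\<omega>'. \<zeta> u \<omega> * cnj (\<zeta> u \<omega>') \<partial>M) \<partial>M)"
    unfolding S.f_def using S.zeta_integrable[OF assms]
    by (subst P.integral_fst'[symmetric]) (simp_all add: symm_def)
  also have "\<dots> = f u * cnj (f u)"
    using zeta_integrable[OF assms] by (simp add: f_def)
  finally show ?thesis by (metis complex_norm_square of_real_power)
qed

text \<open>Conditioning on the first factor of the symmetrized family (Jensen's inequality).\<close>

lemma centered_square_le:
  assumes [measurable]: "u \<in> H"
  shows "integrable M (\<lambda>\<omega>. (1 - Re (\<zeta> u \<omega> * cnj (f u)))\<^sup>2)"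
    "(\<integral>\<omega>. (1 - Re (\<zeta> u \<omega> * cnj (f u)))\<^sup>2 \<partial>M) \<le> S.V u"
proof -
  have b: "\<bar>Re (\<zeta> u \<omega> * cnj (f u))\<bar> \<le> 1" if "\<omega> \<in> space M" for \<omega>
    using abs_Re_le_cmod[of "\<zeta> u \<omega> * cnj (f u)"] zeta_norm[OF assms that] f_le_1[OF assms]
    by (simp add: norm_mult)
  show i: "integrable M (\<lambda>\<omega>. (1 - Re (\<zeta> u \<omega> * cnj (f u)))\<^sup>2)"
    by (rule integrable_const_bound[where B = 4])
       (use b prod_bound in \<open>auto intro!: AE_I2 simp: power2_eq_square simp del: abs_mult\<close>)
  have "S.V u = (\<integral>\<omega>. (\<integral>\<omega>'. (1 - Re (\<zeta> u \<omega> * cnj (\<zeta> u \<omega>')))\<^sup>2 \<partial>M) \<partial>M)"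
    unfolding S.V_def using S.integrable_square[OF assms]
    by (subst P.integral_fst'[symmetric]) (simp_all add: symm_def)
  also have "\<dots> \<ge> (\<integral>\<omega>. (1 - Re (\<zeta> u \<omega> * cnj (f u)))\<^sup>2 \<partial>M)"
  proof (rule integral_mono[OF i])
    show "integrable M (\<lambda>\<omega>. (\<integral>\<omega>'. (1 - Re (\<zeta> u \<omega> * cnj (\<zeta> u \<omega>')))\<^sup>2 \<partial>M))"
      using P.integrable_fst'[OF S.integrable_square[OF assms]] by (simp add: symm_def)
    fix \<omega> assume w: "\<omega> \<in> space M"
    define Y where "Y = (\<lambda>\<omega>'. 1 - Re (\<zeta> u \<omega> * cnj (\<zeta> u \<omega>')))"
    have b: "\<bar>Re (\<zeta> u \<omega> * cnj (\<zeta> u \<omega>'))\<bar> \<le> 1" if "\<omega>' \<in> space M" for \<omega>'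
      using abs_Re_le_cmod[of "\<zeta> u \<omega> * cnj (\<zeta> u \<omega>')"] zeta_norm[OF assms that] zeta_norm[OF assms w]
      by (simp add: norm_mult)
    have [measurable]: "Y \<in> borel_measurable M" unfolding Y_def by measurable
    have i1: "integrable M Y"
      by (rule integrable_const_bound[where B = 2]) (use b in \<open>force intro!: AE_I2 simp: Y_def\<close>)+
    have i2: "integrable M (\<lambda>x. (Y x)\<^sup>2)"
      by (rule integrable_const_bound[where B = 4])
         (use b prod_bound in \<open>auto intro!: AE_I2 simp: Y_def power2_eq_square simp del: abs_mult\<close>)
    have "expectation Y = 1 - Re (\<zeta> u \<omega> * cnj (f u))"
    proof -
      have "expectation Y = 1 - Re (\<integral>\<omega>'. \<zeta> u \<omega> * cnj (\<zeta> u \<omega>') \<partial>M)"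
        unfolding Y_def using zeta_integrable[OF assms]
        by (subst Bochner_Integration.integral_diff) (auto simp: prob_space integral_Re)
      then show ?thesis by (simp add: f_def)
    qed
    moreover have "0 \<le> expectation (\<lambda>x. (Y x)\<^sup>2) - (expectation Y)\<^sup>2"
      unfolding variance_eq[OF i1 i2, symmetric] by simp
    ultimately show "(1 - Re (\<zeta> u \<omega> * cnj (f u)))\<^sup>2 \<le> (\<integral>\<omega>'. (1 - Re (\<zeta> u \<omega> * cnj (\<zeta> u \<omega>')))\<^sup>2 \<partial>M)"
      by (simp only: Y_def diff_ge_0_iff_ge)
  qed
  finally show "(\<integral>\<omega>. (1 - Re (\<zeta> u \<omega> * cnj (f u)))\<^sup>2 \<partial>M) \<le> S.V u" .
qed

definition w where "w u = 1 - norm (f u) ^ 2"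

lemma w_nonneg: "u \<in> H \<Longrightarrow> 0 \<le> w u"
  using f_le_1[of u] by (auto simp: w_def power_le_one)

lemma w_symm: "u \<in> H \<Longrightarrow> w u = 1 - Re (S.f u)"
  by (simp add: symm_f w_def)

lemma w_integral:
  assumes [measurable]: "u \<in> H"
  shows "(\<integral>\<omega>. 1 - Re (\<zeta> u \<omega> * cnj (f u)) \<partial>M) = w u"
proof -
  have "(\<integral>\<omega>. 1 - Re (\<zeta> u \<omega> * cnj (f u)) \<partial>M) = 1 - Re (\<integral>\<omega>. \<zeta> u \<omega> * cnj (f u) \<partial>M)"
    using zeta_integrable[OF assms] by (subst Bochner_Integration.integral_diff) (auto simp: prob_space integral_Re)
  also have "\<dots> = 1 - Re (f u * cnj (f u))" by (simp add: f_def)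
  also have "\<dots> = w u" unfolding w_def
    by (metis Re_complex_of_real complex_norm_square)
  finally show ?thesis .
qed

text \<open>Its phase measures how far \<open>sgn f\<close> is from being multiplicative. Unlike
  that phase it is a mean, namely of the product of the centered characters
  \<open>\<zeta> u * cnj (f u)\<close> and \<open>\<zeta> v * cnj (f v)\<close>.\<close>

definition tri where "tri u v = f (u + v) * cnj (f u) * cnj (f v)"

text \<open>The centered character \<open>Z r\<close> has the real mean 1 - w r, so the product (Z u
  - 1)(Z v - 1) has the same mean imaginary part as \<open>tri u v\<close> while being small of
  second order. The parameter \<eta> is kept free because \<open>S.V\<close> will be of smaller
  order than \<open>w\<close>: fix \<eta> small first, and the quotient by \<eta> still vanishes in
  the limit.\<close>

lemma tri_bounds:
  assumes [measurable]: "u \<in> H" "v \<in> H" and \<eta>: "\<eta> > 0"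
  shows "1 - 2 * w u - 2 * w v \<le> Re (tri u v)"
    "\<bar>Im (tri u v)\<bar> \<le> (S.V u + S.V v) / \<eta> + \<eta> * (w u + w v)"
proof -
  define Z where "Z u \<omega> = \<zeta> u \<omega> * cnj (f u)" for u \<omega>
  have Z1: "norm (Z r \<omega>) \<le> 1" if "r \<in> H" "\<omega> \<in> space M" for r \<omega>
    using that f_le_1[of r] zeta_norm[of r \<omega>] by (simp add: Z_def norm_mult)
  have [measurable]: "Z u \<in> borel_measurable M" "Z v \<in> borel_measurable M" unfolding Z_def by measurable
  have uv: "u + v \<in> H" using assms H_add by auto
  have iZ: "integrable M (Z r)" if "r \<in> H" for r
    unfolding Z_def using zeta_integrable[OF that] by simp
  have iZZ: "integrable M (\<lambda>\<omega>. Z u \<omega> * Z v \<omega>)"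
    by (rule integrable_const_bound[where B = 1])
       (use Z1 assms(1,2) in \<open>auto intro!: AE_I2 mult_le_one simp: norm_mult\<close>)
  have EZ: "(\<integral>\<omega>. Z r \<omega> \<partial>M) = of_real (1 - w r)" if "r \<in> H" for r
    by (simp add: Z_def f_def[symmetric] w_def complex_norm_square[symmetric] flip: of_real_power)
  have EZZ: "(\<integral>\<omega>. Z u \<omega> * Z v \<omega> \<partial>M) = tri u v"
  proof -
    have "(\<integral>\<omega>. Z u \<omega> * Z v \<omega> \<partial>M) = (\<integral>\<omega>. \<zeta> (u + v) \<omega> * (cnj (f u) * cnj (f v)) \<partial>M)"
      by (rule Bochner_Integration.integral_cong) (use assms in \<open>auto simp: Z_def zeta_add\<close>)
    then show ?thesis by (simp add: tri_def f_def mult.assoc)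
  qed
  define Q where "Q \<omega> = (Z u \<omega> - 1) * (Z v \<omega> - 1)" for \<omega>
  have Qe: "Q = (\<lambda>\<omega>. Z u \<omega> * Z v \<omega> - Z u \<omega> - Z v \<omega> + 1)" by (auto simp: Q_def algebra_simps)
  have iQ: "integrable M Q" unfolding Qe using iZ iZZ assms by auto
  have EQ: "(\<integral>\<omega>. Q \<omega> \<partial>M) = tri u v + of_real (w u + w v - 1)"
    unfolding Qe using iZ iZZ assms by (simp add: EZ EZZ prob_space)
  define k where "k r \<omega> = 1 - Re (Z r \<omega>)" for r \<omega>
  have ik: "integrable M (k r)" "integrable M (\<lambda>\<omega>. (k r \<omega>)\<^sup>2)" "(\<integral>\<omega>. k r \<omega> \<partial>M) = w r"
    "(\<integral>\<omega>. (k r \<omega>)\<^sup>2 \<partial>M) \<le> S.V r" if "r \<in> H" for r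
  proof -
    show "integrable M (k r)" unfolding k_def
      using iZ[OF that] by (intro Bochner_Integration.integrable_diff integrable_Re) auto
  qed (use centered_square_le[OF that] w_integral[OF that] in \<open>simp_all only: k_def Z_def\<close>)
  have "\<bar>Re (\<integral>\<omega>. Q \<omega> \<partial>M)\<bar> \<le> norm (\<integral>\<omega>. Q \<omega> \<partial>M)" by (rule abs_Re_le_cmod)
  also have "\<dots> \<le> (\<integral>\<omega>. norm (Q \<omega>) \<partial>M)" by (rule integral_norm_bound)
  also have "\<dots> \<le> (\<integral>\<omega>. k u \<omega> + k v \<omega> \<partial>M)"
  proof (rule integral_mono)
    fix \<omega> assume w: "\<omega> \<in> space M"
    have "2 * norm (Q \<omega>) \<le> norm (Z u \<omega> - 1) ^ 2 + norm (Z v \<omega> - 1) ^ 2"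
      unfolding Q_def norm_mult using sum_squares_bound by (simp add: mult.assoc[symmetric])
    also have "\<dots> \<le> 2 * k u \<omega> + 2 * k v \<omega>"
      unfolding k_def using assms w by (intro add_mono one_minus_Re_square_le Z1) auto
    finally show "norm (Q \<omega>) \<le> k u \<omega> + k v \<omega>" by simp
  qed (use iQ ik assms in auto)
  also have "\<dots> = w u + w v" using ik assms by simp
  finally show "1 - 2 * w u - 2 * w v \<le> Re (tri u v)" unfolding EQ by simp
  have "\<bar>Im (tri u v)\<bar> = \<bar>\<integral>\<omega>. Im (Q \<omega>) \<partial>M\<bar>"
    using EQ iQ by (simp add: integral_Im)
  also have "\<dots> \<le> (\<integral>\<omega>. \<bar>Im (Q \<omega>)\<bar> \<partial>M)" by (rule integral_abs_bound)
  also have "\<dots> \<le> (\<integral>\<omega>. ((k u \<omega>)\<^sup>2 + (k v \<omega>)\<^sup>2) / \<eta> + \<eta> * (k u \<omega> + k v \<omega>) \<partial>M)"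
  proof (rule integral_mono)
    show "integrable M (\<lambda>\<omega>. \<bar>Im (Q \<omega>)\<bar>)" using iQ by (simp add: integrable_Im)
    show "integrable M (\<lambda>\<omega>. ((k u \<omega>)\<^sup>2 + (k v \<omega>)\<^sup>2) / \<eta> + \<eta> * (k u \<omega> + k v \<omega>))"
      using ik assms by simp
    fix \<omega> assume w: "\<omega> \<in> space M"
    \<comment> \<open>The small weight \<eta> goes to the imaginary part, whose square is only as
      small as \<open>k\<close>; the large weight goes to \<open>k\<close>, whose second moment is
      of smaller order.\<close>
    have amgm: "\<bar>x * y\<bar> \<le> x\<^sup>2 / \<eta> + \<eta> * y\<^sup>2 / 2" for x y :: real
    proof -
      have "0 \<le> (\<bar>x\<bar> - \<eta> * \<bar>y\<bar>)\<^sup>2" by simp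
      then have "2 * \<eta> * \<bar>x * y\<bar> \<le> x\<^sup>2 + \<eta>\<^sup>2 * y\<^sup>2"
        by (simp add: power2_diff power_mult_distrib abs_mult algebra_simps)
      then have "\<bar>x * y\<bar> \<le> x\<^sup>2 / (2 * \<eta>) + \<eta> * y\<^sup>2 / 2" using \<eta> by (simp add: field_simps power2_eq_square)
      moreover have "x\<^sup>2 / (2 * \<eta>) \<le> x\<^sup>2 / \<eta>" using \<eta> by (intro divide_left_mono) auto
      ultimately show ?thesis by linarith
    qed
    have im: "\<eta> * (Im (Z r \<omega>))\<^sup>2 / 2 \<le> \<eta> * k r \<omega>" if "r \<in> H" for r
      using mult_left_mono[OF one_minus_Re_square_le(1)[OF Z1[OF that w]], of \<eta>] \<eta> by (simp add: k_def)
    have "Im (Q \<omega>) = - (k u \<omega> * Im (Z v \<omega>)) - k v \<omega> * Im (Z u \<omega>)"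
      by (simp add: Q_def k_def algebra_simps)
    then have "\<bar>Im (Q \<omega>)\<bar> \<le> \<bar>k u \<omega> * Im (Z v \<omega>)\<bar> + \<bar>k v \<omega> * Im (Z u \<omega>)\<bar>" by linarith
    also have "\<dots> \<le> ((k u \<omega>)\<^sup>2 / \<eta> + \<eta> * (Im (Z v \<omega>))\<^sup>2 / 2) + ((k v \<omega>)\<^sup>2 / \<eta> + \<eta> * (Im (Z u \<omega>))\<^sup>2 / 2)"
      by (intro add_mono amgm)
    also have "\<dots> \<le> ((k u \<omega>)\<^sup>2 + (k v \<omega>)\<^sup>2) / \<eta> + \<eta> * (k u \<omega> + k v \<omega>)"
      using im[OF assms(1)] im[OF assms(2)] by (simp add: add_divide_distrib algebra_simps)
    finally show "\<bar>Im (Q \<omega>)\<bar> \<le> ((k u \<omega>)\<^sup>2 + (k v \<omega>)\<^sup>2) / \<eta> + \<eta> * (k u \<omega> + k v \<omega>)" .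
  qed
  also have "\<dots> = ((\<integral>\<omega>. (k u \<omega>)\<^sup>2 \<partial>M) + (\<integral>\<omega>. (k v \<omega>)\<^sup>2 \<partial>M)) / \<eta> + \<eta> * (w u + w v)"
    using ik assms by simp
  also have "\<dots> \<le> (S.V u + S.V v) / \<eta> + \<eta> * (w u + w v)"
    using ik assms by (intro add_mono divide_right_mono) auto
  finally show "\<bar>Im (tri u v)\<bar> \<le> (S.V u + S.V v) / \<eta> + \<eta> * (w u + w v)" .
qed

end

lemma cnj_sgn: "cnj (sgn z) = sgn (cnj z)"
  by (simp add: sgn_eq)

lemma sgn_prod_complex: "sgn (\<Prod>j\<in>J. g j :: complex) = (\<Prod>j\<in>J. sgn (g j))"
  by (induction J rule: infinite_finite_induct) (auto simp: sgn_mult)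

section \<open>The equation for the characteristic function\<close>

locale character_equation = symmetrized_family M H \<zeta> p for M :: "'a measure" and H \<zeta> p +
  fixes J :: "'j set" and \<epsilon> :: "'j \<Rightarrow> real" and m :: "'j \<Rightarrow> nat"
  assumes J: "finite J" "J \<noteq> {}"
    and \<epsilon>: "j \<in> J \<Longrightarrow> \<epsilon> j = 1 \<or> \<epsilon> j = -1" and m: "j \<in> J \<Longrightarrow> 1 \<le> m j"
    and weights: "(\<Sum>j\<in>J. 1 / real p ^ (2 * m j)) = 1"
    and eq: "u \<in> H \<Longrightarrow> f u = (\<Prod>j\<in>J. f (\<epsilon> j * u / real p ^ m j))"
    and H_rat: "H \<subseteq> \<rat>"
begin

definition N where "N = {u\<in>H. f u \<noteq> 0}"

text \<open>The squared modulus makes this the logarithm belonging to the symmetrized family, with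
  \<open>w\<close> as its first-order approximation for small values.\<close>

definition psi where "psi u = - ln (norm (f u) ^ 2)"

definition W where "W s u = real p ^ (2 * s) * w (u / real p ^ s)"

lemma p_pos: "real p > 0"
  using p by simp

text \<open>The signs disappear because \<open>f (- u)\<close> is the conjugate of
  \<open>f u\<close>.\<close>

lemma norm_eq: "u \<in> H \<Longrightarrow> norm (f u) = (\<Prod>j\<in>J. norm (f (u / real p ^ m j)))"
proof -
  assume u: "u \<in> H"
  have "norm (f (\<epsilon> j * u / real p ^ m j)) = norm (f (u / real p ^ m j))" if "j \<in> J" for j
    using \<epsilon>[OF that] f_uminus[OF H_divide_power[OF u, of "m j"]] by auto
  then have "(\<Prod>j\<in>J. norm (f (\<epsilon> j * u / real p ^ m j))) = (\<Prod>j\<in>J. norm (f (u / real p ^ m j)))"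
    by (intro prod.cong refl)
  then show ?thesis by (subst eq[OF u]) (simp only: prod_norm)
qed

lemma N_iff: "u \<in> H \<Longrightarrow> u \<in> N \<longleftrightarrow> (\<forall>j\<in>J. u / real p ^ m j \<in> N)"
proof -
  assume u: "u \<in> H"
  have "f u = 0 \<longleftrightarrow> (\<exists>j\<in>J. f (u / real p ^ m j) = 0)"
  proof -
    have "norm (f u) = 0 \<longleftrightarrow> (\<exists>j\<in>J. norm (f (u / real p ^ m j)) = 0)"
      unfolding norm_eq[OF u] using J(1) by (rule prod_zero_iff)
    then show ?thesis by (simp only: norm_eq_zero)
  qed
  then show ?thesis using u by (auto simp: N_def H_divide_power)
qed

lemma N_H: "u \<in> N \<Longrightarrow> u \<in> H"
  by (simp add: N_def)

lemma psi_eq: "u \<in> N \<Longrightarrow> psi u = (\<Sum>j\<in>J. psi (u / real p ^ m j))"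
proof -
  assume u: "u \<in> N"
  have "psi u = - ln (\<Prod>j\<in>J. norm (f (u / real p ^ m j)) ^ 2)"
    by (simp add: psi_def norm_eq[OF N_H[OF u]] prod_power_distrib)
  also have "\<dots> = (\<Sum>j\<in>J. psi (u / real p ^ m j))"
    using N_iff[OF N_H[OF u]] u J(1)
    by (subst ln_prod) (auto simp: psi_def sum_negf N_def)
  finally show ?thesis .
qed

lemma divide_power_divide_power: "u / real p ^ s / real p ^ k = u / real p ^ (s + k)"
  by (simp only: divide_divide_eq_left power_add)

lemma power_double_add: "real p ^ (2 * (s + k)) = real p ^ (2 * s) * real p ^ (2 * k)"
  by (simp only: distrib_left power_add)

lemma power_double_nonzero: "real p ^ (2 * k) \<noteq> 0"
  using p_pos by simp

text \<open>Passing to \<open>u / p ^ k\<close> advances the index by \<open>k\<close> and costs the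
  factor 1/p^(2 k), the very weight of a summand in \<open>weights\<close>.\<close>

lemma W_shift: "W s (u / real p ^ k) = W (s + k) u / real p ^ (2 * k)"
proof -
  have "a * x = a * b * x / b" if "b \<noteq> 0" for a b x :: real using that by simp
  from this[OF power_double_nonzero] show ?thesis
    unfolding W_def divide_power_divide_power power_double_add add.commute[of k s] .
qed

lemma weight_scale: "1 / real p ^ (2 * k) * (real p ^ (2 * (s + k)) * x) = real p ^ (2 * s) * x"
proof -
  have "1 / b * (a * b * x) = a * x" if "b \<noteq> 0" for a b :: real using that by simp
  from this[OF power_double_nonzero] show ?thesis unfolding power_double_add .
qed

lemma W_nonneg: "u \<in> H \<Longrightarrow> 0 \<le> W s u"
  using w_nonneg[OF H_divide_power] by (simp add: W_def)

lemma W_increment: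
  assumes "u \<in> H"
  shows "2 * (real p ^ (2 * s) * S.V (u / real p ^ Suc s)) \<le> W (Suc s) u - W s u"
proof -
  let ?v = "u / real p ^ Suc s"
  have v: "?v \<in> H" using assms by (rule H_divide_power)
  have pv: "real p * ?v = u / real p ^ s" using p_pos by simp
  have "2 * S.V ?v \<le> real p ^ 2 * w ?v - w (u / real p ^ s)"
    using S.V_le_increment[OF v] unfolding pv by (simp only: w_symm v H_divide_power[OF assms])
  then have "real p ^ (2 * s) * (2 * S.V ?v) \<le> real p ^ (2 * s) * (real p ^ 2 * w ?v - w (u / real p ^ s))"
    by (rule mult_left_mono) simp
  also have "\<dots> = W (Suc s) u - W s u"
    unfolding W_def right_diff_distrib mult.assoc[symmetric] power_add[symmetric] by simp
  finally show ?thesis by (simp only: mult.left_commute)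
qed

lemma W_mono: "u \<in> H \<Longrightarrow> s \<le> t \<Longrightarrow> W s u \<le> W t u"
proof (rule lift_Suc_mono_le[of "\<lambda>s. W s u"])
  fix n assume "u \<in> H"
  moreover have "0 \<le> real p ^ (2 * n) * S.V (u / real p ^ Suc n)"
    using S.V_nonneg by simp
  ultimately show "W n u \<le> W (Suc n) u" using W_increment[of u n] by linarith
qed

text \<open>Induction with \<open>u\<close> free. The weights write \<open>W (Suc s) u\<close> as an
  average; since \<open>m j\<close> is at least 1, monotonicity raises the j-th term to
  \<open>W (s + m j) u\<close>, which the shift identifies with \<open>W s\<close> at
  \<open>u / p ^ m j\<close>, one index lower. The start is 1 - x <= - ln x.\<close>

lemma W_le_psi: "u \<in> N \<Longrightarrow> W s u \<le> psi u"
proof (induction s arbitrary: u)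
  case 0
  then have "0 < norm (f u) ^ 2" by (auto simp: N_def)
  then show ?case using ln_le_minus_one[of "norm (f u) ^ 2"] by (simp add: W_def w_def psi_def)
next
  case (Suc s)
  have "W (Suc s) u = (\<Sum>j\<in>J. 1 / real p ^ (2 * m j)) * W (Suc s) u"
    by (simp add: weights)
  also have "\<dots> = (\<Sum>j\<in>J. W (Suc s) u / real p ^ (2 * m j))"
    by (simp add: sum_distrib_right)
  also have "\<dots> \<le> (\<Sum>j\<in>J. W (s + m j) u / real p ^ (2 * m j))"
    using W_mono[OF N_H[OF Suc.prems]] m by (intro sum_mono divide_right_mono) auto
  also have "\<dots> = (\<Sum>j\<in>J. W s (u / real p ^ m j))"
    by (simp add: W_shift)
  also have "\<dots> \<le> (\<Sum>j\<in>J. psi (u / real p ^ m j))"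
    using N_iff[OF N_H[OF Suc.prems]] Suc by (intro sum_mono) auto
  finally show ?case using psi_eq[OF Suc.prems] by simp
qed

lemma psi_nonneg: "u \<in> H \<Longrightarrow> 0 \<le> psi u"
  using f_le_1[of u] by (cases "f u = 0") (auto simp: psi_def ln_le_zero_iff power_le_one)

lemma power_tendsto_zero: "(\<lambda>s. c / real p ^ (2 * s)) \<longlonglongrightarrow> 0"
proof -
  have "(\<lambda>s. c * (1 / real p ^ 2) ^ s) \<longlonglongrightarrow> c * 0"
  proof (intro tendsto_intros LIMSEQ_power_zero)
    have "1 < real p ^ 2" using p by (intro one_less_power) auto
    then show "norm (1 / real p ^ 2) < 1" using p by (simp add: divide_less_eq_1)
  qed
  moreover have "c * (1 / real p ^ 2) ^ s = c / real p ^ (2 * s)" for s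
    by (simp only: power_mult power_divide power_one times_divide_eq_right mult_1_right)
  ultimately show ?thesis by (simp only: mult_zero_right)
qed

lemma w_tendsto: "u \<in> N \<Longrightarrow> (\<lambda>s. w (u / real p ^ s)) \<longlonglongrightarrow> 0"
proof (rule tendsto_sandwich[of "\<lambda>_. 0"])
  assume u: "u \<in> N"
  show "\<forall>\<^sub>F s in sequentially. w (u / real p ^ s) \<le> psi u / real p ^ (2 * s)"
    using W_le_psi[OF u] p_pos
    by (intro always_eventually allI)
       (simp only: W_def pos_le_divide_eq zero_less_power mult.commute[of "w _"])
  show "\<forall>\<^sub>F s in sequentially. 0 \<le> w (u / real p ^ s)"
    using w_nonneg[OF H_divide_power[OF N_H[OF u]]] by simp
qed (rule tendsto_const, rule power_tendsto_zero)

text \<open>\<open>W\<close> is increasing and bounded by \<open>psi\<close>, so it converges and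
  its increments die out. This is the little o behind both the parallelogram law and the phase
  estimate.\<close>

lemma scaled_V_tendsto: "u \<in> N \<Longrightarrow> (\<lambda>s. real p ^ (2 * s) * S.V (u / real p ^ s)) \<longlonglongrightarrow> 0"
proof -
  assume u: "u \<in> N"
  have "Bseq (\<lambda>s. W s u)"
    by (rule BseqI'[of _ "psi u"]) (use W_le_psi[OF u] W_nonneg[OF N_H[OF u]] in auto)
  moreover have "monoseq (\<lambda>s. W s u)"
    using W_mono[OF N_H[OF u]] by (auto simp: monoseq_def)
  ultimately have "convergent (\<lambda>s. W s u)" by (rule Bseq_monoseq_convergent)
  then obtain L where L: "(\<lambda>s. W s u) \<longlonglongrightarrow> L" by (auto simp: convergent_def)
  have "(\<lambda>s. real p ^ 2 / 2 * (W (Suc s) u - W s u)) \<longlonglongrightarrow> real p ^ 2 / 2 * (L - L)"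
    by (intro tendsto_intros LIMSEQ_Suc L)
  then have lim: "(\<lambda>s. real p ^ 2 / 2 * (W (Suc s) u - W s u)) \<longlonglongrightarrow> 0" by simp
  have "(\<lambda>s. real p ^ (2 * Suc s) * S.V (u / real p ^ Suc s)) \<longlonglongrightarrow> 0"
  proof (rule tendsto_sandwich[OF _ _ tendsto_const lim])
    show "\<forall>\<^sub>F s in sequentially. 0 \<le> real p ^ (2 * Suc s) * S.V (u / real p ^ Suc s)"
      using S.V_nonneg by (intro always_eventually) simp
    show "\<forall>\<^sub>F s in sequentially. real p ^ (2 * Suc s) * S.V (u / real p ^ Suc s)
        \<le> real p ^ 2 / 2 * (W (Suc s) u - W s u)"
    proof (intro always_eventually allI)
      fix s
      have "real p ^ 2 / 2 * (2 * (real p ^ (2 * s) * S.V (u / real p ^ Suc s)))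
          \<le> real p ^ 2 / 2 * (W (Suc s) u - W s u)"
        by (intro mult_left_mono W_increment N_H u) simp
      then show "real p ^ (2 * Suc s) * S.V (u / real p ^ Suc s)
        \<le> real p ^ 2 / 2 * (W (Suc s) u - W s u)"
        by (simp add: power2_eq_square mult_ac)
    qed
  qed
  then show ?thesis by (subst (asm) filterlim_sequentially_Suc)
qed

text \<open>Only the upper bound on \<open>psi\<close> is new. From - ln (1 - w) <= w / (1 - w) and
  w -> 0, the scaled \<open>psi\<close> at \<open>u / p ^ s\<close> is eventually below any
  \<open>C\<close> that exceeds a bound \<open>C0\<close> of all \<open>W s u\<close>; as
  \<open>psi\<close> satisfies the equation exactly, this bound descends to
  \<open>s = 0\<close>.\<close>

lemma psi_tendsto: "u \<in> N \<Longrightarrow> (\<lambda>s. W s u) \<longlonglongrightarrow> psi u"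
proof -
  assume u: "u \<in> N"
  have uN: "u / real p ^ s \<in> N" if "w (u / real p ^ s) < 1" for s
    using that H_divide_power[OF N_H[OF u], of s] by (auto simp: N_def w_def)
  have le: "psi u \<le> C" if C: "\<And>s. W s u \<le> C0" "C0 < C" for C0 C
  proof -
    have C0: "0 \<le> C0" using W_nonneg[OF N_H[OF u], of 0] C(1)[of 0] by linarith
    have "real p ^ (2 * 0) * psi (u / real p ^ 0) \<le> C"
    proof (rule average_le_backwards[where J = J and q = "\<lambda>j. 1 / real p ^ (2 * m j)" and m = m])
      have lim: "(\<lambda>s. C0 / (1 - w (u / real p ^ s))) \<longlonglongrightarrow> C0 / (1 - 0)"
        by (intro tendsto_intros w_tendsto u) simp
      have ev1: "\<forall>\<^sub>F s in sequentially. C0 / (1 - w (u / real p ^ s)) < C"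
        using order_tendstoD(2)[OF lim, of C] C by simp
      have ev2: "\<forall>\<^sub>F s in sequentially. w (u / real p ^ s) < 1"
        using order_tendstoD(2)[OF w_tendsto[OF u], of 1] by simp
      show "\<forall>\<^sub>F s in sequentially. real p ^ (2 * s) * psi (u / real p ^ s) \<le> C"
        using ev1 ev2
      proof eventually_elim
        case (elim s)
        let ?w = "w (u / real p ^ s)"
        have "psi (u / real p ^ s) = - ln (1 - ?w)" by (simp add: psi_def w_def)
        also have "\<dots> = ln (1 / (1 - ?w))" using elim by (simp add: ln_div)
        also have "\<dots> \<le> 1 / (1 - ?w) - 1" using elim by (intro ln_le_minus_one) simp
        also have "\<dots> = ?w / (1 - ?w)" using elim by (simp add: field_simps)
        finally have "real p ^ (2 * s) * psi (u / real p ^ s) \<le> real p ^ (2 * s) * (?w / (1 - ?w))"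
          by (rule mult_left_mono) simp
        also have "\<dots> = W s u / (1 - ?w)" by (simp add: W_def)
        also have "\<dots> \<le> C0 / (1 - ?w)" using elim C(1) by (intro divide_right_mono) auto
        finally show ?case using elim by linarith
      qed
    next
      \<comment> \<open>Closure of \<open>N\<close> under division by \<open>p\<close> is not yet
        available at this point. Along this one sequence it follows from large \<open>s\<close>,
        where \<open>w\<close> is below 1, by descending through the equation.\<close>
      have "u / real p ^ s \<in> N" for s
      proof (rule eventually_all_backwards[where P = "\<lambda>s. u / real p ^ s \<in> N" and J = J and m = m])
        show "\<forall>\<^sub>F s in sequentially. u / real p ^ s \<in> N"
          using order_tendstoD(2)[OF w_tendsto[OF u], of 1] by (auto elim!: eventually_mono intro: uN)
        show "u / real p ^ s \<in> N" if "\<And>j. j \<in> J \<Longrightarrow> u / real p ^ (s + m j) \<in> N" for s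
          using that by (subst N_iff) (auto intro!: H_divide_power N_H[OF u] simp: power_add)
      qed (use m in auto)
      note N = this
      show "real p ^ (2 * s) * psi (u / real p ^ s) \<le>
          (\<Sum>j\<in>J. 1 / real p ^ (2 * m j) * (real p ^ (2 * (s + m j)) * psi (u / real p ^ (s + m j))))" for s
        by (subst psi_eq[OF N])
          (simp only: sum_distrib_left weight_scale divide_power_divide_power order_refl)
    qed (use m weights in auto)
    then show ?thesis by simp
  qed
  have inc: "incseq (\<lambda>s. W s u)" using W_mono[OF N_H[OF u]] by (auto simp: incseq_def)
  obtain L where L: "(\<lambda>s. W s u) \<longlonglongrightarrow> L" "\<And>s. W s u \<le> L"
    using incseq_convergent[OF inc, of "psi u"] W_le_psi[OF u] by auto
  have "psi u \<le> L" by (rule field_le_epsilon) (use le[OF L(2)] in auto)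
  moreover have "L \<le> psi u" using W_le_psi[OF u] by (intro LIMSEQ_le_const2[OF L(1)]) auto
  ultimately show ?thesis using L by simp
qed

lemma N_zero: "0 \<in> N"
  by (simp add: N_def f_zero H_zero)

lemma N_uminus: "u \<in> N \<Longrightarrow> - u \<in> N"
  by (simp add: N_def f_uminus H_uminus)

text \<open>At a late index the parallelogram inequality gives w (u + v) <= 2 w u + 2 w v < 1 for
  the divided arguments, so \<open>f\<close> does not vanish there; the equation carries this back
  to \<open>u + v\<close>.\<close>

lemma N_add:
  assumes "u \<in> N" "v \<in> N"
  shows "u + v \<in> N"
proof -
  have mem: "u \<in> H" "v \<in> H" "u + v \<in> H" using assms by (auto intro: N_H H_add)
  have "(u + v) / real p ^ s \<in> N" for s
  proof (rule eventually_all_backwards[where P = "\<lambda>s. (u + v) / real p ^ s \<in> N" and J = J and m = m])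
    have "(\<lambda>s. 2 * w (u / real p ^ s) + 2 * w (v / real p ^ s)) \<longlonglongrightarrow> 2 * 0 + 2 * 0"
      by (intro tendsto_intros w_tendsto assms)
    then have "\<forall>\<^sub>F s in sequentially. 2 * w (u / real p ^ s) + 2 * w (v / real p ^ s) < 1"
      by (rule order_tendstoD) simp
    then show "\<forall>\<^sub>F s in sequentially. (u + v) / real p ^ s \<in> N"
    proof eventually_elim
      case (elim s)
      have h: "u / real p ^ s \<in> H" "v / real p ^ s \<in> H" "u / real p ^ s + v / real p ^ s \<in> H"
        "u / real p ^ s - v / real p ^ s \<in> H" using mem by (auto intro: H_divide_power H_add H_diff)
      have "w (u / real p ^ s + v / real p ^ s) + w (u / real p ^ s - v / real p ^ s)
          - 2 * w (u / real p ^ s) - 2 * w (v / real p ^ s) \<le> 0"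
        using S.parallelogram_defect(1)[OF h(1,2)] by (simp only: w_symm h)
      then have "w (u / real p ^ s + v / real p ^ s) < 1"
        using w_nonneg[OF h(4)] elim by argo
      then show ?case using h(3) by (auto simp: N_def w_def add_divide_distrib)
    qed
    show "(u + v) / real p ^ s \<in> N" if "\<And>j. j \<in> J \<Longrightarrow> (u + v) / real p ^ (s + m j) \<in> N" for s
      using that by (subst N_iff) (auto intro!: H_divide_power mem simp: power_add)
  qed (use m in auto)
  from this[of 0] show ?thesis by simp
qed

lemma N_of_nat_mult: "u \<in> N \<Longrightarrow> of_nat k * u \<in> N"
proof (induction k)
  case (Suc k)
  then have "of_nat k * u + u \<in> N" by (intro N_add)
  then show ?case by (simp only: of_nat_Suc distrib_right mult_1 add.commute)
qed (simp add: N_zero)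

text \<open>The equation only yields \<open>u / p ^ m j\<close> for the exponents that occur;
  additivity of \<open>N\<close> multiplies this back by p^(m j - 1).\<close>

lemma N_divide:
  assumes "u \<in> N"
  shows "u / real p \<in> N"
proof -
  obtain j where j: "j \<in> J" using J by auto
  then have "u / real p ^ m j \<in> N" using N_iff[OF N_H[OF assms]] assms by auto
  then have "of_nat (p ^ (m j - 1)) * (u / real p ^ m j) \<in> N" by (rule N_of_nat_mult)
  moreover have "of_nat (p ^ (m j - 1)) * (u / real p ^ m j) = u / real p"
  proof -
    obtain i where "m j = Suc i" using m[OF j] by (cases "m j") auto
    then show ?thesis using p_pos by simp
  qed
  ultimately show ?thesis by simp
qed

lemma N_divide_power: "u \<in> N \<Longrightarrow> u / real p ^ s \<in> N"
proof (induction s)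
  case (Suc s)
  then have "u / real p ^ s / real p \<in> N" by (intro N_divide)
  then show ?case by (simp add: mult.commute)
qed simp

text \<open>The scaled defect of \<open>w\<close> lies between 0 and a negative sum of scaled second
  moments, which tends to 0, while \<open>W\<close> tends to \<open>psi\<close>.\<close>

lemma psi_parallelogram:
  assumes "u \<in> N" "v \<in> N"
  shows "psi (u + v) + psi (u - v) = 2 * psi u + 2 * psi v"
proof -
  have mem: "u + v \<in> N" "u - v \<in> N"
    using N_add[OF assms] N_add[OF assms(1) N_uminus[OF assms(2)]] by auto
  let ?D = "\<lambda>s. W s (u + v) + W s (u - v) - 2 * W s u - 2 * W s v"
  have "?D \<longlonglongrightarrow> psi (u + v) + psi (u - v) - 2 * psi u - 2 * psi v"
    by (intro tendsto_intros psi_tendsto assms mem)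
  moreover have "?D \<longlonglongrightarrow> 0"
  proof (rule tendsto_sandwich)
    have "(\<lambda>s. - (real p ^ (2 * s) * S.V (u / real p ^ s) + real p ^ (2 * s) * S.V (v / real p ^ s))) \<longlonglongrightarrow> - (0 + 0)"
      by (intro tendsto_intros scaled_V_tendsto assms)
    then show "(\<lambda>s. - (real p ^ (2 * s) * S.V (u / real p ^ s) + real p ^ (2 * s) * S.V (v / real p ^ s))) \<longlonglongrightarrow> 0"
      by simp
    have *: "?D s \<le> 0 \<and> - (real p ^ (2 * s) * S.V (u / real p ^ s) + real p ^ (2 * s) * S.V (v / real p ^ s)) \<le> ?D s" for s
    proof -
      have h: "u / real p ^ s \<in> H" "v / real p ^ s \<in> H" "u / real p ^ s + v / real p ^ s \<in> H"
        "u / real p ^ s - v / real p ^ s \<in> H" using N_H[OF assms(1)] N_H[OF assms(2)] by (auto intro!: H_divide_power H_add H_diff)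
      let ?d = "w (u / real p ^ s + v / real p ^ s) + w (u / real p ^ s - v / real p ^ s) - 2 * w (u / real p ^ s) - 2 * w (v / real p ^ s)"
      have "?d \<le> 0" "- ?d \<le> S.V (u / real p ^ s) + S.V (v / real p ^ s)"
        using S.parallelogram_defect[OF h(1,2)] by (simp_all only: w_symm h)
      then have "real p ^ (2 * s) * ?d \<le> real p ^ (2 * s) * 0"
        "real p ^ (2 * s) * (- ?d) \<le> real p ^ (2 * s) * (S.V (u / real p ^ s) + S.V (v / real p ^ s))"
        by (intro mult_left_mono; simp)+
      moreover have "?D s = real p ^ (2 * s) * ?d"
        unfolding W_def add_divide_distrib diff_divide_distrib
        by (simp only: right_diff_distrib distrib_left mult.left_commute)
      ultimately show ?thesis unfolding distrib_left mult_minus_right by argo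
    qed
    show "\<forall>\<^sub>F s in sequentially. ?D s \<le> 0"
      "\<forall>\<^sub>F s in sequentially. - (real p ^ (2 * s) * S.V (u / real p ^ s) + real p ^ (2 * s) * S.V (v / real p ^ s)) \<le> ?D s"
      using * by (auto intro!: always_eventually)
  qed simp
  ultimately have "psi (u + v) + psi (u - v) - 2 * psi u - 2 * psi v = 0"
    by (rule LIMSEQ_unique)
  then show ?thesis by simp
qed

section \<open>The phase of the characteristic function on its support\<close>

lemma sgn_f_eq: "u \<in> H \<Longrightarrow> sgn (f u) = (\<Prod>j\<in>J. sgn (f (\<epsilon> j * u / real p ^ m j)))"
  by (subst eq) (simp_all only: sgn_prod_complex)

definition dev where "dev u v = sgn (tri u v)"

lemma dev_eq: "dev u v = sgn (f (u + v)) * cnj (sgn (f u)) * cnj (sgn (f v))"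
  by (simp add: dev_def tri_def sgn_mult cnj_sgn)

lemma norm_dev: "u \<in> N \<Longrightarrow> v \<in> N \<Longrightarrow> norm (dev u v) = 1"
  using N_add[of u v] by (auto simp: dev_eq norm_mult norm_sgn N_def)

text \<open>Two products of numbers of modulus at most 1 differ by at most the sum of the
  differences of their factors. A sign -1 merely conjugates a factor, which keeps its distance from
  1. The weights enter only when both sides are scaled by p^(2 s).\<close>

lemma dev_le:
  assumes "u \<in> N" "v \<in> N"
  shows "norm (dev u v - 1) \<le> (\<Sum>j\<in>J. norm (dev (u / real p ^ m j) (v / real p ^ m j) - 1))"
proof -
  have H: "u \<in> H" "v \<in> H" using assms N_H by auto
  have "dev u v = (\<Prod>j\<in>J. dev (\<epsilon> j * u / real p ^ m j) (\<epsilon> j * v / real p ^ m j))"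
    unfolding dev_eq sgn_f_eq[OF H(1)] sgn_f_eq[OF H(2)] sgn_f_eq[OF H_add[OF H]]
    by (simp add: prod.distrib[symmetric] distrib_left add_divide_distrib)
  then have "norm (dev u v - 1) = norm ((\<Prod>j\<in>J. dev (\<epsilon> j * u / real p ^ m j) (\<epsilon> j * v / real p ^ m j)) - (\<Prod>j\<in>J. 1))"
    by simp
  also have "\<dots> \<le> (\<Sum>j\<in>J. norm (dev (\<epsilon> j * u / real p ^ m j) (\<epsilon> j * v / real p ^ m j) - 1))"
  proof (rule norm_prod_diff)
    fix j assume "j \<in> J"
    then have "\<epsilon> j * u / real p ^ m j \<in> N" "\<epsilon> j * v / real p ^ m j \<in> N"
      using \<epsilon>[of j] assms N_uminus by (auto simp: N_divide_power dest: N_uminus[OF N_divide_power])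
    then show "norm (dev (\<epsilon> j * u / real p ^ m j) (\<epsilon> j * v / real p ^ m j)) \<le> 1"
      by (simp add: norm_dev)
  qed simp
  also have "\<dots> = (\<Sum>j\<in>J. norm (dev (u / real p ^ m j) (v / real p ^ m j) - 1))"
  proof (rule sum.cong[OF refl])
    fix j assume j: "j \<in> J"
    have h: "u / real p ^ m j \<in> H" "v / real p ^ m j \<in> H" using H H_divide_power by auto
    have "f (- (u / real p ^ m j) + - (v / real p ^ m j)) = cnj (f (u / real p ^ m j + v / real p ^ m j))"
      using f_uminus[OF H_add[OF h]] by simp
    then have "dev (- (u / real p ^ m j)) (- (v / real p ^ m j)) = cnj (dev (u / real p ^ m j) (v / real p ^ m j))"
      by (simp add: dev_eq f_uminus h cnj_sgn)
    then have "norm (dev (- (u / real p ^ m j)) (- (v / real p ^ m j)) - 1) = norm (dev (u / real p ^ m j) (v / real p ^ m j) - 1)"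
      by (metis complex_cnj_diff complex_cnj_one complex_mod_cnj)
    then show "norm (dev (\<epsilon> j * u / real p ^ m j) (\<epsilon> j * v / real p ^ m j) - 1) = norm (dev (u / real p ^ m j) (v / real p ^ m j) - 1)"
      using \<epsilon>[OF j] by auto
  qed
  finally show ?thesis .
qed

lemma dev_tendsto:
  assumes "u \<in> N" "v \<in> N" "\<eta> > 0"
  shows "\<forall>\<^sub>F s in sequentially. real p ^ (2 * s) * norm (dev (u / real p ^ s) (v / real p ^ s) - 1) \<le> \<eta>"
proof -
  \<comment> \<open>Bounds \<open>W s u + W s v\<close> for all \<open>s\<close>; the summand 1
    keeps it positive.\<close>
  define c where "c = psi u + psi v + 1"
  have c: "c > 0" using psi_nonneg N_H assms by (auto simp: c_def add_nonneg_pos)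
  \<comment> \<open>Splits \<eta> evenly: both 4 (\<eta> / 8), from the second moments, and 4 e c
    equal \<eta> / 2.\<close>
  define e where "e = \<eta> / (8 * c)"
  have e: "e > 0" using c assms by (simp add: e_def)
  have "(\<lambda>s. 1 - 2 * w (u / real p ^ s) - 2 * w (v / real p ^ s)) \<longlonglongrightarrow> 1 - 2 * 0 - 2 * 0"
    by (intro tendsto_intros w_tendsto assms)
  then have ev1: "\<forall>\<^sub>F s in sequentially. 1 / 2 < 1 - 2 * w (u / real p ^ s) - 2 * w (v / real p ^ s)"
    by (rule order_tendstoD) simp
  have "(\<lambda>s. (real p ^ (2 * s) * S.V (u / real p ^ s) + real p ^ (2 * s) * S.V (v / real p ^ s)) / e) \<longlonglongrightarrow> (0 + 0) / e"
    using e by (intro tendsto_intros scaled_V_tendsto assms) auto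
  then have ev2: "\<forall>\<^sub>F s in sequentially. (real p ^ (2 * s) * S.V (u / real p ^ s) + real p ^ (2 * s) * S.V (v / real p ^ s)) / e < \<eta> / 8"
    using assms by (intro order_tendstoD) auto
  show ?thesis using ev1 ev2
  proof eventually_elim
    case (elim s)
    let ?t = "tri (u / real p ^ s) (v / real p ^ s)" and ?d = "dev (u / real p ^ s) (v / real p ^ s)"
    let ?P = "real p ^ (2 * s)"
    have h: "u / real p ^ s \<in> H" "v / real p ^ s \<in> H" using N_H[OF assms(1)] N_H[OF assms(2)] by (auto intro!: H_divide_power)
    have Re: "1 / 2 \<le> Re ?t" using tri_bounds(1)[OF h e] elim by linarith
    then have n: "1 / 2 \<le> norm ?t" using complex_Re_le_cmod[of ?t] by linarith
    have d: "?d = ?t / of_real (norm ?t)"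
      unfolding dev_def by (simp add: sgn_eq)
    have "norm (?d - 1) \<le> 2 * \<bar>Im ?d\<bar>"
    proof (rule unit_close_1)
      show "norm ?d = 1" using assms by (simp add: norm_dev N_divide_power)
      show "0 \<le> Re ?d" using Re n unfolding d by (simp add: Re_divide_of_real)
    qed
    also have "\<bar>Im ?d\<bar> = \<bar>Im ?t\<bar> / norm ?t" unfolding d by (simp add: Im_divide_of_real)
    also have "\<dots> \<le> \<bar>Im ?t\<bar> / (1 / 2)" using n by (intro divide_left_mono) auto
    finally have "norm (?d - 1) \<le> 4 * \<bar>Im ?t\<bar>" by simp
    also have "\<dots> \<le> 4 * ((S.V (u / real p ^ s) + S.V (v / real p ^ s)) / e + e * (w (u / real p ^ s) + w (v / real p ^ s)))"
      by (intro mult_left_mono tri_bounds h e) simp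
    finally have "?P * norm (?d - 1) \<le> ?P * (4 * ((S.V (u / real p ^ s) + S.V (v / real p ^ s)) / e + e * (w (u / real p ^ s) + w (v / real p ^ s))))"
      by (rule mult_left_mono) simp
    also have "\<dots> = 4 * ((?P * S.V (u / real p ^ s) + ?P * S.V (v / real p ^ s)) / e) + 4 * e * (W s u + W s v)"
    proof -
      have "P * (4 * ((A + B) / e + e * (x + y))) = 4 * ((P * A + P * B) / e) + 4 * e * (P * x + P * y)"
        for P A B x y :: real using e by (simp add: field_simps)
      from this[of ?P] show ?thesis unfolding W_def .
    qed
    also have "\<dots> \<le> 4 * (\<eta> / 8) + 4 * e * c"
      using elim W_le_psi[OF assms(1), of s] W_le_psi[OF assms(2), of s] e
      by (intro add_mono mult_left_mono) (auto simp: c_def)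
    also have "\<dots> = \<eta>" using c by (simp add: e_def)
    finally show ?case .
  qed
qed

text \<open>The deviation scaled by p^(2 s) is at most an average of its later values and eventually
  below every positive \<eta>, so it is already below \<eta> at \<open>s = 0\<close>.\<close>

lemma dev_one:
  assumes "u \<in> N" "v \<in> N"
  shows "dev u v = 1"
proof -
  have le: "norm (dev u v - 1) \<le> \<eta>" if "\<eta> > 0" for \<eta>
  proof -
    have "real p ^ (2 * 0) * norm (dev (u / real p ^ 0) (v / real p ^ 0) - 1) \<le> \<eta>"
    proof (rule average_le_backwards[where J = J and q = "\<lambda>j. 1 / real p ^ (2 * m j)" and m = m])
      show "\<forall>\<^sub>F s in sequentially. real p ^ (2 * s) * norm (dev (u / real p ^ s) (v / real p ^ s) - 1) \<le> \<eta>"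
        by (rule dev_tendsto[OF assms that])
      fix s
      have "real p ^ (2 * s) * norm (dev (u / real p ^ s) (v / real p ^ s) - 1)
        \<le> real p ^ (2 * s) * (\<Sum>j\<in>J. norm (dev (u / real p ^ s / real p ^ m j) (v / real p ^ s / real p ^ m j) - 1))"
        by (intro mult_left_mono dev_le N_divide_power assms) simp
      also have "\<dots> = (\<Sum>j\<in>J. 1 / real p ^ (2 * m j) * (real p ^ (2 * (s + m j)) * norm (dev (u / real p ^ (s + m j)) (v / real p ^ (s + m j)) - 1)))"
        by (simp only: sum_distrib_left weight_scale divide_power_divide_power)
      finally show "real p ^ (2 * s) * norm (dev (u / real p ^ s) (v / real p ^ s) - 1)
        \<le> (\<Sum>j\<in>J. 1 / real p ^ (2 * m j) * (real p ^ (2 * (s + m j)) * norm (dev (u / real p ^ (s + m j)) (v / real p ^ (s + m j)) - 1)))" .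
    qed (use m weights in auto)
    then show ?thesis by simp
  qed
  have "norm (dev u v - 1) \<le> 0" by (rule field_le_epsilon) (simp only: add_0_left le)
  then show ?thesis by simp
qed

lemma sgn_add:
  assumes "u \<in> N" "v \<in> N"
  shows "sgn (f (u + v)) = sgn (f u) * sgn (f v)"
proof -
  have 1: "sgn (f r) * cnj (sgn (f r)) = 1" if "r \<in> N" for r
    using that complex_norm_square[of "sgn (f r)"] by (simp add: norm_sgn N_def)
  have "sgn (f (u + v)) = sgn (f (u + v)) * (sgn (f u) * cnj (sgn (f u))) * (sgn (f v) * cnj (sgn (f v)))"
    using 1 assms by simp
  also have "\<dots> = dev u v * (sgn (f u) * sgn (f v))" unfolding dev_eq by (simp add: mult_ac)
  finally show ?thesis using dev_one[OF assms] by simp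
qed

theorem gaussian_on_support:
  "\<exists>c\<ge>0. \<forall>u\<in>N. f u = sgn (f u) * of_real (exp (- c * u\<^sup>2))"
proof -
  have NQ: "N \<subseteq> \<rat>" using H_rat N_H by auto
  obtain c where c: "0 \<le> c" "\<And>u. u \<in> N \<Longrightarrow> psi u = c * u\<^sup>2"
    using parallelogram_on_rational_subgroup[of N psi, OF N_zero N_add N_uminus NQ psi_parallelogram psi_nonneg[OF N_H]]
    by metis
  \<comment> \<open>The half undoes the square in \<open>psi\<close>.\<close>
  have "f u = sgn (f u) * of_real (exp (- (c / 2) * u\<^sup>2))" if u: "u \<in> N" for u
  proof -
    have n: "norm (f u) > 0" using u by (simp add: N_def)
    then have "psi u = - (2 * ln (norm (f u)))" by (simp add: psi_def ln_realpow)
    then have "ln (norm (f u)) = - (c / 2) * u\<^sup>2" using c(2)[OF u] by simp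
    then have "norm (f u) = exp (- (c / 2) * u\<^sup>2)" using n by (metis exp_ln)
    then show ?thesis using n by (simp add: sgn_eq)
  qed
  then show ?thesis using c(1) by (intro exI[of _ "c / 2"] conjI ballI) simp_all
qed

end

section \<open>Uniqueness of distributions\<close>

text \<open>The complex linear span of \<open>C\<close>. The closure lemmas compare functions on a
  set \<open>S\<close> only, since continuous extensions of characters multiply correctly only
  there: z and cnj z are inverse to each other on the circle, not on the plane.\<close>

inductive_set trig :: "('b \<Rightarrow> complex) set \<Rightarrow> ('b \<Rightarrow> complex) set" for C where
  scale: "h \<in> C \<Longrightarrow> (\<lambda>x. c * h x) \<in> trig C"
| add: "g \<in> trig C \<Longrightarrow> h \<in> trig C \<Longrightarrow> (\<lambda>x. g x + h x) \<in> trig C"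

lemma trig_scale: "g \<in> trig C \<Longrightarrow> \<exists>k\<in>trig C. \<forall>x. k x = c * g x"
proof (induction rule: trig.induct)
  case (scale h d)
  then have "(\<lambda>x. (c * d) * h x) \<in> trig C" by (rule trig.scale)
  then show ?case by (rule bexI[rotated]) simp
next
  case (add g h)
  then obtain k l where "k \<in> trig C" "\<forall>x. k x = c * g x" "l \<in> trig C" "\<forall>x. l x = c * h x" by blast
  then show ?case using trig.add[of k C l] by (intro bexI[of _ "\<lambda>x. k x + l x"]) (auto simp: distrib_left)
qed

lemma trig_cnj:
  assumes "\<And>h. h \<in> C \<Longrightarrow> \<exists>l\<in>C. \<forall>x\<in>S. l x = cnj (h x)"
  shows "g \<in> trig C \<Longrightarrow> \<exists>k\<in>trig C. \<forall>x\<in>S. k x = cnj (g x)"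
proof (induction rule: trig.induct)
  case (scale h d)
  then obtain l where l: "l \<in> C" "\<forall>x\<in>S. l x = cnj (h x)" using assms by blast
  from trig.scale[OF l(1), of "cnj d"] show ?case by (rule bexI[rotated]) (use l in simp)
next
  case (add g h)
  then obtain k l where "k \<in> trig C" "\<forall>x\<in>S. k x = cnj (g x)" "l \<in> trig C" "\<forall>x\<in>S. l x = cnj (h x)" by blast
  then show ?case using trig.add[of k C l] by (intro bexI[of _ "\<lambda>x. k x + l x"]) auto
qed

lemma trig_mult:
  assumes mult: "\<And>h k. h \<in> C \<Longrightarrow> k \<in> C \<Longrightarrow> \<exists>l\<in>C. \<forall>x\<in>S. l x = h x * k x"
    and f: "f \<in> trig C"
  shows "g \<in> trig C \<Longrightarrow> \<exists>k\<in>trig C. \<forall>x\<in>S. k x = f x * g x"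
  using f
proof (induction arbitrary: g rule: trig.induct)
  case (scale h d)
  show ?case using scale(2)
  proof (induction rule: trig.induct)
    case (scale h' d')
    then obtain l where l: "l \<in> C" "\<forall>x\<in>S. l x = h x * h' x" using mult \<open>h \<in> C\<close> by blast
    from trig.scale[OF l(1), of "d * d'"] show ?case by (rule bexI[rotated]) (use l in simp)
  next
    case (add g h')
    obtain k where k: "k \<in> trig C" "\<forall>x\<in>S. k x = d * h x * g x" using add.IH(1) by blast
    obtain l where l: "l \<in> trig C" "\<forall>x\<in>S. l x = d * h x * h' x" using add.IH(2) by blast
    show ?case by (rule bexI[OF _ trig.add[OF k(1) l(1)]]) (simp add: k(2) l(2) distrib_left)
  qed
next
  case (add f h)
  obtain k where k: "k \<in> trig C" "\<forall>x\<in>S. k x = f x * g x" using add.IH(1)[OF add.prems] by blast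
  obtain l where l: "l \<in> trig C" "\<forall>x\<in>S. l x = h x * g x" using add.IH(2)[OF add.prems] by blast
  show ?case by (rule bexI[OF _ trig.add[OF k(1) l(1)]]) (simp add: k(2) l(2) distrib_right)
qed

lemma trig_continuous:
  assumes "\<And>h. h \<in> C \<Longrightarrow> continuous_on UNIV h"
  shows "g \<in> trig C \<Longrightarrow> continuous_on UNIV g"
proof (induction rule: trig.induct)
  case (scale h c)
  then show ?case by (intro continuous_intros assms)
next
  case (add g h)
  then show ?case by (intro continuous_intros)
qed

lemma integrable_continuous_on_support:
  fixes h :: "'b::topological_space \<Rightarrow> 'c::{banach, second_countable_topology}"
  assumes "prob_space P" "sets P = sets borel" "compact S" "AE x in P. x \<in> S" "continuous_on UNIV h"
  shows "integrable P h"
proof -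
  interpret prob_space P by fact
  have "compact (h ` S)"
    by (rule compact_continuous_image[OF continuous_on_subset[OF assms(5) subset_UNIV] assms(3)])
  then have "bounded (h ` S)" by (rule compact_imp_bounded)
  then obtain K where K: "\<And>x. x \<in> S \<Longrightarrow> norm (h x) \<le> K" unfolding bounded_iff by blast
  have "h \<in> borel_measurable borel" using assms(5) by (rule borel_measurable_continuous_onI)
  then have m: "h \<in> borel_measurable P" unfolding measurable_cong_sets[OF assms(2) refl] .
  show ?thesis
  proof (rule integrable_const_bound[OF _ m])
    show "AE x in P. norm (h x) \<le> K" using assms(4) by eventually_elim (rule K)
  qed
qed

text \<open>By Stone-Weierstrass the real parts of the span of \<open>C\<close> are uniformly dense
  in the continuous functions on \<open>S\<close>, so both measures integrate continuous functions
  alike; these approximate the indicators of closed sets, which generate the Borel sets.\<close>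

theorem measure_eqI_characters:
  fixes P Q :: "'b::metric_space measure"
  assumes P: "prob_space P" "sets P = sets borel" "AE x in P. x \<in> S"
    and Q: "prob_space Q" "sets Q = sets borel" "AE x in Q. x \<in> S"
    and S: "compact S"
    and cont: "\<And>h. h \<in> C \<Longrightarrow> continuous_on UNIV h"
    and one: "(\<lambda>_. 1) \<in> C"
    and mult: "\<And>h k. h \<in> C \<Longrightarrow> k \<in> C \<Longrightarrow> \<exists>l\<in>C. \<forall>x\<in>S. l x = h x * k x"
    and cnj: "\<And>h. h \<in> C \<Longrightarrow> \<exists>l\<in>C. \<forall>x\<in>S. l x = cnj (h x)"
    and sep: "\<And>x y. x \<in> S \<Longrightarrow> y \<in> S \<Longrightarrow> x \<noteq> y \<Longrightarrow> \<exists>h\<in>C. h x \<noteq> h y"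
    and eq: "\<And>h. h \<in> C \<Longrightarrow> (\<integral>x. h x \<partial>P) = (\<integral>x. h x \<partial>Q)"
  shows "P = Q"
proof -
  interpret P: prob_space P by fact
  interpret Q: prob_space Q by fact
  note int = integrable_continuous_on_support[OF P(1,2) S P(3)] integrable_continuous_on_support[OF Q(1,2) S Q(3)]
  have trig_eq: "(\<integral>x. g x \<partial>P) = (\<integral>x. g x \<partial>Q)" if "g \<in> trig C" for g
    using that
  proof (induction rule: trig.induct)
    case (scale h c)
    then show ?case using eq by simp
  next
    case (add g h)
    then show ?case using int[OF trig_continuous[OF cont add.hyps(1)]] int[OF trig_continuous[OF cont add.hyps(2)]] by simp
  qed
  have Re_eq: "(\<integral>x. Re (g x) \<partial>P) = (\<integral>x. Re (g x) \<partial>Q)" if "g \<in> trig C" for g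
    using trig_eq[OF that] int[OF trig_continuous[OF cont that]] by simp
  define A where "A = {f. continuous_on S f \<and> (\<exists>g\<in>trig C. \<forall>x\<in>S. f x = Re (g x))}"
  interpret A: function_ring_on A S
  proof
    show "compact S" by (rule S)
    show "continuous_on S f" if "f \<in> A" for f using that by (simp add: A_def)
    show "(\<lambda>x. f x + g x) \<in> A" if fg: "f \<in> A" "g \<in> A" for f g
    proof -
      obtain f' g' where "f' \<in> trig C" "\<forall>x\<in>S. f x = Re (f' x)" "g' \<in> trig C" "\<forall>x\<in>S. g x = Re (g' x)"
        using fg by (auto simp: A_def)
      then show ?thesis using fg trig.add[of f' C g'] unfolding A_def
        by (auto intro!: continuous_intros bexI[of _ "\<lambda>x. f' x + g' x"])
    qed
    show "(\<lambda>x. f x * g x) \<in> A" if fg: "f \<in> A" "g \<in> A" for f g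
    proof -
      obtain f' g' where f': "f' \<in> trig C" "\<forall>x\<in>S. f x = Re (f' x)" and g': "g' \<in> trig C" "\<forall>x\<in>S. g x = Re (g' x)"
        using fg by (auto simp: A_def)
      obtain h where h: "h \<in> trig C" "\<forall>x\<in>S. h x = cnj (g' x)" using trig_cnj[of C S, OF cnj g'(1)] by blast
      obtain k where k: "k \<in> trig C" "\<forall>x\<in>S. k x = f' x * g' x" using trig_mult[of C S, OF mult f'(1) g'(1)] by blast
      obtain l where l: "l \<in> trig C" "\<forall>x\<in>S. l x = f' x * h x" using trig_mult[of C S, OF mult f'(1) h(1)] by blast
      \<comment> \<open>Re z Re w = Re (z w + z cnj w) / 2: closure under conjugation is what turns
        the real parts into a ring.\<close>
      obtain m where m: "m \<in> trig C" "\<forall>x. m x = 1 / 2 * (k x + l x)"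
        using trig_scale[OF trig.add[OF k(1) l(1)], of "1 / 2"] by blast
      have "f x * g x = Re (m x)" if "x \<in> S" for x
      proof -
        have "Re (m x) = (Re (k x) + Re (l x)) / 2" unfolding m(2)[rule_format] by simp
        then show ?thesis using that f'(2) g'(2) h(2) k(2) l(2) by simp
      qed
      moreover have "continuous_on S (\<lambda>x. f x * g x)"
        using fg unfolding A_def by (intro continuous_on_mult) blast+
      ultimately show ?thesis using m(1) unfolding A_def by blast
    qed
    show "(\<lambda>_. c) \<in> A" for c
      using trig.scale[OF one, of "of_real c"] unfolding A_def
      by (auto intro!: bexI[of _ "\<lambda>x. of_real c * 1"])
    show "\<exists>f\<in>A. f x \<noteq> f y" if xy: "x \<in> S" "y \<in> S" "x \<noteq> y" for x y
    proof -
      obtain h where h: "h \<in> C" "h x \<noteq> h y" using sep[OF xy] by blast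
      have A: "(\<lambda>x. Re (c * h x)) \<in> A" for c
        using trig.scale[OF h(1), of c] continuous_on_subset[OF cont[OF h(1)], of S] unfolding A_def
        by (auto intro!: continuous_intros simp del: times_complex.sel)
      show ?thesis
      proof (cases "Re (h x) = Re (h y)")
        case True
        then have "Im (h x) \<noteq> Im (h y)" using h by (auto simp: complex_eq_iff)
        \<comment> \<open>Multiplication by - i turns the imaginary part into a real part.\<close>
        then show ?thesis using A[of "- \<i>"] by (intro bexI[of _ "\<lambda>x. Re (- \<i> * h x)"]) auto
      next
        case False
        then show ?thesis using A[of 1] by (intro bexI[of _ "\<lambda>x. Re (1 * h x)"]) auto
      qed
    qed
  qed
  have cont_eq: "(\<integral>x. F x \<partial>P) = (\<integral>x. F x \<partial>Q)" if F: "continuous_on UNIV F" for F :: "'b \<Rightarrow> real"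
  proof -
    have close: "\<bar>(\<integral>x. F x \<partial>P) - (\<integral>x. F x \<partial>Q)\<bar> \<le> 2 * e" if e: "e > 0" for e
    proof -
      obtain f where f: "f \<in> A" "\<forall>x\<in>S. \<bar>F x - f x\<bar> < e"
        using A.Stone_Weierstrass_basic[OF continuous_on_subset[OF F subset_UNIV] e] by blast
      then obtain g where g: "g \<in> trig C" "\<forall>x\<in>S. \<bar>F x - Re (g x)\<bar> < e" by (auto simp: A_def)
      have *: "\<bar>(\<integral>x. F x \<partial>N) - (\<integral>x. Re (g x) \<partial>N)\<bar> \<le> e"
        if N: "prob_space N" "sets N = sets borel" "AE x in N. x \<in> S" for N
      proof -
        interpret N: prob_space N by fact
        note i = integrable_continuous_on_support[OF N(1,2) S N(3)]
        have iF: "integrable N F" by (rule i[OF F])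
        have ig: "integrable N (\<lambda>x. Re (g x))" using i[OF trig_continuous[OF cont g(1)]] by simp
        have "\<bar>\<integral>x. F x - Re (g x) \<partial>N\<bar> \<le> (\<integral>x. \<bar>F x - Re (g x)\<bar> \<partial>N)" by (rule integral_abs_bound)
        also have "\<dots> \<le> (\<integral>x. e \<partial>N)"
        proof (rule integral_mono_AE)
          show "AE x in N. \<bar>F x - Re (g x)\<bar> \<le> e" using N(3) by eventually_elim (use g(2) in force)
        qed (use iF ig in auto)
        finally show ?thesis using iF ig by (simp add: N.prob_space)
      qed
      show ?thesis using *[OF P] *[OF Q] Re_eq[OF g(1)] by linarith
    qed
    have "\<bar>(\<integral>x. F x \<partial>P) - (\<integral>x. F x \<partial>Q)\<bar> \<le> 0 + e" if "e > 0" for e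
      using close[of "e / 2"] that by simp
    then have "\<bar>(\<integral>x. F x \<partial>P) - (\<integral>x. F x \<partial>Q)\<bar> \<le> 0" by (rule field_le_epsilon)
    then show ?thesis by simp
  qed
  have closed_eq: "emeasure P Z = emeasure Q Z" if Z: "closed Z" for Z
  proof (cases "Z = {}")
    case False
    \<comment> \<open>Continuous functions decreasing to the indicator of \<open>Z\<close>. The
      empty set is treated apart because \<open>infdist\<close> to it is 0 by convention.\<close>
    define F where "F n x = max 0 (1 - real n * infdist x Z)" for n x
    have Fc: "continuous_on UNIV (F n)" for n
      unfolding F_def by (intro continuous_intros continuous_on_infdist)
    have lim: "(\<lambda>n. F n x) \<longlonglongrightarrow> indicator Z x" for x
    proof (cases "x \<in> Z")
      case True
      then show ?thesis by (simp add: F_def)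
    next
      case x: False
      then have "infdist x Z > 0"
        using in_closed_iff_infdist_zero[OF Z False] infdist_nonneg[of x Z] by (metis less_eq_real_def)
      then obtain n0 where "1 / infdist x Z < real n0" using reals_Archimedean2 by blast
      then have n0: "1 < real n0 * infdist x Z" using \<open>infdist x Z > 0\<close> by (simp add: field_simps)
      have "F n x = 0" if "n \<ge> n0" for n
      proof -
        have "real n0 * infdist x Z \<le> real n * infdist x Z"
          using that infdist_nonneg by (intro mult_right_mono) auto
        then show ?thesis using n0 by (simp add: F_def)
      qed
      then show ?thesis using x by (auto intro!: tendsto_eventually eventually_sequentiallyI[of n0])
    qed
    have conv: "(\<lambda>n. \<integral>x. F n x \<partial>N) \<longlonglongrightarrow> measure N Z" if N: "prob_space N" "sets N = sets borel" for N
    proof -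
      interpret N: prob_space N by fact
      have "(\<lambda>n. \<integral>x. F n x \<partial>N) \<longlonglongrightarrow> (\<integral>x. indicator Z x \<partial>N)"
      proof (rule integral_dominated_convergence[where w = "\<lambda>_. 1"])
        have "Z \<in> sets N" using Z N(2) by simp
        then show "(\<lambda>x. indicator Z x :: real) \<in> borel_measurable N" by (rule borel_measurable_indicator)
        show "F n \<in> borel_measurable N" for n
          using borel_measurable_continuous_onI[OF Fc] unfolding measurable_cong_sets[OF N(2) refl] .
        show "AE x in N. norm (F n x) \<le> 1" for n
          by (intro AE_I2) (auto simp: F_def infdist_nonneg)
      qed (use lim in auto)
      then show ?thesis using sets_eq_imp_space_eq[OF N(2)] by simp
    qed
    have "measure P Z = measure Q Z"
      using LIMSEQ_unique[OF conv[OF P(1,2)]] conv[OF Q(1,2)] cont_eq[OF Fc] by simp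
    then show ?thesis by (simp add: P.emeasure_eq_measure Q.emeasure_eq_measure)
  qed simp
  show "P = Q"
  proof (rule measure_eqI_generator_eq[where E = "Collect closed" and \<Omega> = UNIV and A = "\<lambda>_. UNIV"])
    show "Int_stable (Collect closed)" by (auto simp: Int_stable_def)
    show "sets P = sigma_sets UNIV (Collect closed)" "sets Q = sigma_sets UNIV (Collect closed)"
      by (simp_all add: P(2) Q(2) borel_eq_closed)
    show "emeasure P Z = emeasure Q Z" if "Z \<in> Collect closed" for Z using closed_eq that by simp
  qed (auto simp: P.emeasure_eq_measure)
qed

section \<open>Measures on the circle with prescribed Fourier coefficients\<close>

text \<open>On the unit circle this is the integer power \<open>z powi m\<close>, but it is continuous on the
  whole plane.\<close>

definition cpow :: "int \<Rightarrow> complex \<Rightarrow> complex" where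
  "cpow m z = (if 0 \<le> m then z ^ nat m else cnj z ^ nat (- m))"

lemma cpow_cis: "cpow m (cis t) = cis (of_int m * t)"
  by (auto simp: cpow_def cis_cnj Complex.DeMoivre)

lemma norm_1_cis:
  assumes "norm (z :: complex) = 1"
  obtains t where "z = cis t"
  using assms by (metis complex_norm_eq_1_exp cis_conv_exp)

lemma continuous_cpow: "continuous_on A (cpow m)"
  unfolding cpow_def by (cases "0 \<le> m") (auto intro!: continuous_intros)

lemma cpow_add: "norm z = 1 \<Longrightarrow> cpow (m + n) z = cpow m z * cpow n z"
  by (elim norm_1_cis) (simp add: cpow_cis cis_mult distrib_right)

lemma cpow_uminus: "norm z = 1 \<Longrightarrow> cpow (- m) z = cnj (cpow m z)"
  by (elim norm_1_cis) (simp add: cpow_cis cis_cnj)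

lemma cpow_mult_base: "norm z = 1 \<Longrightarrow> norm w = 1 \<Longrightarrow> cpow m (z * w) = cpow m z * cpow m w"
  by (elim norm_1_cis) (simp add: cpow_cis cis_mult distrib_left)

lemma cpow_power: "norm z = 1 \<Longrightarrow> cpow m (z ^ n) = cpow (int n * m) z"
  by (elim norm_1_cis) (simp add: cpow_cis Complex.DeMoivre mult_ac)

lemma norm_cpow: "norm z = 1 \<Longrightarrow> norm (cpow m z) = 1"
  by (elim norm_1_cis) (simp add: cpow_cis)

lemma cpow_0 [simp]: "cpow 0 z = 1" and cpow_1 [simp]: "cpow 1 z = z"
  by (simp_all add: cpow_def)

lemma measure_eqI_circle:
  fixes P Q :: "complex measure"
  assumes "prob_space P" "sets P = sets borel" "AE z in P. norm z = 1"
    and "prob_space Q" "sets Q = sets borel" "AE z in Q. norm z = 1"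
    and "\<And>m. (\<integral>z. cpow m z \<partial>P) = (\<integral>z. cpow m z \<partial>Q)"
  shows "P = Q"
proof (rule measure_eqI_characters[where S = "sphere 0 1" and C = "range cpow"])
  show "\<exists>l\<in>range cpow. \<forall>x\<in>sphere 0 1. l x = h x * k x" if "h \<in> range cpow" "k \<in> range cpow" for h k
  proof -
    obtain m n where "h = cpow m" "k = cpow n" using \<open>h \<in> range cpow\<close> \<open>k \<in> range cpow\<close> by blast
    then show ?thesis by (intro bexI[of _ "cpow (m + n)"]) (simp_all add: cpow_add)
  qed
  show "\<exists>l\<in>range cpow. \<forall>x\<in>sphere 0 1. l x = cnj (h x)" if "h \<in> range cpow" for h
  proof -
    obtain m where "h = cpow m" using \<open>h \<in> range cpow\<close> by blast
    then show ?thesis by (intro bexI[of _ "cpow (- m)"]) (simp_all add: cpow_uminus)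
  qed
  show "\<exists>h\<in>range cpow. h x \<noteq> h y" if "x \<noteq> y" for x y
    using that by (intro bexI[of _ "cpow 1"]) auto
  show "(\<lambda>_. 1) \<in> range cpow" by (rule range_eqI[of _ _ 0]) auto
qed (use assms in \<open>auto intro: continuous_cpow\<close>)

lemma sum_roots_of_unity:
  fixes m :: int
  assumes "0 < d"
  shows "(\<Sum>j<d. cis (of_int m * (2 * pi * real j / real d))) = (if int d dvd m then of_nat d else 0)"
proof -
  define w where "w = cis (2 * pi * of_int m / real d)"
  have w: "cis (of_int m * (2 * pi * real j / real d)) = w ^ j" for j
  proof -
    have "of_int m * (2 * pi * real j / real d) = real j * (2 * pi * of_int m / real d)" by simp
    then show ?thesis unfolding w_def Complex.DeMoivre by (rule arg_cong)
  qed
  have w1: "w = 1 \<longleftrightarrow> int d dvd m"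
  proof
    assume "w = 1"
    then have "cos (2 * pi * of_int m / real d) = 1" unfolding w_def by (metis cis.sel(1) one_complex.sel(1))
    then obtain k :: int where "2 * pi * of_int m / real d = of_int k * 2 * pi" unfolding cos_one_2pi_int by blast
    then have "real_of_int m = of_int (int d * k)" using assms by (simp add: field_simps)
    then have "m = int d * k" by linarith
    then show "int d dvd m" by simp
  next
    assume "int d dvd m"
    then obtain k where "m = int d * k" by (rule dvdE)
    then have "w = cis (2 * pi * of_int k)" using assms by (simp add: w_def field_simps)
    then show "w = 1" by simp
  qed
  have "w ^ d = cis (2 * pi * of_int m)" using assms by (simp add: w_def Complex.DeMoivre)
  then have wd: "w ^ d = 1" by simp
  show ?thesis
  proof (cases "w = 1")
    case True
    then show ?thesis using w1 unfolding w by simp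
  next
    case False
    then have "(\<Sum>j<d. w ^ j) = (w ^ d - 1) / (w - 1)" by (simp add: geometric_sum)
    then show ?thesis using w1 False wd unfolding w by simp
  qed
qed

lemma integral_cis_period:
  fixes m :: int
  assumes "m \<noteq> 0"
  shows "(\<integral>t\<in>{0..1}. cis (of_int m * (2 * pi * t)) \<partial>lborel) = 0"
proof -
  let ?F = "\<lambda>t::real. cis (of_int m * (2 * pi * t)) / (\<i> * of_real (of_int m * 2 * pi))"
  have "((\<lambda>t. cis (of_int m * (2 * pi * t))) has_integral (?F 1 - ?F 0)) {0..1}"
  proof (rule fundamental_theorem_of_calculus)
    fix t :: real
    have e: "cis (of_int m * (2 * pi * t)) = exp (\<i> * of_real (of_int m * 2 * pi) * of_real t)" for t
      by (simp add: cis_conv_exp mult_ac)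
    show "(?F has_vector_derivative cis (of_int m * (2 * pi * t))) (at t within {0..1})"
      unfolding e
      by (rule has_vector_derivative_real_field) (auto intro!: derivative_eq_intros simp: assms)
  qed simp
  moreover have "?F 1 = ?F 0"
  proof -
    have "cis (of_int m * (2 * pi * 1)) = 1" using cis_multiple_2pi[of "of_int m"] by (simp add: mult_ac)
    then show ?thesis by simp
  qed
  ultimately have "integral {0..1} (\<lambda>t. cis (of_int m * (2 * pi * t))) = 0"
    by (simp add: integral_unique)
  moreover have "set_integrable lborel {0..1::real} (\<lambda>t. cis (of_int m * (2 * pi * t)))"
    by (rule borel_integrable_atLeastAtMost') (auto intro!: continuous_intros)
  ultimately show ?thesis by (simp add: set_borel_integral_eq_integral)
qed

text \<open>These are the Haar measures of the closed subgroups of the circle: the uniform law on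
  the d-th roots of unity and, for \<open>d = 0\<close>, the normalized length, as 0 divides only 0.
  They become the one-coordinate marginals of a Haar distribution on the solenoid.\<close>

lemma uniform_root_measure:
  obtains P :: "complex measure" where "prob_space P" "sets P = sets borel" "AE z in P. norm z = 1"
    "\<And>m. (\<integral>z. cpow m z \<partial>P) = (if int d dvd m then 1 else 0)"
proof (cases "d = 0")
  case True
  define L where "L = restrict_space lborel {0..1::real}"
  interpret L: prob_space L
    by (rule prob_spaceI) (simp add: L_def space_restrict_space emeasure_restrict_space)
  have [measurable]: "(\<lambda>t. cis (2 * pi * t)) \<in> borel_measurable L"
    unfolding L_def
    by (intro measurable_restrict_space1) (simp add: borel_measurable_continuous_onI continuous_intros)
  have [measurable]: "cpow m \<in> borel_measurable borel" for m
    by (intro borel_measurable_continuous_onI continuous_cpow)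
  show ?thesis
  proof (rule that[of "distr L borel (\<lambda>t. cis (2 * pi * t))"])
    show "prob_space (distr L borel (\<lambda>t. cis (2 * pi * t)))" by (rule L.prob_space_distr) simp
    show "AE z in distr L borel (\<lambda>t. cis (2 * pi * t)). norm z = 1" by (subst AE_distr_iff) auto
    fix m
    have "(\<integral>z. cpow m z \<partial>distr L borel (\<lambda>t. cis (2 * pi * t))) = (\<integral>t. cis (of_int m * (2 * pi * t)) \<partial>L)"
      by (subst integral_distr) (auto simp: cpow_cis)
    also have "\<dots> = (if m = 0 then 1 else 0)"
    proof (cases "m = 0")
      case True
      then show ?thesis using L.prob_space by simp
    next
      case False
      have "(\<integral>t. cis (of_int m * (2 * pi * t)) \<partial>L) = (\<integral>t\<in>{0..1}. cis (of_int m * (2 * pi * t)) \<partial>lborel)"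
        unfolding L_def set_lebesgue_integral_def by (rule integral_restrict_space) simp
      then show ?thesis using False integral_cis_period[OF False] by simp
    qed
    finally show "(\<integral>z. cpow m z \<partial>distr L borel (\<lambda>t. cis (2 * pi * t))) = (if int d dvd m then 1 else 0)"
      using True by simp
  qed simp
next
  case False
  define L where "L = measure_pmf (pmf_of_set {..<d})"
  have ne: "{..<d} \<noteq> {}" using False by (auto simp: lessThan_empty_iff)
  have [measurable]: "cpow m \<in> borel_measurable borel" for m
    by (intro borel_measurable_continuous_onI continuous_cpow)
  show ?thesis
  proof (rule that[of "distr L borel (\<lambda>j. cis (2 * pi * real j / real d))"])
    show "prob_space (distr L borel (\<lambda>j. cis (2 * pi * real j / real d)))"
      unfolding L_def by (rule measure_pmf.prob_space_distr) simp
    show "AE z in distr L borel (\<lambda>j. cis (2 * pi * real j / real d)). norm z = 1"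
      unfolding L_def by (subst AE_distr_iff) auto
    fix m
    have "(\<integral>z. cpow m z \<partial>distr L borel (\<lambda>j. cis (2 * pi * real j / real d)))
        = (\<integral>j. cis (of_int m * (2 * pi * real j / real d)) \<partial>L)"
      unfolding L_def by (subst integral_distr) (auto simp: cpow_cis)
    also have "\<dots> = (\<Sum>j<d. cis (of_int m * (2 * pi * real j / real d))) / of_nat d"
      unfolding L_def using False
      by (subst integral_measure_pmf[of "{..<d}"])
         (auto simp: pmf_of_set[OF ne] set_pmf_of_set[OF ne] scaleR_conv_of_real sum_divide_distrib field_simps)
    finally show "(\<integral>z. cpow m z \<partial>distr L borel (\<lambda>j. cis (2 * pi * real j / real d))) = (if int d dvd m then 1 else 0)"
      using sum_roots_of_unity[of d m] False by simp
  qed simp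
qed

section \<open>The solenoid as a group\<close>

lemma neg_mod_unique:
  fixes i m d :: nat
  assumes "i < d" "(i + m mod d) mod d = 0"
  shows "int i = - int m mod int d"
proof -
  have "d dvd i + m" using assms(2) by (simp only: mod_add_right_eq dvd_eq_mod_eq_0)
  then have "int d dvd int i - (- int m)" by (simp flip: of_nat_add)
  then have "int i mod int d = - int m mod int d" by (simp only: mod_eq_dvd_iff)
  then show ?thesis using assms(1) by (simp only: zmod_int[symmetric] mod_less)
qed
lemma carry_step:
  assumes "r + b * c' = u + v + c" "q + c * d = s + t"
  shows "q + r * d + c' * (b * d) = s + u * d + (t + v * (d::nat))"
proof -
  have "q + r * d + c' * (b * d) = q + (r + b * c') * d" by (simp add: algebra_simps)
  also have "\<dots> = q + c * d + (u + v) * d" unfolding assms(1) by (simp add: algebra_simps)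
  also have "\<dots> = s + u * d + (t + v * d)" unfolding assms(2) by (simp add: algebra_simps)
  finally show ?thesis .
qed

lemma divide_add_carry:
  fixes d :: real
  assumes "q + d * c = u + v" "d \<noteq> 0"
  shows "(s + t - q) / d = ((s - u) / d + (t - v) / d) + c"
proof -
  have "q = u + v - d * c" using assms(1) by simp
  then show ?thesis using assms(2) by (simp add: add_divide_distrib diff_divide_distrib)
qed

lemma divide_digit_step:
  fixes b d :: real
  assumes "b \<noteq> 0" "d \<noteq> 0"
  shows "b * ((t - (u + v * d)) / (b * d)) = (t - u) / d + - v"
  using assms by (simp add: field_simps)

locale adic =
  fixes a :: "nat \<Rightarrow> nat"
  assumes a_gt_1: "1 < a j"
begin

abbreviation "\<Delta> \<equiv> adic_integers a"

definition D :: "nat \<Rightarrow> nat" where "D k = (\<Prod>i<k. a i)"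

text \<open>The residue of the adic integer \<open>x\<close> modulo \<open>D k\<close>. Through
  these residues the adic integers become an inverse limit of the groups Z / D k, where the group
  laws are evident, while carries make them awkward digit by digit.\<close>

definition psum :: "(nat \<Rightarrow> nat) \<Rightarrow> nat \<Rightarrow> nat" where "psum x k = (\<Sum>i<k. x i * D i)"

lemma D_0 [simp]: "D 0 = 1" and D_Suc: "D (Suc k) = a k * D k"
  by (simp_all add: D_def)

lemma a_pos: "0 < a j"
  by (rule less_trans[OF zero_less_one a_gt_1])

lemma D_pos: "0 < D k"
  unfolding D_def by (intro prod_pos a_pos)

lemma D_real_pos [simp]: "0 < real (D k)"
  using D_pos by simp

lemma D_real_nonzero [simp]: "real (D k) \<noteq> 0"
  using D_real_pos[of k] by linarith

lemma D_dvd: "k \<le> l \<Longrightarrow> D k dvd D l"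
  by (induction l rule: dec_induct) (auto simp: D_Suc)

lemma D_gt_1: "0 < k \<Longrightarrow> 1 < D k"
proof (cases k)
  case (Suc l)
  have "a l \<le> a l * D l" using D_pos[of l] by simp
  then show ?thesis using a_gt_1[of l] unfolding Suc D_Suc by linarith
qed simp

lemma psum_0 [simp]: "psum x 0 = 0" and psum_Suc: "psum x (Suc k) = psum x k + x k * D k"
  by (simp_all add: psum_def)

lemma adic_carrier_iff: "x \<in> carrier \<Delta> \<longleftrightarrow> (\<forall>i. x i < a i)"
  by (auto simp: adic_integers_def PiE_UNIV_domain)

lemma psum_less: "x \<in> carrier \<Delta> \<Longrightarrow> psum x k < D k"
proof (induction k)
  case (Suc k)
  have "psum x k + x k * D k < (1 + x k) * D k" using Suc by simp
  also have "\<dots> \<le> a k * D k" using Suc.prems by (intro mult_right_mono) (auto simp: adic_carrier_iff Suc_le_eq)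
  finally show ?case by (simp add: psum_Suc D_Suc)
qed simp

lemma adic_eqI:
  assumes "\<And>k. psum x k = psum z k"
  shows "x = z"
proof
  fix i
  show "x i = z i" using assms[of "Suc i"] assms[of i] D_pos[of i] by (simp add: psum_Suc)
qed

lemma adic_mult_digit:
  "(x \<otimes>\<^bsub>\<Delta>\<^esub> z) k + a k * adic_carry a x z (Suc k) = x k + z k + adic_carry a x z k"
  unfolding adic_integers_def adic_carry.simps by (simp only: monoid.simps mod_mult_div_eq)

text \<open>The digit identities telescope, a carry into position \<open>k\<close> being worth
  \<open>D k\<close> units.\<close>

lemma psum_carry:
  "psum (x \<otimes>\<^bsub>\<Delta>\<^esub> z) k + adic_carry a x z k * D k = psum x k + psum z k"
proof (induction k)
  case 0
  show ?case by (simp only: psum_0 adic_carry.simps mult_0 add_0)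
next
  case (Suc k)
  show ?case unfolding psum_Suc D_Suc by (rule carry_step[OF adic_mult_digit Suc])
qed

lemma psum_mult:
  assumes "x \<in> carrier \<Delta>" "z \<in> carrier \<Delta>"
  shows "psum (x \<otimes>\<^bsub>\<Delta>\<^esub> z) k = (psum x k + psum z k) mod D k"
proof -
  have "x \<otimes>\<^bsub>\<Delta>\<^esub> z \<in> carrier \<Delta>"
    by (simp add: adic_integers_def PiE_UNIV_domain a_pos)
  from psum_less[OF this, of k] psum_carry[of x z k] show ?thesis
    by (metis mod_less mod_mult_self1)
qed

text \<open>Inverse to taking residues: digit \<open>k\<close> is read off from the residue modulo
  \<open>D (Suc k)\<close>. It is meant for sequences \<open>c\<close> whose terms are compatible
  modulo the \<open>D k\<close>.\<close>

definition digits :: "(nat \<Rightarrow> int) \<Rightarrow> nat \<Rightarrow> nat" where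
  "digits c k = nat (c (Suc k) mod int (D (Suc k))) div D k"

lemma digits_carrier: "digits c \<in> carrier \<Delta>"
proof -
  have "nat (c (Suc k) mod int (D (Suc k))) < a k * D k" for k
    unfolding D_Suc[symmetric]
    by (subst nat_less_iff) (simp_all only: pos_mod_sign pos_mod_bound of_nat_0_less_iff D_pos)
  then show ?thesis unfolding adic_carrier_iff digits_def
    by (intro allI less_mult_imp_div_less)
qed

lemma psum_digits:
  assumes "\<And>k. c (Suc k) mod int (D k) = c k mod int (D k)"
  shows "int (psum (digits c) k) = c k mod int (D k)"
proof (induction k)
  case (Suc k)
  let ?r = "c (Suc k) mod int (D (Suc k))"
  have "?r \<ge> 0" using D_pos[of "Suc k"] by simp
  then have "int (digits c k) = ?r div int (D k)" by (simp add: digits_def zdiv_int)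
  moreover have "?r mod int (D k) = c k mod int (D k)"
    using assms[of k] by (simp add: D_Suc mod_mod_cancel)
  ultimately have "int (psum (digits c) (Suc k)) = ?r mod int (D k) + ?r div int (D k) * int (D k)"
    using Suc by (simp add: psum_Suc)
  then show ?case by simp
qed simp

lemma psum_one: "psum \<one>\<^bsub>\<Delta>\<^esub> k = 0"
  by (simp add: adic_integers_def psum_def)

lemma adic_mult_closed: "x \<in> carrier \<Delta> \<Longrightarrow> z \<in> carrier \<Delta> \<Longrightarrow> x \<otimes>\<^bsub>\<Delta>\<^esub> z \<in> carrier \<Delta>"
  by (simp add: adic_integers_def PiE_UNIV_domain a_pos)

sublocale adic: comm_group \<Delta>
proof (rule comm_groupI)
  show one: "\<one>\<^bsub>\<Delta>\<^esub> \<in> carrier \<Delta>"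
    by (simp add: adic_integers_def PiE_UNIV_domain a_pos)
  show "x \<otimes>\<^bsub>\<Delta>\<^esub> z \<otimes>\<^bsub>\<Delta>\<^esub> v = x \<otimes>\<^bsub>\<Delta>\<^esub> (z \<otimes>\<^bsub>\<Delta>\<^esub> v)"
    if "x \<in> carrier \<Delta>" "z \<in> carrier \<Delta>" "v \<in> carrier \<Delta>" for x z v
    by (rule adic_eqI) (use that in \<open>simp add: psum_mult adic_mult_closed mod_simps add.assoc\<close>)
  show "x \<otimes>\<^bsub>\<Delta>\<^esub> z = z \<otimes>\<^bsub>\<Delta>\<^esub> x" if "x \<in> carrier \<Delta>" "z \<in> carrier \<Delta>" for x z
    by (rule adic_eqI) (use that in \<open>simp add: psum_mult add.commute\<close>)
  show "\<one>\<^bsub>\<Delta>\<^esub> \<otimes>\<^bsub>\<Delta>\<^esub> x = x" if "x \<in> carrier \<Delta>" for x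
    by (rule adic_eqI) (use that one in \<open>simp add: psum_mult psum_one psum_less\<close>)
  show "\<exists>z\<in>carrier \<Delta>. z \<otimes>\<^bsub>\<Delta>\<^esub> x = \<one>\<^bsub>\<Delta>\<^esub>" if x: "x \<in> carrier \<Delta>" for x
  proof
    \<comment> \<open>The inverse is assembled from the negated residues; neighbouring ones differ
      by a multiple of \<open>D k\<close>, so they are compatible.\<close>
    let ?c = "\<lambda>k. - int (psum x k)"
    have c: "?c (Suc k) mod int (D k) = ?c k mod int (D k)" for k
    proof -
      have "?c (Suc k) = ?c k + (- int (x k)) * int (D k)" by (simp add: psum_Suc)
      then show ?thesis by (simp only: mod_mult_self1)
    qed
    show "digits ?c \<otimes>\<^bsub>\<Delta>\<^esub> x = \<one>\<^bsub>\<Delta>\<^esub>"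
    proof (rule adic_eqI)
      fix k
      have "int (psum (digits ?c \<otimes>\<^bsub>\<Delta>\<^esub> x) k) = (?c k mod int (D k) + int (psum x k)) mod int (D k)"
        using psum_digits[of ?c k, OF c] by (simp add: psum_mult digits_carrier x zmod_int)
      then show "psum (digits ?c \<otimes>\<^bsub>\<Delta>\<^esub> x) k = psum \<one>\<^bsub>\<Delta>\<^esub> k"
        by (simp add: psum_one mod_simps)
    qed
  qed (rule digits_carrier)
qed (rule adic_mult_closed)

text \<open>The reduction matters only at \<open>k = 0\<close>, where \<open>D 0 = 1\<close> turns
  the residue into 0.\<close>

lemma psum_unit: "psum adic_unit k = 1 mod D k"
proof (induction k)
  case (Suc k)
  have S: "1 mod D (Suc k) = 1" by (intro mod_less D_gt_1) simp
  show ?case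
  proof (cases "k = 0")
    case True
    then show ?thesis unfolding psum_Suc S by (simp add: adic_unit_def)
  next
    case False
    then have "1 mod D k = 1" by (intro mod_less D_gt_1) simp
    with False show ?thesis unfolding psum_Suc Suc S by (simp add: adic_unit_def)
  qed
qed (simp add: psum_def)

lemma adic_unit_carrier: "adic_unit \<in> carrier \<Delta>"
  using a_gt_1[of 0] by (simp add: adic_carrier_iff adic_unit_def a_pos)

lemma psum_unit_power: "psum (adic_unit [^]\<^bsub>\<Delta>\<^esub> (n :: nat)) k = n mod D k"
proof (induction n)
  case (Suc n)
  have "psum (adic_unit [^]\<^bsub>\<Delta>\<^esub> Suc n) k = (n mod D k + 1 mod D k) mod D k"
    unfolding adic.nat_pow_Suc
    by (subst psum_mult) (simp_all only: adic.nat_pow_closed adic_unit_carrier Suc psum_unit)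
  then show ?case by (simp only: mod_add_eq Suc_eq_plus1)
qed (simp add: psum_one)

lemma psum_unit_int_power: "int (psum (adic_unit [^]\<^bsub>\<Delta>\<^esub> (n :: int)) k) = n mod int (D k)"
proof (cases "n \<ge> 0")
  case True
  then have "adic_unit [^]\<^bsub>\<Delta>\<^esub> n = adic_unit [^]\<^bsub>\<Delta>\<^esub> nat n"
    unfolding int_pow_def2 by (simp only: not_less[symmetric] if_not_P if_False)
  moreover have "int (nat n) = n" using True by simp
  ultimately show ?thesis by (metis psum_unit_power zmod_int)
next
  case False
  let ?u = "adic_unit [^]\<^bsub>\<Delta>\<^esub> nat (- n)"
  have u: "?u \<in> carrier \<Delta>" by (rule adic.nat_pow_closed[OF adic_unit_carrier])
  have "(psum (inv\<^bsub>\<Delta>\<^esub> ?u) k + nat (- n) mod D k) mod D k = 0"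
    using psum_mult[OF adic.inv_closed[OF u] u, of k] by (simp only: adic.l_inv[OF u] psum_one psum_unit_power)
  then have "int (psum (inv\<^bsub>\<Delta>\<^esub> ?u) k) = - int (nat (- n)) mod int (D k)"
    by (rule neg_mod_unique[OF psum_less[OF adic.inv_closed[OF u]]])
  moreover have "adic_unit [^]\<^bsub>\<Delta>\<^esub> n = inv\<^bsub>\<Delta>\<^esub> ?u"
    using False unfolding int_pow_def2 not_le by (simp only: if_True)
  moreover have "- int (nat (- n)) = n" using False by simp
  ultimately show ?thesis by (simp only:)
qed

section \<open>The quotient group and the characters that separate its points\<close>

abbreviation "R \<equiv> real_group \<times>\<times> \<Delta>"

abbreviation "B \<equiv> solenoid_kernel a"

abbreviation "G \<equiv> solenoid a"

lemma real_group_comm: "comm_group real_group"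
  by (rule comm_groupI) (auto simp: real_group_def intro: exI[of _ "- x" for x])

sublocale real: comm_group real_group
  by (rule real_group_comm)

sublocale R: comm_group R
proof (rule group.group_comm_groupI)
  show "group R" by (rule DirProd_group[OF real.group_axioms adic.group_axioms])
  fix g h assume "g \<in> carrier R" "h \<in> carrier R"
  then show "g \<otimes>\<^bsub>R\<^esub> h = h \<otimes>\<^bsub>R\<^esub> g"
    by (auto simp: real.m_comm adic.m_comm)
qed

lemma R_carrier: "carrier R = UNIV \<times> carrier \<Delta>"
  by (simp add: DirProd_def real_group_def)

lemma R_mult: "(s, x) \<otimes>\<^bsub>R\<^esub> (t, z) = (s + t, x \<otimes>\<^bsub>\<Delta>\<^esub> z)"
  by (simp add: DirProd_def real_group_def)

text \<open>The character \<open>1 / D k\<close>, pulled back to \<open>\<real> \<times> \<Delta>\<close>; these characters generate \<open>H\<close>.\<close>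

definition E :: "nat \<Rightarrow> real \<times> (nat \<Rightarrow> nat) \<Rightarrow> complex" where
  "E k g = cis (2 * pi * ((fst g - real (psum (snd g) k)) / real (D k)))"

lemma cis_2pi_add_int: "cis (2 * pi * (t + of_int n)) = cis (2 * pi * t)"
  by (simp add: distrib_left cis_mult[symmetric])

lemma cis_2pi_eq_1: "cis (2 * pi * t) = 1 \<longleftrightarrow> t \<in> \<int>"
proof
  assume "cis (2 * pi * t) = 1"
  then have "cos (2 * pi * t) = 1" by (metis cis.sel(1) one_complex.sel(1))
  then obtain n :: int where "2 * pi * t = of_int n * 2 * pi" using cos_one_2pi_int by auto
  then show "t \<in> \<int>" by simp
qed (auto elim!: Ints_cases)

text \<open>The carry beyond the first \<open>k\<close> digits shifts the exponent by an integer,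
  which \<open>cis\<close> does not see.\<close>

lemma E_mult:
  assumes "g \<in> carrier R" "h \<in> carrier R"
  shows "E k (g \<otimes>\<^bsub>R\<^esub> h) = E k g * E k h"
proof -
  obtain s x t z where gh: "g = (s, x)" "h = (t, z)" by (cases g, cases h)
  have "real (psum (x \<otimes>\<^bsub>\<Delta>\<^esub> z) k + adic_carry a x z k * D k) = real (psum x k + psum z k)"
    by (simp only: psum_carry)
  then have "real (psum (x \<otimes>\<^bsub>\<Delta>\<^esub> z) k) + real (D k) * real (adic_carry a x z k) = real (psum x k) + real (psum z k)"
    by (simp only: of_nat_add of_nat_mult mult.commute)
  from divide_add_carry[OF this D_real_nonzero]
  have "(s + t - real (psum (x \<otimes>\<^bsub>\<Delta>\<^esub> z) k)) / real (D k) =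
      ((s - real (psum x k)) / real (D k) + (t - real (psum z k)) / real (D k)) + of_int (int (adic_carry a x z k))"
    by (simp only: of_int_of_nat_eq)
  then have "E k (g \<otimes>\<^bsub>R\<^esub> h) = cis (2 * pi * ((s - real (psum x k)) / real (D k) + (t - real (psum z k)) / real (D k)))"
    unfolding E_def gh R_mult fst_conv snd_conv by (simp only: cis_2pi_add_int)
  then show ?thesis by (simp add: E_def gh cis_mult distrib_left)
qed

text \<open>A pair killed by all \<open>E k\<close> has an integer first component n, by
  \<open>E 0\<close>, and its second component then has residue n modulo every \<open>D k\<close>,
  just like n times the unit. With \<open>B\<close> as a common kernel, cosets can be compared
  through the \<open>E k\<close>.\<close>

lemma kernel_iff: "g \<in> B \<longleftrightarrow> g \<in> carrier R \<and> (\<forall>k. E k g = 1)"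
proof
  assume "g \<in> B"
  then obtain n :: int where g: "g = (of_int n, adic_unit [^]\<^bsub>\<Delta>\<^esub> n)"
    by (auto simp: solenoid_kernel_def)
  have "E k g = 1" for k
  proof -
    have "real (psum (adic_unit [^]\<^bsub>\<Delta>\<^esub> n) k) = of_int (n mod int (D k))"
      using psum_unit_int_power[of n k] by (metis of_int_of_nat_eq)
    moreover have "n - n mod int (D k) = int (D k) * (n div int (D k))"
      by (simp add: minus_mod_eq_mult_div)
    ultimately have "of_int n - real (psum (adic_unit [^]\<^bsub>\<Delta>\<^esub> n) k) = real (D k) * of_int (n div int (D k))"
      by (metis of_int_diff of_int_mult of_int_of_nat_eq)
    then have "E k g = cis (2 * pi * of_int (n div int (D k)))" by (simp add: E_def g)
    then show ?thesis by (simp only: cis_2pi_eq_1 Ints_of_int)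
  qed
  then show "g \<in> carrier R \<and> (\<forall>k. E k g = 1)"
    unfolding g R_carrier using adic.int_pow_closed[OF adic_unit_carrier] by auto
next
  assume g: "g \<in> carrier R \<and> (\<forall>k. E k g = 1)"
  obtain t x where tx: "g = (t, x)" by (cases g)
  have x: "x \<in> carrier \<Delta>" using g tx by (simp add: R_carrier)
  have "E 0 g = 1" using g by blast
  then obtain n where n: "t = of_int n" unfolding E_def tx cis_2pi_eq_1 by (auto elim!: Ints_cases)
  have "x = adic_unit [^]\<^bsub>\<Delta>\<^esub> n"
  proof (rule adic_eqI)
    fix k
    have "E k g = 1" using g by blast
    then obtain m where "(of_int n - real (psum x k)) / real (D k) = of_int m"
      unfolding E_def tx cis_2pi_eq_1 n by (auto elim!: Ints_cases)
    then have "of_int n - real (psum x k) = of_int m * real (D k)"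
      by (simp only: divide_eq_eq D_real_nonzero if_True not_False_eq_True)
    then have "real_of_int (n - int (psum x k)) = real_of_int (m * int (D k))" by simp
    then have "n = int (psum x k) + m * int (D k)" by linarith
    then have "n mod int (D k) = int (psum x k)" using psum_less[OF x, of k] by simp
    then show "psum x k = psum (adic_unit [^]\<^bsub>\<Delta>\<^esub> n) k"
      using psum_unit_int_power[of n k] by linarith
  qed
  then show "g \<in> B" using tx n by (auto simp: solenoid_kernel_def)
qed

lemma norm_E [simp]: "norm (E k g) = 1" by (simp add: E_def)

lemma E_nonzero [simp]: "E k g \<noteq> 0" by (metis norm_E norm_zero zero_neq_one)

lemma E_one: "E k \<one>\<^bsub>R\<^esub> = 1"
  using E_mult[of "\<one>\<^bsub>R\<^esub>" "\<one>\<^bsub>R\<^esub>" k] by simp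

lemma E_inv: "g \<in> carrier R \<Longrightarrow> E k (inv\<^bsub>R\<^esub> g) = inverse (E k g)"
  using E_mult[OF R.inv_closed, of g g k] R.l_inv[of g] E_one[of k]
  by (metis inverse_unique mult.commute)

lemma kernel_subgroup: "subgroup B R"
proof (rule R.subgroupI)
  show "B \<noteq> {}" by (auto simp: solenoid_kernel_def)
  show "B \<subseteq> carrier R" by (auto simp: kernel_iff)
  show "inv\<^bsub>R\<^esub> g \<in> B" if "g \<in> B" for g
    using that E_inv[of g] R.inv_closed[of g] by (metis inverse_1 kernel_iff)
  show "g \<otimes>\<^bsub>R\<^esub> h \<in> B" if "g \<in> B" "h \<in> B" for g h
    using that E_mult[of g h] R.m_closed[of g h] by (metis kernel_iff mult_1)
qed

sublocale B: normal B R
  by (rule R.subgroup_imp_normal[OF kernel_subgroup])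

sublocale G: comm_group G
  unfolding solenoid_def by (rule R.abelian_FactGroup[OF kernel_subgroup])

definition q :: "real \<times> (nat \<Rightarrow> nat) \<Rightarrow> (real \<times> (nat \<Rightarrow> nat)) set" where
  "q g = B #>\<^bsub>R\<^esub> g"

lemma G_carrier: "carrier G = q ` carrier R"
  by (auto simp: solenoid_def FactGroup_def RCOSETS_def q_def)

lemma q_carrier [simp]: "g \<in> carrier R \<Longrightarrow> q g \<in> carrier G"
  by (simp add: G_carrier)

lemma q_mult: "g \<in> carrier R \<Longrightarrow> h \<in> carrier R \<Longrightarrow> q g \<otimes>\<^bsub>G\<^esub> q h = q (g \<otimes>\<^bsub>R\<^esub> h)"
  by (simp add: solenoid_def FactGroup_def q_def B.rcos_sum del: mult_DirProd)

lemma q_eq_iff: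
  assumes "g \<in> carrier R" "h \<in> carrier R"
  shows "q g = q h \<longleftrightarrow> (\<forall>k. E k g = E k h)"
proof
  assume "q g = q h"
  moreover have "g \<in> q g" unfolding q_def using R.rcos_self[OF assms(1) kernel_subgroup] .
  ultimately obtain b where "b \<in> B" "g = b \<otimes>\<^bsub>R\<^esub> h" by (auto simp: q_def r_coset_def)
  then show "\<forall>k. E k g = E k h" using assms by (auto simp: kernel_iff E_mult simp del: mult_DirProd)
next
  assume "\<forall>k. E k g = E k h"
  then have b: "g \<otimes>\<^bsub>R\<^esub> inv\<^bsub>R\<^esub> h \<in> B"
    unfolding kernel_iff
    using E_mult[OF assms(1) R.inv_closed[OF assms(2)]] E_inv[OF assms(2)]
      R.m_closed[OF assms(1) R.inv_closed[OF assms(2)]]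
    by (metis E_nonzero right_inverse)
  have "(g \<otimes>\<^bsub>R\<^esub> inv\<^bsub>R\<^esub> h) \<otimes>\<^bsub>R\<^esub> h = g"
    using assms R.inv_solve_right' by (metis R.inv_closed R.l_inv R.m_assoc R.r_one)
  then have "g \<in> B #>\<^bsub>R\<^esub> h" using b unfolding r_coset_def by (metis UN_iff singletonI)
  then show "q g = q h" unfolding q_def using R.repr_independence[OF _ assms(2) kernel_subgroup] by metis
qed

text \<open>The choice of a representative is harmless because \<open>E k\<close> is constant on
  cosets of \<open>B\<close>.\<close>

definition y :: "nat \<Rightarrow> (real \<times> (nat \<Rightarrow> nat)) set \<Rightarrow> complex" where
  "y k C = E k (SOME g. g \<in> carrier R \<and> q g = C)"

lemma y_q: "g \<in> carrier R \<Longrightarrow> y k (q g) = E k g"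
  unfolding y_def using q_eq_iff by (metis (mono_tags, lifting) someI_ex)

lemma G_cases:
  assumes "x \<in> carrier G"
  obtains g where "g \<in> carrier R" "x = q g"
  using assms unfolding G_carrier by blast

lemma y_mult:
  assumes "x \<in> carrier G" "z \<in> carrier G"
  shows "y k (x \<otimes>\<^bsub>G\<^esub> z) = y k x * y k z"
proof -
  obtain g h where g: "g \<in> carrier R" "x = q g" and h: "h \<in> carrier R" "z = q h"
    using assms by (blast elim: G_cases)
  show ?thesis unfolding g(2) h(2) q_mult[OF g(1) h(1)] y_q[OF R.m_closed[OF g(1) h(1)]]
    y_q[OF g(1)] y_q[OF h(1)] by (rule E_mult[OF g(1) h(1)])
qed

lemma y_eqI:
  assumes "x \<in> carrier G" "z \<in> carrier G" "\<And>k. y k x = y k z"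
  shows "x = z"
proof -
  obtain g h where g: "g \<in> carrier R" "x = q g" and h: "h \<in> carrier R" "z = q h"
    using assms(1,2) by (blast elim: G_cases)
  have "E k g = E k h" for k
    using assms(3)[of k] unfolding g(2) h(2) y_q[OF g(1)] y_q[OF h(1)] .
  then show ?thesis unfolding g(2) h(2) q_eq_iff[OF g(1) h(1)] by (intro allI)
qed

lemma norm_y [simp]: "norm (y k x) = 1"
  by (simp add: y_def)

lemma E_Suc_power:
  assumes "g \<in> carrier R"
  shows "E (Suc k) g ^ a k = E k g"
proof -
  obtain t x where tx: "g = (t, x)" by (cases g)
  have ak: "real (a k) \<noteq> 0" using a_gt_1[of k] by simp
  have "real (a k) * ((t - real (psum x (Suc k))) / real (D (Suc k))) = (t - real (psum x k)) / real (D k) + of_int (- int (x k))"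
    unfolding D_Suc psum_Suc of_nat_mult of_nat_add
    using divide_digit_step[OF ak D_real_nonzero, of t "real (psum x k)" "real (x k)" k] by simp
  then have "cis (2 * pi * (real (a k) * ((t - real (psum x (Suc k))) / real (D (Suc k))))) = E k g"
    unfolding E_def tx fst_conv snd_conv by (simp only: cis_2pi_add_int)
  then show ?thesis unfolding E_def tx fst_conv snd_conv Complex.DeMoivre
    by (simp only: mult.left_commute)
qed

lemma y_Suc_power: "x \<in> carrier G \<Longrightarrow> y (Suc k) x ^ a k = y k x"
  by (auto simp: G_carrier y_q E_Suc_power)

lemma y_power_D:
  assumes "x \<in> carrier G" "k \<le> l"
  shows "y l x ^ (D l div D k) = y k x"
  using assms(2)
proof (induction l rule: dec_induct)
  case base
  then show ?case using D_pos[of k] by simp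
next
  case (step l)
  have "D (Suc l) div D k = a l * (D l div D k)"
    using D_dvd[OF step(1)] by (simp add: D_Suc div_mult_swap)
  then show ?case using step.IH y_Suc_power[OF assms(1), of l] by (simp add: power_mult)
qed

lemma y_one: "y k \<one>\<^bsub>G\<^esub> = 1"
  using y_mult[OF G.one_closed G.one_closed, of k] norm_y[of k "\<one>\<^bsub>G\<^esub>"]
  by (metis G.r_one G.one_closed mult_cancel_right1 norm_zero zero_neq_one)

text \<open>The one-parameter subgroup coming from the real factor. It turns out to be dense, so
  continuous characters can be compared on it.\<close>

definition line :: "real \<Rightarrow> (real \<times> (nat \<Rightarrow> nat)) set" where
  "line t = q (t, \<one>\<^bsub>\<Delta>\<^esub>)"

lemma line_R: "(t, \<one>\<^bsub>\<Delta>\<^esub>) \<in> carrier R"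
  unfolding R_carrier by simp

lemma line_carrier [simp]: "line t \<in> carrier G"
  unfolding line_def by (rule q_carrier[OF line_R])

lemma y_line: "y k (line t) = cis (2 * pi * (t / real (D k)))"
  by (simp add: line_def y_q[OF line_R] E_def psum_one)

lemma line_add: "line (s + t) = line s \<otimes>\<^bsub>G\<^esub> line t"
  by (rule y_eqI) (simp_all add: y_mult y_line cis_mult add_divide_distrib distrib_left)

end

section \<open>The topology of the solenoid\<close>

text \<open>Basic open sets of a product restrict finitely many coordinates only; agreement on an
  initial segment is all that the density arguments need.\<close>

lemma open_fun_nhd:
  fixes z :: "nat \<Rightarrow> 'b::topological_space"
  assumes "open V" "z \<in> V"
  obtains L where "\<And>w. (\<And>k. k \<le> L \<Longrightarrow> w k = z k) \<Longrightarrow> w \<in> V"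
proof -
  have "openin (product_topology (\<lambda>i. euclidean) UNIV) V"
    using assms(1) by (simp add: euclidean_product_topology)
  from product_topology_open_contains_basis[OF this assms(2)]
  obtain Y where Y: "z \<in> (\<Pi>\<^sub>E i\<in>UNIV. Y i)" "finite {i. Y i \<noteq> UNIV}" "(\<Pi>\<^sub>E i\<in>UNIV. Y i) \<subseteq> V"
    by auto
  obtain L where L: "\<And>i. Y i \<noteq> UNIV \<Longrightarrow> i \<le> L"
    using finite_nat_set_iff_bounded_le Y(2) by auto
  show ?thesis
  proof (rule that[of L])
    fix w assume w: "\<And>k. k \<le> L \<Longrightarrow> w k = z k"
    have "w i \<in> Y i" for i
      using L[of i] w[of i] Y(1) by (cases "Y i = UNIV") (auto simp: PiE_UNIV_domain)
    then show "w \<in> V" using Y(3) by (auto simp: PiE_UNIV_domain)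
  qed
qed

lemma additive_continuous_real_linear:
  fixes h :: "real \<Rightarrow> real"
  assumes add: "\<And>s t. h (s + t) = h s + h t" and cont: "continuous_on UNIV h"
  shows "h t = h 1 * t"
proof -
  interpret additive h by standard (rule add)
  have nat: "h (of_nat n * t) = of_nat n * h t" for n t
    by (induction n) (auto simp: zero distrib_right add)
  have int: "h (of_int k * t) = of_int k * h t" for k t
  proof (cases "k \<ge> 0")
    case True
    then show ?thesis using nat[of "nat k" t] by simp
  next
    case False
    then show ?thesis using nat[of "nat (-k)" t] minus[of "real (nat (-k)) * t"] by simp
  qed
  have rat: "h t - h 1 * t = 0" if "t \<in> \<rat>" for t
  proof -
    obtain m n where t: "t = of_int m / of_int n" "n > 0" using \<open>t \<in> \<rat>\<close> by (auto elim: Rats_cases')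
    have "of_int n * h t = h (of_int m * 1)" using int[of n t] t by simp
    also have "\<dots> = of_int m * h 1" by (rule int)
    finally have "h t = of_int m * h 1 / of_int n" using t(2) by (auto simp: eq_divide_eq mult.commute)
    moreover have "h 1 * t = of_int m * h 1 / of_int n" unfolding t(1) by simp
    ultimately show ?thesis by (simp only: diff_self)
  qed
  have "h t - h 1 * t = 0"
    by (rule continuous_constant_on_closure[of \<rat> "\<lambda>t. h t - h 1 * t"])
       (auto simp: Rats_closure_real rat intro!: continuous_intros cont)
  then show ?thesis by simp
qed

lemma cis_eq_1_iff: "cis x = 1 \<longleftrightarrow> (\<exists>m::int. x = 2 * pi * of_int m)"
proof
  assume "cis x = 1"
  then have "cos x = 1" by (metis cis.sel(1) one_complex.sel(1))
  then obtain m :: int where "x = of_int m * 2 * pi" unfolding cos_one_2pi_int by blast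
  then show "\<exists>m::int. x = 2 * pi * of_int m" by (intro exI[of _ m]) simp
qed auto

text \<open>The real line is contractible, so \<open>v\<close> has a continuous logarithm. Its
  normalized imaginary part \<open>h\<close> is additive up to multiples of 2 pi; this error is
  continuous with discrete range, hence constant, and it vanishes at 0.\<close>

lemma circle_hom_eq_cis:
  fixes v :: "real \<Rightarrow> complex"
  assumes cont: "continuous_on UNIV v" and mult: "\<And>s t. v (s + t) = v s * v t"
    and norm: "\<And>t. norm (v t) = 1"
  obtains c where "\<And>t. v t = cis (c * t)"
proof -
  have v0: "v t \<noteq> 0" for t using norm[of t] by auto
  obtain g where g: "continuous_on UNIV g" "\<And>t. v t = exp (g t)"
    using continuous_logarithm_on_contractible[OF cont _ v0] contractible_UNIV by auto
  have Re: "Re (g t) = 0" for t using norm[of t] by (simp add: g(2))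
  define h where "h t = Im (g t) - Im (g 0)" for t
  have vexp: "v t = cis (Im (g t))" for t
    using g(2)[of t] Re[of t] by (simp add: exp_eq_polar)
  have "v 0 = 1" using mult[of 0 0] v0[of 0] by simp
  then have vh: "v t = cis (h t)" for t
    using vexp[of t] vexp[of 0] by (simp add: h_def flip: cis_divide)
  have cont_h: "continuous_on A h" for A
    unfolding h_def by (intro continuous_intros continuous_on_subset[OF g(1) subset_UNIV])
  have "h (s + t) = h s + h t" for s t
  proof -
    define d where "d = (\<lambda>t. h (s + t) - h s - h t)"
    have "d constant_on UNIV"
    proof (rule continuous_discrete_range_constant)
      show "continuous_on UNIV d" unfolding d_def
        by (intro continuous_intros continuous_on_compose2[OF cont_h[of UNIV]] cont_h) auto
      show "\<exists>e>0. \<forall>y. y \<in> UNIV \<and> d y \<noteq> d x \<longrightarrow> e \<le> norm (d y - d x)" if "x \<in> UNIV" for x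
      proof (intro exI[of _ "2 * pi"] conjI allI impI)
        fix y assume y: "y \<in> UNIV \<and> d y \<noteq> d x"
        have "\<exists>m::int. d t = 2 * pi * of_int m" for t
        proof -
          have "cis (h (s + t)) = cis (h s + h t)" using mult[of s t] by (simp only: vh cis_mult)
          moreover have "h (s + t) = d t + (h s + h t)" by (simp add: d_def)
          ultimately have "cis (d t) * cis (h s + h t) = cis (h s + h t)" by (simp only: cis_mult)
          then have "cis (d t) = 1" by (metis cis_neq_zero mult_cancel_right1)
          then show ?thesis unfolding cis_eq_1_iff .
        qed
        then obtain m n :: int where "d x = 2 * pi * of_int m" "d y = 2 * pi * of_int n" by metis
        then have *: "d y - d x = 2 * pi * of_int (n - m)" by (simp add: algebra_simps)
        with y have "n \<noteq> m" by auto
        then have "1 \<le> \<bar>real_of_int (n - m)\<bar>" by linarith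
        then show "2 * pi \<le> norm (d y - d x)" unfolding * by (simp add: abs_mult)
      qed simp
    qed simp
    then have "d t = d 0" by (auto simp: constant_on_def)
    also have "d 0 = 0" by (simp add: d_def h_def)
    finally show ?thesis by (simp add: d_def)
  qed
  then have lin: "h t = h 1 * t" for t by (rule additive_continuous_real_linear[OF _ cont_h])
  have "v t = cis (h 1 * t)" for t unfolding vh[of t] by (rule arg_cong[OF lin])
  then show ?thesis by (rule that)
qed

text \<open>Doubling the angle multiplies \<open>1 - Re z\<close> by at least 3 as long as \<open>Re z \<ge> 1 / 2\<close>.\<close>

lemma no_small_subgroups:
  fixes z :: complex
  assumes "norm z = 1" "\<And>n. norm (z ^ n - 1) < 1"
  shows "z = 1"
proof -
  have Re: "Re (z ^ n) \<ge> 1 / 2" for n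
  proof -
    have n1: "norm (z ^ n) = 1" using assms(1) by (simp add: norm_power)
    have "norm (z ^ n - 1) ^ 2 < 1" using assms(2)[of n] by (simp add: power_less_one_iff)
    moreover have "norm (z ^ n - 1) ^ 2 = norm (z ^ n) ^ 2 + 1 - 2 * Re (z ^ n)"
      by (simp only: cmod_power2) (simp add: power2_eq_square algebra_simps)
    ultimately show ?thesis using n1 by simp
  qed
  have "3 ^ k * (1 - Re z) \<le> 1 - Re (z ^ (2 ^ k))" for k
  proof (induction k)
    case (Suc k)
    let ?w = "z ^ (2 ^ k)"
    have n1: "norm ?w = 1" using assms(1) by (simp add: norm_power)
    then have "(Re ?w)\<^sup>2 + (Im ?w)\<^sup>2 = 1" by (simp add: cmod_def)
    then have "1 - Re (?w\<^sup>2) = 2 * (1 - Re ?w) * (1 + Re ?w)"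
      by (simp add: power2_eq_square algebra_simps)
    moreover have "Re ?w \<le> 1" using complex_Re_le_cmod[of ?w] n1 by simp
    then have "2 * (1 - Re ?w) * (1 + Re ?w) \<ge> 2 * (1 - Re ?w) * (3 / 2)"
      using Re[of "2 ^ k"] by (intro mult_left_mono) auto
    moreover have "z ^ 2 ^ Suc k = ?w\<^sup>2" by (simp add: power_mult[symmetric] mult.commute)
    ultimately show ?case using Suc by simp
  qed simp
  note grow = this
  have le: "3 ^ k * (1 - Re z) \<le> 1 / 2" for k
    using grow[of k] Re[of "2 ^ k"] by linarith
  have "Re z \<le> 1" using complex_Re_le_cmod[of z] assms(1) by simp
  moreover have "\<not> Re z < 1"
  proof
    assume "Re z < 1"
    then obtain k where "1 / 2 / (1 - Re z) < 3 ^ k" using real_arch_pow[of 3 "1 / 2 / (1 - Re z)"] by auto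
    then show False using le[of k] \<open>Re z < 1\<close> by (simp add: field_simps)
  qed
  ultimately have "Re z = 1" by simp
  moreover from this have "Im z = 0" using assms(1) by (simp add: cmod_def)
  ultimately show ?thesis by (simp add: complex_eq_iff)
qed

context adic
begin

abbreviation "T \<equiv> solenoid_topology a"

abbreviation "RT \<equiv> prod_topology euclideanreal (adic_topology a)"

lemma topspace_adic: "topspace (adic_topology a) = carrier \<Delta>"
  by (simp add: adic_topology_def adic_integers_def)

lemma topspace_RT: "topspace RT = carrier R"
  by (simp add: topspace_adic real_group_def)

lemma T_eq: "T = quotient_topology RT q"
  by (simp add: solenoid_topology_def q_def[abs_def])

lemma quotient_map_q: "quotient_map RT T q"
  unfolding T_eq by (rule quotient_map_quotient_topology)

lemma topspace_T [simp]: "topspace T = carrier G"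
  unfolding T_eq topspace_quotient_topology topspace_RT G_carrier ..

lemma continuous_psum: "continuous_map (adic_topology a) euclideanreal (\<lambda>x. real (psum x k))"
proof -
  have "continuous_map (adic_topology a) euclideanreal (real \<circ> (\<lambda>x. x i))" for i
    by (rule continuous_map_compose[of _ "discrete_topology {..<a i}"])
       (auto simp: adic_topology_def intro: continuous_map_product_projection)
  then show ?thesis unfolding psum_def
    by (auto intro!: continuous_map_sum continuous_map_real_mult simp: o_def)
qed

lemma continuous_E: "continuous_map RT euclidean (E k)"
proof -
  have "continuous_map RT euclideanreal (\<lambda>g. 2 * pi * ((fst g - real (psum (snd g) k)) / real (D k)))"
    by (intro continuous_map_real_mult continuous_map_diff continuous_map_real_divide
          continuous_map_fst continuous_map_compose[OF continuous_map_snd continuous_psum, unfolded o_def])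
       (auto simp: D_pos)
  then have "continuous_map RT euclidean (cis \<circ> (\<lambda>g. 2 * pi * ((fst g - real (psum (snd g) k)) / real (D k))))"
    by (rule continuous_map_compose) (auto intro!: continuous_intros)
  then show ?thesis by (simp add: E_def[abs_def] o_def)
qed

lemma continuous_y: "continuous_map T euclidean (y k)"
proof (rule continuous_compose_quotient_map[OF quotient_map_q])
  show "continuous_map RT euclidean (y k \<circ> q)"
    by (rule continuous_map_eq[OF continuous_E[of k]]) (simp only: topspace_RT o_apply y_q)
qed

text \<open>Subtracting the integer part of the real component, together with the same multiple of
  the unit, is a shift by an element of \<open>B\<close>. So the compact set [0, 1] x \<Delta>
  already meets every coset.\<close>

lemma compact_T: "compact_space T"
proof -
  have "compactin (adic_topology a) (carrier \<Delta>)"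
    unfolding topspace_adic[symmetric] compact_space_def[symmetric] adic_topology_def
    by (intro compact_space_product_topology[THEN iffD2] disjI2 ballI)
      (simp only: compact_space_discrete_topology finite_lessThan)
  then have "compactin RT ({0..1} \<times> carrier \<Delta>)"
    unfolding compactin_Times compactin_euclidean_iff by (intro disjI2 conjI compact_Icc)
  then have "compactin T (q ` ({0..1} \<times> carrier \<Delta>))"
    by (rule image_compactin[OF _ quotient_imp_continuous_map[OF quotient_map_q]])
  moreover have "q ` ({0..1} \<times> carrier \<Delta>) = carrier G"
  proof
    show "q ` ({0..1} \<times> carrier \<Delta>) \<subseteq> carrier G"
      unfolding G_carrier R_carrier by (intro image_mono Sigma_mono subset_UNIV order_refl)
    show "carrier G \<subseteq> q ` ({0..1} \<times> carrier \<Delta>)"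
    proof
      fix x assume "x \<in> carrier G"
      then obtain g where g: "g \<in> carrier R" "x = q g" by (rule G_cases)
      obtain t v where tv: "g = (t, v)" by (cases g)
      define b where "b = (of_int (- \<lfloor>t\<rfloor>) :: real, adic_unit [^]\<^bsub>\<Delta>\<^esub> (- \<lfloor>t\<rfloor>))"
      have b: "b \<in> B" unfolding b_def solenoid_kernel_def by (rule CollectI, rule exI[of _ "- \<lfloor>t\<rfloor>"]) (intro conjI refl TrueI)
      have bR: "b \<in> carrier R" by (rule conjunct1[OF b[unfolded kernel_iff]])
      have bE: "E k b = 1" for k by (rule spec[OF conjunct2[OF b[unfolded kernel_iff]]])
      have "q g = q (b \<otimes>\<^bsub>R\<^esub> g)"
        unfolding q_eq_iff[OF g(1) R.m_closed[OF bR g(1)]] E_mult[OF bR g(1)] bE mult_1 by (intro allI refl)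
      moreover have "b \<otimes>\<^bsub>R\<^esub> g \<in> {0..1} \<times> carrier \<Delta>"
      proof -
        have "snd (b \<otimes>\<^bsub>R\<^esub> g) \<in> carrier \<Delta>"
          using R.m_closed[OF bR g(1)] unfolding R_carrier mem_Times_iff by (rule conjunct2)
        moreover have "fst (b \<otimes>\<^bsub>R\<^esub> g) = t - of_int \<lfloor>t\<rfloor>"
          unfolding b_def tv R_mult fst_conv by simp
        then have "fst (b \<otimes>\<^bsub>R\<^esub> g) \<in> {0..1}" unfolding atLeastAtMost_iff by linarith
        ultimately show ?thesis unfolding mem_Times_iff by (intro conjI)
      qed
      ultimately show "x \<in> q ` ({0..1} \<times> carrier \<Delta>)" unfolding g(2) by (rule image_eqI)
    qed
  qed
  ultimately show ?thesis by (simp only: compact_space_def topspace_T)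
qed

section \<open>The solenoid as an inverse limit of circles\<close>

definition \<Phi> :: "(real \<times> (nat \<Rightarrow> nat)) set \<Rightarrow> nat \<Rightarrow> complex" where
  "\<Phi> x = (\<lambda>k. y k x)"

lemma \<Phi>_apply [simp]: "\<Phi> x k = y k x"
  by (simp add: \<Phi>_def)

lemma inj_\<Phi>: "inj_on \<Phi> (carrier G)"
  by (rule inj_onI) (metis y_eqI \<Phi>_apply)

lemma continuous_\<Phi>: "continuous_map T euclidean \<Phi>"
  unfolding euclidean_product_topology[symmetric] continuous_map_componentwise_UNIV
  using continuous_y by simp

lemma compact_\<Phi>: "compact (\<Phi> ` carrier G)"
  using image_compactin[OF _ continuous_\<Phi>, of "carrier G"] compact_T
  by (simp add: compact_space_def)

text \<open>A continuous injection of a compact space into a Hausdorff space is an embedding. From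
  here on the quotient topology can be replaced by conditions on the coordinates
  \<open>y k\<close>.\<close>

lemma openin_T_iff: "openin T U \<longleftrightarrow> (\<exists>V. open V \<and> U = \<Phi> -` V \<inter> carrier G)"
proof
  assume U: "openin T U"
  define C where "C = carrier G - U"
  have "closedin T C" using closedin_diff[OF closedin_topspace U] by (simp add: C_def)
  then have "compactin T C" by (rule closedin_compact_space[OF compact_T])
  then have "compact (\<Phi> ` C)" using image_compactin[OF _ continuous_\<Phi>] by simp
  then have "open (- \<Phi> ` C)" by (simp add: compact_imp_closed open_Compl)
  moreover have "U = \<Phi> -` (- \<Phi> ` C) \<inter> carrier G"
    using openin_subset[OF U] inj_\<Phi> by (auto simp: C_def inj_on_def)
  ultimately show "\<exists>V. open V \<and> U = \<Phi> -` V \<inter> carrier G" by blast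
next
  assume "\<exists>V. open V \<and> U = \<Phi> -` V \<inter> carrier G"
  then obtain V where "open V" "U = \<Phi> -` V \<inter> carrier G" by blast
  moreover have "\<Phi> -` V \<inter> carrier G = {x \<in> topspace T. \<Phi> x \<in> V}" by auto
  ultimately show "openin T U"
    using openin_continuous_map_preimage[OF continuous_\<Phi>, of V] by simp
qed

lemma open_nhd:
  assumes "openin T U" "x \<in> U"
  obtains L where "\<And>z. z \<in> carrier G \<Longrightarrow> (\<And>k. k \<le> L \<Longrightarrow> y k z = y k x) \<Longrightarrow> z \<in> U"
proof -
  obtain V where V: "open V" "U = \<Phi> -` V \<inter> carrier G" using assms by (auto simp: openin_T_iff)
  obtain L where L: "\<And>w. (\<And>k. k \<le> L \<Longrightarrow> w k = \<Phi> x k) \<Longrightarrow> w \<in> V"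
    using open_fun_nhd[OF V(1), of "\<Phi> x"] assms(2) V by blast
  show ?thesis by (rule that[of L]) (use L V in auto)
qed

lemma power_chain:
  fixes z :: "nat \<Rightarrow> complex"
  assumes "\<And>k. z (Suc k) ^ a k = z k" "k \<le> l"
  shows "z l ^ (D l div D k) = z k"
  using assms(2)
proof (induction l rule: dec_induct)
  case base
  then show ?case using D_pos[of k] by simp
next
  case (step l)
  have "D (Suc l) div D k = a l * (D l div D k)"
    using D_dvd[OF step(1)] by (simp add: D_Suc div_mult_swap)
  then show ?case using step.IH assms(1)[of l] by (simp add: power_mult)
qed

text \<open>It suffices to match coordinate \<open>L\<close>: on both sides the lower coordinates
  are powers of it.\<close>

lemma line_approx:
  assumes "\<And>k. norm (z k) = 1" "\<And>k. z (Suc k) ^ a k = z k"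
  obtains t where "\<And>k. k \<le> L \<Longrightarrow> y k (line t) = z k"
proof -
  obtain r where r: "z L = cis r" using assms(1)[of L] by (metis complex_norm_eq_1_exp cis_conv_exp)
  define t where "t = r * real (D L) / (2 * pi)"
  have "y L (line t) = z L" using r D_pos[of L] by (simp add: y_line t_def)
  then have "y k (line t) = z k" if "k \<le> L" for k
    using power_chain[of z, OF assms(2) that] power_chain[of "\<lambda>k. y k (line t)", OF y_Suc_power[OF line_carrier] that]
    by simp
  then show ?thesis by (rule that)
qed

text \<open>A compatible sequence outside the image would, the image being closed, be separated from
  it by finitely many coordinates; but a point of the line matches these. The equality allows
  measures on sequences to be pulled back to the solenoid.\<close>

lemma \<Phi>_image: "\<Phi> ` carrier G = {z. \<forall>k. norm (z k) = 1 \<and> z (Suc k) ^ a k = z k}"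
proof
  show "\<Phi> ` carrier G \<subseteq> {z. \<forall>k. norm (z k) = 1 \<and> z (Suc k) ^ a k = z k}"
    by (auto simp: y_Suc_power)
  show "{z. \<forall>k. norm (z k) = 1 \<and> z (Suc k) ^ a k = z k} \<subseteq> \<Phi> ` carrier G"
  proof (rule subsetI, rule ccontr)
    fix z assume z: "z \<in> {z. \<forall>k. norm (z k) = 1 \<and> z (Suc k) ^ a k = z k}" "z \<notin> \<Phi> ` carrier G"
    have "open (- \<Phi> ` carrier G)" using compact_\<Phi> by (simp add: compact_imp_closed open_Compl)
    then obtain L where L: "\<And>w. (\<And>k. k \<le> L \<Longrightarrow> w k = z k) \<Longrightarrow> w \<in> - \<Phi> ` carrier G"
      using open_fun_nhd[of "- \<Phi> ` carrier G" z] z by auto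
    obtain t where "\<And>k. k \<le> L \<Longrightarrow> y k (line t) = z k" using line_approx[of z L] z by auto
    then have "\<Phi> (line t) \<in> - \<Phi> ` carrier G" by (intro L) simp
    then show False using line_carrier by blast
  qed
qed

lemma open_contains_line:
  assumes "openin T U" "x \<in> U"
  obtains t where "line t \<in> U"
proof -
  obtain L where L: "\<And>z. z \<in> carrier G \<Longrightarrow> (\<And>k. k \<le> L \<Longrightarrow> y k z = y k x) \<Longrightarrow> z \<in> U"
    using open_nhd[OF assms] by blast
  have x: "x \<in> carrier G" using openin_subset[OF assms(1)] assms(2) by auto
  obtain t where "\<And>k. k \<le> L \<Longrightarrow> y k (line t) = y k x"
    using line_approx[of "\<lambda>k. y k x" L] y_Suc_power[OF x] by auto
  then show ?thesis using that[of t] L[of "line t"] by simp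
qed

lemma continuous_map_T_iff:
  "continuous_map Z T f \<longleftrightarrow> f \<in> topspace Z \<rightarrow> carrier G \<and> (\<forall>k. continuous_map Z euclidean (\<lambda>z. y k (f z)))"
proof
  assume f: "continuous_map Z T f"
  then show "f \<in> topspace Z \<rightarrow> carrier G \<and> (\<forall>k. continuous_map Z euclidean (\<lambda>z. y k (f z)))"
    using continuous_map_compose[OF f continuous_y] continuous_map_image_subset_topspace[OF f]
    by (auto simp: o_def)
next
  assume f: "f \<in> topspace Z \<rightarrow> carrier G \<and> (\<forall>k. continuous_map Z euclidean (\<lambda>z. y k (f z)))"
  then have c: "continuous_map Z euclidean (\<lambda>z. \<Phi> (f z))"
    unfolding euclidean_product_topology[symmetric] continuous_map_componentwise_UNIV by simp
  show "continuous_map Z T f"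
    unfolding continuous_map_def
  proof (intro conjI allI impI)
    fix U assume "openin T U"
    then obtain V where V: "open V" "U = \<Phi> -` V \<inter> carrier G" by (auto simp: openin_T_iff)
    have "{z \<in> topspace Z. f z \<in> U} = {z \<in> topspace Z. \<Phi> (f z) \<in> V}" using f V(2) by auto
    then show "openin Z {z \<in> topspace Z. f z \<in> U}"
      using openin_continuous_map_preimage[OF c, of V] V(1) by simp
  qed (use f in auto)
qed

lemma continuous_line: "continuous_map euclideanreal T line"
  unfolding continuous_map_T_iff by (auto simp: y_line less_imp_neq[OF D_pos, symmetric] intro!: continuous_intros)

lemma eq_on_lines_imp_eq:
  fixes u v :: "_ \<Rightarrow> complex"
  assumes u: "continuous_map T euclidean u" and v: "continuous_map T euclidean v"
    and eq: "\<And>t. u (line t) = v (line t)" and x: "x \<in> carrier G"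
  shows "u x = v x"
proof (rule ccontr)
  assume neq: "u x \<noteq> v x"
  have "continuous_map T euclidean (\<lambda>x. u x - v x)" using u v by (rule continuous_map_diff)
  then have "openin T {x \<in> topspace T. u x - v x \<in> - {0}}"
    by (rule openin_continuous_map_preimage) auto
  then obtain t where "line t \<in> {x \<in> topspace T. u x - v x \<in> - {0}}"
    by (rule open_contains_line[of _ x]) (use neq x in auto)
  then show False using eq by simp
qed

section \<open>Borel sets and measurable maps\<close>

lemma space_borel [simp]: "space (borel_algebra T) = carrier G"
  by (simp add: borel_algebra_def space_measure_of_conv)

lemma sets_borel: "sets (borel_algebra T) = {\<Phi> -` A \<inter> carrier G | A. A \<in> sets borel}"
proof -
  have "sets (borel_algebra T) = sigma_sets (carrier G) {U. openin T U}"
    unfolding borel_algebra_def using openin_subset[of T] by (subst sets_measure_of) auto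
  also have "{U. openin T U} = {\<Phi> -` A \<inter> carrier G | A. A \<in> Collect open}"
    by (auto simp: openin_T_iff)
  also have "sigma_sets (carrier G) \<dots> = {\<Phi> -` A \<inter> carrier G | A. A \<in> sigma_sets UNIV (Collect open)}"
    by (rule sigma_sets_vimage_commute[symmetric]) auto
  also have "sigma_sets UNIV (Collect open) = sets borel"
    by (simp add: borel_def)
  finally show ?thesis .
qed

text \<open>The Borel sets are the preimages under \<Phi> of Borel sets in a countable product,
  whose sigma-algebra comes from the coordinates.\<close>

lemma measurable_T_iff:
  "f \<in> measurable N (borel_algebra T) \<longleftrightarrow>
    f \<in> space N \<rightarrow> carrier G \<and> (\<forall>k. (\<lambda>\<omega>. y k (f \<omega>)) \<in> borel_measurable N)"
proof -
  have eq: "sets (borel_algebra T) = sets (vimage_algebra (carrier G) \<Phi> borel)"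
    unfolding sets_borel by (simp add: sets_vimage_algebra2)
  have \<Phi>: "\<Phi> \<in> measurable (borel_algebra T) borel"
    unfolding measurable_cong_sets[OF eq refl] by (rule measurable_vimage_algebra1) simp
  show ?thesis
  proof (intro iffI conjI allI)
    assume f: "f \<in> measurable N (borel_algebra T)"
    show "f \<in> space N \<rightarrow> carrier G" using measurable_space[OF f] by auto
    fix k
    have "(\<lambda>\<omega>. \<Phi> (f \<omega>)) \<in> measurable N borel" using f \<Phi> by (rule measurable_compose)
    then have "(\<lambda>\<omega>. \<Phi> (f \<omega>) k) \<in> borel_measurable N"
      by (rule measurable_compose[OF _ measurable_product_coordinates])
    then show "(\<lambda>\<omega>. y k (f \<omega>)) \<in> borel_measurable N" by simp
  next
    assume f: "f \<in> space N \<rightarrow> carrier G \<and> (\<forall>k. (\<lambda>\<omega>. y k (f \<omega>)) \<in> borel_measurable N)"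
    then have "(\<lambda>\<omega>. \<Phi> (f \<omega>)) \<in> measurable N borel"
      by (intro measurable_coordinatewise_then_product) simp
    then show "f \<in> measurable N (borel_algebra T)"
      unfolding measurable_cong_sets[OF refl eq] using f by (intro measurable_vimage_algebra2) auto
  qed
qed

lemma measurable_\<Phi>: "\<Phi> \<in> measurable (borel_algebra T) borel"
proof (rule measurable_coordinatewise_then_product)
  have "(\<lambda>x. x) \<in> measurable (borel_algebra T) (borel_algebra T)" by simp
  then show "(\<lambda>x. \<Phi> x k) \<in> borel_measurable (borel_algebra T)" for k
    unfolding measurable_T_iff by simp
qed

lemma continuous_imp_measurable:
  assumes "continuous_map T euclidean (f :: _ \<Rightarrow> complex)"
  shows "f \<in> borel_measurable (borel_algebra T)"
proof (rule borel_measurableI)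
  fix V :: "complex set" assume "open V"
  then have "openin T {x \<in> topspace T. f x \<in> V}"
    using openin_continuous_map_preimage[OF assms, of V] by simp
  moreover have "f -` V \<inter> space (borel_algebra T) = {x \<in> topspace T. f x \<in> V}" by auto
  ultimately show "f -` V \<inter> space (borel_algebra T) \<in> sets (borel_algebra T)"
    unfolding borel_algebra_def using openin_subset[of T] by (subst sets_measure_of) auto
qed


section \<open>The characters of the solenoid\<close>

definition H :: "real set" where "H = {r. \<exists>k. r * real (D k) \<in> \<int>}"

text \<open>The character of frequency \<open>r\<close>, which on the line is t -> exp (2 pi i r t).
  \<open>LEAST\<close> merely fixes a level; every level at which \<open>r\<close> becomes an
  integer gives the same value. Outside \<open>H\<close> the value is unspecified.\<close>

definition chr :: "real \<Rightarrow> (real \<times> (nat \<Rightarrow> nat)) set \<Rightarrow> complex" where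
  "chr r x = (let k = LEAST k. r * real (D k) \<in> \<int> in cpow \<lfloor>r * real (D k)\<rfloor> (y k x))"

lemma scale_up:
  assumes "r * real (D k) = of_int m" "k \<le> l"
  shows "r * real (D l) = of_int (int (D l div D k) * m)"
proof -
  have "real (D l) = real (D l div D k) * real (D k)"
    using D_dvd[OF assms(2)] by (metis dvd_div_mult_self of_nat_mult)
  then have "r * real (D l) = real (D l div D k) * (r * real (D k))" by simp
  then show ?thesis unfolding assms(1) by simp
qed

lemma H_cases:
  assumes "r \<in> H"
  obtains k m where "r * real (D k) = of_int m"
  using assms by (auto simp: H_def elim!: Ints_cases)

lemma H_I: "r * real (D k) = of_int m \<Longrightarrow> r \<in> H"
  unfolding H_def by (rule CollectI, rule exI[of _ k]) simp

lemma H_common: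
  assumes "r \<in> H" "s \<in> H"
  obtains k m n where "r * real (D k) = of_int m" "s * real (D k) = of_int n"
proof -
  obtain i m where i: "r * real (D i) = of_int m" using assms(1) by (rule H_cases)
  obtain j n where j: "s * real (D j) = of_int n" using assms(2) by (rule H_cases)
  show ?thesis
    by (rule that[OF scale_up[OF i max.cobounded1[of i j]] scale_up[OF j max.cobounded2[of j i]]])
qed

lemma H_0: "0 \<in> H" and H_1: "1 \<in> H"
  by (rule H_I[of _ 0 0], simp) (rule H_I[of _ 0 1], simp)

lemma H_plus: "r \<in> H \<Longrightarrow> s \<in> H \<Longrightarrow> r + s \<in> H"
proof -
  assume "r \<in> H" "s \<in> H"
  then obtain k m n where k: "r * real (D k) = of_int m" "s * real (D k) = of_int n" by (rule H_common)
  then have "(r + s) * real (D k) = of_int (m + n)" by (simp add: distrib_right)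
  then show ?thesis by (rule H_I)
qed

lemma H_minus: "r \<in> H \<Longrightarrow> - r \<in> H"
  by (erule H_cases) (rule H_I[of _ _ "- _"], simp)

lemma H_Rats: "H \<subseteq> \<rat>"
proof
  fix r assume "r \<in> H"
  then obtain k m where "r * real (D k) = of_int m" by (rule H_cases)
  then have "r = of_int m / of_nat (D k)" using D_pos[of k] by (simp add: eq_divide_eq)
  then show "r \<in> \<rat>" by simp
qed

lemma chr_eq:
  assumes x: "x \<in> carrier G" and r: "r * real (D k) = of_int m"
  shows "chr r x = cpow m (y k x)"
proof -
  define i where "i = (LEAST k. r * real (D k) \<in> \<int>)"
  have ex: "r * real (D k) \<in> \<int>" using r by simp
  have ik: "i \<le> k" unfolding i_def using ex by (rule Least_le)
  have "r * real (D i) \<in> \<int>" unfolding i_def using ex by (rule LeastI)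
  then obtain n where n: "r * real (D i) = of_int n" by (rule Ints_cases)
  have "chr r x = cpow n (y i x)" by (simp add: chr_def Let_def i_def[symmetric] n)
  also have "\<dots> = cpow n (y k x ^ (D k div D i))" by (simp only: y_power_D[OF x ik])
  also have "\<dots> = cpow (int (D k div D i) * n) (y k x)" by (rule cpow_power) simp
  also have "int (D k div D i) * n = m" using scale_up[OF n ik] r by (simp only: of_int_eq_iff)
  finally show ?thesis .
qed

lemma norm_chr: "x \<in> carrier G \<Longrightarrow> r \<in> H \<Longrightarrow> norm (chr r x) = 1"
  by (erule H_cases) (simp add: chr_eq norm_cpow)

lemma chr_add: "x \<in> carrier G \<Longrightarrow> r \<in> H \<Longrightarrow> s \<in> H \<Longrightarrow> chr (r + s) x = chr r x * chr s x"
proof -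
  assume x: "x \<in> carrier G" and rs: "r \<in> H" "s \<in> H"
  from rs obtain k m n where k: "r * real (D k) = of_int m" "s * real (D k) = of_int n" by (rule H_common)
  then have "(r + s) * real (D k) = of_int (m + n)" by (simp add: distrib_right)
  then show ?thesis unfolding chr_eq[OF x k(1)] chr_eq[OF x k(2)] chr_eq[OF x \<open>(r + s) * _ = _\<close>]
    by (simp add: cpow_add)
qed

lemma chr_mult:
  assumes "x \<in> carrier G" "z \<in> carrier G" "r \<in> H"
  shows "chr r (x \<otimes>\<^bsub>G\<^esub> z) = chr r x * chr r z"
proof -
  obtain k m where k: "r * real (D k) = of_int m" using assms(3) by (rule H_cases)
  show ?thesis unfolding chr_eq[OF assms(1) k] chr_eq[OF assms(2) k] chr_eq[OF G.m_closed[OF assms(1,2)] k]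
    y_mult[OF assms(1,2)] by (rule cpow_mult_base) simp_all
qed

lemma chr_line: "r \<in> H \<Longrightarrow> chr r (line t) = cis (2 * pi * r * t)"
proof -
  assume "r \<in> H"
  then obtain k m where k: "r * real (D k) = of_int m" by (rule H_cases)
  have "of_int m * (2 * pi * (t / real (D k))) = 2 * pi * r * t"
    unfolding k[symmetric] using D_real_nonzero[of k] by simp
  then show ?thesis unfolding chr_eq[OF line_carrier k] y_line cpow_cis by (rule arg_cong)
qed

lemma y_eq_chr: "x \<in> carrier G \<Longrightarrow> y k x = chr (1 / real (D k)) x"
  using chr_eq[of x "1 / real (D k)" k 1] D_pos[of k] by simp

lemma inverse_D_H: "1 / real (D k) \<in> H"
  using H_I[of "1 / real (D k)" k 1] D_pos[of k] by simp

lemma chr_continuous: "r \<in> H \<Longrightarrow> continuous_map T euclidean (chr r)"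
proof -
  assume "r \<in> H"
  then obtain k m where k: "r * real (D k) = of_int m" by (rule H_cases)
  have "continuous_map T euclidean (cpow m \<circ> y k)"
    by (rule continuous_map_compose[OF continuous_y]) (simp add: continuous_cpow)
  then show ?thesis by (rule continuous_map_eq) (simp add: chr_eq[OF _ k])
qed

lemma chr_measurable: "r \<in> H \<Longrightarrow> chr r \<in> borel_measurable (borel_algebra T)"
  by (intro continuous_imp_measurable chr_continuous)

lemma chr_eqI:
  "x \<in> carrier G \<Longrightarrow> z \<in> carrier G \<Longrightarrow> (\<And>r. r \<in> H \<Longrightarrow> chr r x = chr r z) \<Longrightarrow> x = z"
  by (rule y_eqI) (simp_all add: y_eq_chr inverse_D_H)

lemma chr_one: "r \<in> H \<Longrightarrow> chr r \<one>\<^bsub>G\<^esub> = 1"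
proof -
  assume r: "r \<in> H"
  have "chr r \<one>\<^bsub>G\<^esub> * chr r \<one>\<^bsub>G\<^esub> = chr r \<one>\<^bsub>G\<^esub>"
    using chr_mult[OF G.one_closed G.one_closed r] by simp
  moreover have "chr r \<one>\<^bsub>G\<^esub> \<noteq> 0" using norm_chr[OF G.one_closed r] by auto
  ultimately show ?thesis by simp
qed

lemma chr_0: "x \<in> carrier G \<Longrightarrow> chr 0 x = 1"
  using chr_eq[of x 0 0 0] by simp

lemma chr_uminus:
  assumes "x \<in> carrier G" "r \<in> H"
  shows "chr (- r) x = cnj (chr r x)"
proof -
  obtain k m where k: "r * real (D k) = of_int m" using assms(2) by (rule H_cases)
  then have "- r * real (D k) = of_int (- m)" by simp
  then show ?thesis unfolding chr_eq[OF assms(1) k] chr_eq[OF assms(1) \<open>- r * _ = _\<close>]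
    by (simp add: cpow_uminus)
qed

lemma rate_unique:
  assumes "\<And>t. cis (2 * pi * r * t) = cis (2 * pi * s * t)"
  shows "r = s"
proof (rule ccontr)
  assume "r \<noteq> s"
  \<comment> \<open>At this parameter the two exponents differ by exactly pi.\<close>
  define t where "t = 1 / (2 * (r - s))"
  have "2 * pi * r * t = 2 * pi * s * t + pi" using \<open>r \<noteq> s\<close> by (simp add: t_def field_simps)
  then have "cis (2 * pi * r * t) = - cis (2 * pi * s * t)" by (simp flip: cis_mult)
  then show False using assms[of t] by simp
qed

text \<open>On the line \<open>u\<close> is t -> cis (c t), and c must be shown to lie in 2 pi H.
  The points \<open>line (n * D L)\<close> agree with the identity in all coordinates up to
  \<open>L\<close>, so for a suitable \<open>L\<close> every power of \<open>v (D L)\<close> stays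
  within 1 of 1, which forces \<open>v (D L) = 1\<close>. Density of the line does the rest.\<close>

theorem continuous_hom_eq_chr:
  fixes u :: "_ \<Rightarrow> complex"
  assumes cont: "continuous_map T euclidean u"
    and mult: "\<And>x z. x \<in> carrier G \<Longrightarrow> z \<in> carrier G \<Longrightarrow> u (x \<otimes>\<^bsub>G\<^esub> z) = u x * u z"
    and norm: "\<And>x. x \<in> carrier G \<Longrightarrow> norm (u x) = 1"
  obtains r where "r \<in> H" "\<And>x. x \<in> carrier G \<Longrightarrow> u x = chr r x"
proof -
  define v where "v t = u (line t)" for t
  have vm: "v (s + t) = v s * v t" for s t by (simp add: v_def line_add mult)
  have vn: "norm (v t) = 1" for t by (simp add: v_def norm)
  have "continuous_map euclideanreal euclidean (u \<circ> line)"
    by (rule continuous_map_compose[OF continuous_line cont])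
  then have "continuous_on UNIV v" by (simp add: v_def o_def)
  then obtain c where c: "\<And>t. v t = cis (c * t)" using circle_hom_eq_cis[OF _ vm vn] by blast
  define U where "U = {x \<in> topspace T. u x \<in> ball 1 1}"
  have "openin T U" unfolding U_def by (rule openin_continuous_map_preimage[OF cont]) simp
  moreover have "line 0 \<in> U" using c[of 0] by (simp add: U_def v_def)
  ultimately obtain L where L: "\<And>z. z \<in> carrier G \<Longrightarrow> (\<And>k. k \<le> L \<Longrightarrow> y k z = y k (line 0)) \<Longrightarrow> z \<in> U"
    using open_nhd by blast
  have "norm (v (real (D L)) ^ n - 1) < 1" for n
  proof -
    have "line (real n * real (D L)) \<in> U"
    proof (rule L)
      fix k assume k: "k \<le> L"
      have "real n * real (D L) / real (D k) = of_int (int (n * (D L div D k)))"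
        using D_dvd[OF k] by (simp add: real_of_nat_div)
      then show "y k (line (real n * real (D L))) = y k (line 0)"
        unfolding y_line by (simp only: cis_2pi_eq_1 Ints_of_int) simp
    qed simp
    then have "norm (v (real n * real (D L)) - 1) < 1"
      by (simp add: U_def v_def dist_norm norm_minus_commute)
    moreover have "v (real n * real (D L)) = v (real (D L)) ^ n"
      unfolding c Complex.DeMoivre by (simp add: mult.left_commute)
    ultimately show ?thesis by simp
  qed
  then have "v (real (D L)) = 1" by (rule no_small_subgroups[OF vn])
  then obtain m :: int where m: "c * real (D L) = 2 * pi * of_int m" unfolding c cis_eq_1_iff by blast
  define r where "r = c / (2 * pi)"
  have "r * real (D L) = of_int m" using m by (simp add: r_def)
  then have r: "r \<in> H" by (rule H_I)
  show ?thesis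
  proof (rule that[OF r])
    fix x assume x: "x \<in> carrier G"
    have "u (line t) = chr r (line t)" for t
      unfolding chr_line[OF r] using c[of t] by (simp add: v_def r_def)
    then show "u x = chr r x"
      by (rule eq_on_lines_imp_eq[OF cont chr_continuous[OF r] _ x])
  qed
qed

end

section \<open>Distributions on the solenoid\<close>

lemma int_subgroup_generator:
  fixes A :: "int set"
  assumes zero: "0 \<in> A" and add: "\<And>m n. m \<in> A \<Longrightarrow> n \<in> A \<Longrightarrow> m + n \<in> A"
    and uminus: "\<And>m. m \<in> A \<Longrightarrow> - m \<in> A"
  shows "\<exists>d::nat. \<forall>m. m \<in> A \<longleftrightarrow> int d dvd m"
proof (cases "A = {0}")
  case True
  then show ?thesis by (intro exI[of _ 0]) auto
next
  case False
  have nat_mult: "int j * m \<in> A" if "m \<in> A" for j m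
    using that by (induction j) (auto simp: zero add distrib_right)
  have mult: "j * m \<in> A" if "m \<in> A" for j m
  proof (cases "j \<ge> 0")
    case True
    then show ?thesis using nat_mult[OF that, of "nat j"] by simp
  next
    case False
    then show ?thesis using uminus[OF nat_mult[OF that, of "nat (- j)"]] by simp
  qed
  obtain m0 where m0: "m0 \<in> A" "m0 \<noteq> 0" using False zero by auto
  have "\<exists>d::nat. 0 < d \<and> int d \<in> A"
  proof (cases "m0 > 0")
    case True
    then show ?thesis using m0 by (intro exI[of _ "nat m0"]) simp
  next
    case False
    then show ?thesis using m0 uminus[OF m0(1)] by (intro exI[of _ "nat (- m0)"]) simp
  qed
  note ex = this
  define d where "d = (LEAST d::nat. 0 < d \<and> int d \<in> A)"
  have d: "0 < d" "int d \<in> A" using LeastI_ex[OF ex] unfolding d_def by blast+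
  have least: "d \<le> e" if "0 < e" "int e \<in> A" for e :: nat
    unfolding d_def using that by (intro Least_le conjI)
  have "int d dvd m" if "m \<in> A" for m
  proof (rule ccontr)
    assume "\<not> int d dvd m"
    define e where "e = m mod int d"
    have "e \<noteq> 0" using \<open>\<not> int d dvd m\<close> unfolding e_def dvd_eq_mod_eq_0 .
    moreover have "0 \<le> e" "e < int d" unfolding e_def using d(1) by (simp_all only: pos_mod_sign pos_mod_bound of_nat_0_less_iff)
    ultimately have e: "0 < e" "e < int d" by linarith+
    have "m + (- (m div int d)) * int d = e"
      using div_mult_mod_eq[of m "int d"] unfolding e_def[symmetric] by linarith
    then have "e \<in> A" using add[OF that mult[OF d(2), of "- (m div int d)"]] by (simp only:)
    then have "d \<le> nat e" using e(1) by (intro least) simp_all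
    then show False using e by linarith
  qed
  moreover have "m \<in> A" if "int d dvd m" for m
  proof -
    obtain j where "m = int d * j" using \<open>int d dvd m\<close> by (rule dvdE)
    then show ?thesis using mult[OF d(2), of j] by (simp only: mult.commute)
  qed
  ultimately show ?thesis by blast
qed

context adic
begin

lemma distribution_space: "distribution_on T \<mu> \<Longrightarrow> space \<mu> = carrier G"
  unfolding distribution_on_def using sets_eq_imp_space_eq[of \<mu> "borel_algebra T"] by simp

lemma distribution_measurable:
  "distribution_on T \<mu> \<Longrightarrow> measurable \<mu> N = measurable (borel_algebra T) N"
  unfolding distribution_on_def by (intro measurable_cong_sets) simp_all

text \<open>The measures are transported by \<Phi> to the metric space of complex sequences, with
  \<open>C\<close> the continuous functions that restrict to some character on the image. Nothing is
  lost, as every Borel set of the solenoid is a preimage under \<Phi>.\<close>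

theorem distribution_eqI:
  assumes \<mu>: "distribution_on T \<mu>" and \<nu>: "distribution_on T \<nu>"
    and eq: "\<And>r. r \<in> H \<Longrightarrow> (\<integral>x. chr r x \<partial>\<mu>) = (\<integral>x. chr r x \<partial>\<nu>)"
  shows "\<mu> = \<nu>"
proof -
  let ?S = "\<Phi> ` carrier G"
  define C where "C = {h. continuous_on UNIV h \<and> (\<exists>r\<in>H. \<forall>x\<in>carrier G. h (\<Phi> x) = chr r x)}"
  have repr: "\<exists>h\<in>C. \<forall>x\<in>carrier G. h (\<Phi> x) = chr r x" if r: "r \<in> H" for r
  proof -
    obtain k m where k: "r * real (D k) = of_int m" using r by (rule H_cases)
    have "continuous_on UNIV (\<lambda>z::nat \<Rightarrow> complex. cpow m (z k))"
      by (rule continuous_on_compose2[OF continuous_cpow[of UNIV] continuous_on_product_coordinates]) simp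
    moreover have "\<forall>x\<in>carrier G. cpow m (\<Phi> x k) = chr r x" by (simp add: chr_eq[OF _ k])
    ultimately show ?thesis using r unfolding C_def
      by (intro bexI[of _ "\<lambda>z. cpow m (z k)"]) blast+
  qed
  have \<Phi>m: "\<Phi> \<in> measurable N borel" if "distribution_on T N" for N
    unfolding distribution_measurable[OF that] by (rule measurable_\<Phi>)
  have prob: "prob_space (distr N borel \<Phi>)" "AE z in distr N borel \<Phi>. z \<in> ?S"
    if N: "distribution_on T N" for N
  proof -
    interpret N: prob_space N using N by (simp add: distribution_on_def)
    show "prob_space (distr N borel \<Phi>)" by (rule N.prob_space_distr[OF \<Phi>m[OF N]])
    have "closed ?S" using compact_\<Phi> by (rule compact_imp_closed)
    then have "{z \<in> space borel. z \<in> ?S} \<in> sets borel" by (simp add: borel_closed)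
    then show "AE z in distr N borel \<Phi>. z \<in> ?S"
      by (subst AE_distr_iff[OF \<Phi>m[OF N]]) (auto simp: distribution_space[OF N])
  qed
  have integral: "(\<integral>z. h z \<partial>distr N borel \<Phi>) = (\<integral>x. chr r x \<partial>N)"
    if N: "distribution_on T N" and h: "h \<in> C" "\<forall>x\<in>carrier G. h (\<Phi> x) = chr r x" for N h r
  proof -
    have "h \<in> borel_measurable borel" using h(1) unfolding C_def by (auto intro: borel_measurable_continuous_onI)
    then have "(\<integral>z. h z \<partial>distr N borel \<Phi>) = (\<integral>x. h (\<Phi> x) \<partial>N)"
      by (rule integral_distr[OF \<Phi>m[OF N]])
    also have "\<dots> = (\<integral>x. chr r x \<partial>N)"
      by (rule Bochner_Integration.integral_cong) (use h(2) in \<open>simp_all add: distribution_space[OF N]\<close>)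
    finally show ?thesis .
  qed
  have same: "distr \<mu> borel \<Phi> = distr \<nu> borel \<Phi>"
  proof (rule measure_eqI_characters[where S = ?S and C = C])
    show "(\<lambda>_. 1) \<in> C" unfolding C_def using H_0 chr_0 by auto
    show "\<exists>l\<in>C. \<forall>z\<in>?S. l z = h z * k z" if hk: "h \<in> C" "k \<in> C" for h k
    proof -
      obtain r s where r: "r \<in> H" "\<forall>x\<in>carrier G. h (\<Phi> x) = chr r x" and s: "s \<in> H" "\<forall>x\<in>carrier G. k (\<Phi> x) = chr s x"
        using hk unfolding C_def by blast
      obtain l where "l \<in> C" "\<forall>x\<in>carrier G. l (\<Phi> x) = chr (r + s) x" using repr[OF H_plus[OF r(1) s(1)]] by blast
      then show ?thesis using r s by (intro bexI[of _ l]) (auto simp: chr_add)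
    qed
    show "\<exists>l\<in>C. \<forall>z\<in>?S. l z = cnj (h z)" if hk: "h \<in> C" for h
    proof -
      obtain r where r: "r \<in> H" "\<forall>x\<in>carrier G. h (\<Phi> x) = chr r x" using hk unfolding C_def by blast
      obtain l where l: "l \<in> C" "\<forall>x\<in>carrier G. l (\<Phi> x) = chr (- r) x" using repr[OF H_minus[OF r(1)]] by blast
      show ?thesis using r l by (intro bexI[of _ l]) (auto simp: chr_uminus)
    qed
    show "\<exists>h\<in>C. h z \<noteq> h w" if zw: "z \<in> ?S" "w \<in> ?S" "z \<noteq> w" for z w
    proof -
      obtain k where k: "z k \<noteq> w k" using zw(3) by blast
      have "(\<lambda>z. z k) \<in> C" unfolding C_def using inverse_D_H y_eq_chr
        by (auto intro!: continuous_on_product_coordinates bexI[of _ "1 / real (D k)"])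
      from bexI[OF _ this, of "\<lambda>h. h z \<noteq> h w"] k show ?thesis by simp
    qed
    show "continuous_on UNIV h" if "h \<in> C" for h using that by (simp add: C_def)
    show "(\<integral>z. h z \<partial>distr \<mu> borel \<Phi>) = (\<integral>z. h z \<partial>distr \<nu> borel \<Phi>)" if h: "h \<in> C" for h
    proof -
      obtain r where r: "r \<in> H" "\<forall>x\<in>carrier G. h (\<Phi> x) = chr r x" using h unfolding C_def by blast
      show ?thesis unfolding integral[OF \<mu> h r(2)] integral[OF \<nu> h r(2)] by (rule eq[OF r(1)])
    qed
  qed (use prob[OF \<mu>] prob[OF \<nu>] compact_\<Phi> in auto)
  show "\<mu> = \<nu>"
  proof (rule measure_eqI)
    show "sets \<mu> = sets \<nu>" using \<mu> \<nu> by (simp add: distribution_on_def)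
    fix U assume "U \<in> sets \<mu>"
    then obtain A where A: "A \<in> sets borel" "U = \<Phi> -` A \<inter> carrier G"
      using \<mu> by (auto simp: distribution_on_def sets_borel)
    have "emeasure N U = emeasure (distr N borel \<Phi>) A" if N: "distribution_on T N" for N
      using emeasure_distr[OF \<Phi>m[OF N] A(1)] by (simp add: A(2) distribution_space[OF N])
    then show "emeasure \<mu> U = emeasure \<nu> U" using \<mu> \<nu> same by metis
  qed
qed

lemma D_div_chain:
  assumes "k \<le> i" "i \<le> l"
  shows "(D l div D i) * (D i div D k) = D l div D k"
  using D_dvd[OF assms(1)] D_dvd[OF assms(2)] by (metis div_mult_swap dvd_div_mult_self)

text \<open>The coordinates \<open>y l\<close> are made uniform on the roots of unity that the characters in \<open>N\<close> allow,
  and the consistent finite-dimensional distributions extend by the projective limit theorem.\<close>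

theorem subgroup_indicator_distribution:
  assumes N: "N \<subseteq> H" "0 \<in> N" "\<And>r s. r \<in> N \<Longrightarrow> s \<in> N \<Longrightarrow> r + s \<in> N" "\<And>r. r \<in> N \<Longrightarrow> - r \<in> N"
  obtains m where "distribution_on T m"
    "\<And>r. r \<in> H \<Longrightarrow> (\<integral>x. chr r x \<partial>m) = (if r \<in> N then 1 else 0)"
proof -
  \<comment> \<open>The characters of frequency m / D l depend on coordinate \<open>l\<close> alone.
    If \<open>d l\<close> generates the integers m for which this frequency is in \<open>N\<close>,
    that coordinate has to be uniform on the roots of unity of order \<open>d l\<close>, or on the
    circle when \<open>d l = 0\<close>.\<close>
  have "\<exists>d::nat. \<forall>m::int. of_int m / real (D l) \<in> N \<longleftrightarrow> int d dvd m" for l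
  proof -
    have "of_int (m + n) / real (D l) \<in> N"
      if "of_int m / real (D l) \<in> N" "of_int n / real (D l) \<in> N" for m n :: int
      using N(3)[OF that] by (simp add: add_divide_distrib)
    moreover have "of_int (- m) / real (D l) \<in> N" if "of_int m / real (D l) \<in> N" for m :: int
      using N(4)[OF that] by simp
    moreover have "of_int 0 / real (D l) \<in> N" using N(2) by simp
    ultimately have "\<exists>d::nat. \<forall>m. m \<in> {m. of_int m / real (D l) \<in> N} \<longleftrightarrow> int d dvd m"
      by (intro int_subgroup_generator) (simp_all only: mem_Collect_eq)
    then show ?thesis by (simp only: mem_Collect_eq)
  qed
  then have "\<forall>l. \<exists>d::nat. \<forall>m::int. of_int m / real (D l) \<in> N \<longleftrightarrow> int d dvd m" ..
  from choice[OF this] obtain d :: "nat \<Rightarrow> nat"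
    where d: "\<forall>l. \<forall>m::int. of_int m / real (D l) \<in> N \<longleftrightarrow> int (d l) dvd m" ..
  have "\<exists>P :: complex measure. prob_space P \<and> sets P = sets borel \<and> (AE z in P. norm z = 1) \<and>
      (\<forall>m. (\<integral>z. cpow m z \<partial>P) = (if of_int m / real (D l) \<in> N then 1 else 0))" for l
  proof (rule uniform_root_measure[of "d l"])
    fix P :: "complex measure"
    assume "prob_space P" "sets P = sets borel" "AE z in P. norm z = 1"
      "\<And>m. (\<integral>z. cpow m z \<partial>P) = (if int (d l) dvd m then 1 else 0)"
    then show ?thesis by (intro exI[of _ P]) (simp add: d)
  qed
  then have "\<forall>l. \<exists>P :: complex measure. prob_space P \<and> sets P = sets borel \<and> (AE z in P. norm z = 1) \<and>
      (\<forall>m. (\<integral>z. cpow m z \<partial>P) = (if of_int m / real (D l) \<in> N then 1 else 0))" ..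
  from choice[OF this] obtain U :: "nat \<Rightarrow> complex measure"
    where U0: "\<forall>l. prob_space (U l) \<and> sets (U l) = sets borel \<and> (AE z in U l. norm z = 1) \<and>
      (\<forall>m. (\<integral>z. cpow m z \<partial>U l) = (if of_int m / real (D l) \<in> N then 1 else 0))" ..
  have U: "prob_space (U l)" "sets (U l) = sets borel" "AE z in U l. norm z = 1"
    "(\<integral>z. cpow m z \<partial>U l) = (if of_int m / real (D l) \<in> N then 1 else 0)" for l m
    using spec[OF U0, of l] by simp_all
  have Um: "measurable (U l) M = measurable borel M" for l and M :: "'c measure"
    using U(2) by (rule measurable_cong_sets) simp
  have cm [measurable]: "cpow m \<in> borel_measurable borel" for m
    by (intro borel_measurable_continuous_onI continuous_cpow)
  have pm [measurable]: "(\<lambda>z::complex. z ^ b) \<in> borel_measurable borel" for b :: nat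
    by (intro borel_measurable_continuous_onI continuous_intros)
  \<comment> \<open>Consistency of the marginals: a power of z only rewrites the frequency m / D k
    over the denominator \<open>D l\<close>.\<close>
  have push: "distr (U l) borel (\<lambda>z. z ^ (D l div D k)) = U k" if "k \<le> l" for k l
  proof (rule measure_eqI_circle)
    interpret prob_space "U l" by (rule U)
    show "prob_space (distr (U l) borel (\<lambda>z. z ^ (D l div D k)))"
      by (rule prob_space_distr) (simp add: Um)
    show "AE z in distr (U l) borel (\<lambda>z. z ^ (D l div D k)). norm z = 1"
    proof (subst AE_distr_iff)
      show "AE z in U l. norm (z ^ (D l div D k)) = 1" using U(3) by eventually_elim (simp add: norm_power)
    qed (simp_all add: Um)
    fix m
    have "(\<integral>z. cpow m z \<partial>distr (U l) borel (\<lambda>z. z ^ (D l div D k))) = (\<integral>z. cpow m (z ^ (D l div D k)) \<partial>U l)"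
      by (rule integral_distr) (simp_all add: Um)
    also have "\<dots> = (\<integral>z. cpow (int (D l div D k) * m) z \<partial>U l)"
    proof (rule integral_cong_AE)
      show "AE z in U l. cpow m (z ^ (D l div D k)) = cpow (int (D l div D k) * m) z"
        using U(3) by eventually_elim (rule cpow_power)
    qed (simp_all add: Um)
    also have "\<dots> = (\<integral>z. cpow m z \<partial>U k)"
    proof -
      have "of_int m / real (D k) * real (D k) = of_int m" using D_pos[of k] by simp
      from scale_up[OF this that]
      have "of_int (int (D l div D k) * m) / real (D l) = of_int m / real (D k)"
        by (metis D_real_nonzero nonzero_eq_divide_eq)
      then show ?thesis unfolding U(4) by simp
    qed
    finally show "(\<integral>z. cpow m z \<partial>distr (U l) borel (\<lambda>z. z ^ (D l div D k))) = (\<integral>z. cpow m z \<partial>U k)" .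
  qed (simp_all only: sets_distr U(1-3))
  define pr where "pr l J z = (\<lambda>k\<in>J. z ^ (D l div D k))" for l J and z :: complex
  have prm [measurable]: "pr l J \<in> measurable borel (PiM J (\<lambda>_. borel))" for l J
    unfolding pr_def by (rule measurable_restrict) simp
  \<comment> \<open>For finite \<open>J\<close> the coordinate at the largest index determines all
    others. Inserting 0 provides a value for the empty set.\<close>
  define top where "top J = Max (insert 0 J)" for J :: "nat set"
  define P where "P J = distr (U (top J)) (PiM J (\<lambda>_. borel)) (pr (top J) J)" for J
  have P_eq: "P J = distr (U l) (PiM J (\<lambda>_. borel)) (pr l J)" if "finite J" "\<And>j. j \<in> J \<Longrightarrow> j \<le> l" for J l
  proof -
    have tl: "top J \<le> l" and jt: "\<And>j. j \<in> J \<Longrightarrow> j \<le> top J" using that by (auto simp: top_def)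
    have "P J = distr (distr (U l) borel (\<lambda>z. z ^ (D l div D (top J)))) (PiM J (\<lambda>_. borel)) (pr (top J) J)"
      unfolding P_def push[OF tl] ..
    also have "\<dots> = distr (U l) (PiM J (\<lambda>_. borel)) (pr (top J) J \<circ> (\<lambda>z. z ^ (D l div D (top J))))"
      by (rule distr_distr) (simp_all add: Um)
    also have "pr (top J) J \<circ> (\<lambda>z. z ^ (D l div D (top J))) = pr l J"
    proof
      fix z :: complex
      have "(z ^ (D l div D (top J))) ^ (D (top J) div D k) = z ^ (D l div D k)" if "k \<in> J" for k
        unfolding power_mult[symmetric] D_div_chain[OF jt[OF that] tl] ..
      then show "(pr (top J) J \<circ> (\<lambda>z. z ^ (D l div D (top J)))) z = pr l J z"
        unfolding pr_def o_apply by (intro restrict_ext)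
    qed
    finally show ?thesis .
  qed
  interpret Pr: polish_projective UNIV P
  proof (rule polish_projective.intro, rule projective_family.intro)
    fix J K :: "nat set" assume JK: "J \<subseteq> K" "finite K"
    then have fJ: "finite J" and le: "\<And>j. j \<in> K \<Longrightarrow> j \<le> top K" by (auto intro: finite_subset simp: top_def)
    have "distr (P K) (PiM J (\<lambda>_. borel)) (\<lambda>f. restrict f J)
        = distr (U (top K)) (PiM J (\<lambda>_. borel)) ((\<lambda>f. restrict f J) \<circ> pr (top K) K)"
      unfolding P_def by (rule distr_distr) (simp_all add: Um measurable_restrict_subset[OF JK(1)])
    also have "(\<lambda>f. restrict f J) \<circ> pr (top K) K = pr (top K) J"
      using JK(1) by (auto simp: pr_def fun_eq_iff)
    also have "distr (U (top K)) (PiM J (\<lambda>_. borel)) (pr (top K) J) = P J"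
      by (rule P_eq[OF fJ, symmetric]) (use JK le in blast)
    finally show "P J = distr (P K) (PiM J (\<lambda>_. borel)) (\<lambda>f. restrict f J)" ..
  next
    fix J :: "nat set"
    interpret prob_space "U (top J)" by (rule U)
    show "prob_space (P J)" unfolding P_def by (rule prob_space_distr) (simp add: Um)
  qed
  let ?L = "Pr.lim"
  have sets_L: "sets ?L = sets (borel :: (nat \<Rightarrow> complex) measure)"
    by (simp add: sets_PiM_equal_borel)
  have Lm: "measurable ?L M = measurable (borel :: (nat \<Rightarrow> complex) measure) M" for M :: "'c measure"
    using sets_L by (rule measurable_cong_sets) simp
  have rm: "(\<lambda>z. restrict z J) \<in> measurable ?L (PiM J (\<lambda>_. borel))" for J
    unfolding measurable_cong_sets[OF Pr.sets_lim refl] by (rule measurable_restrict_subset) simp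
  have lim_restrict: "distr ?L (PiM J (\<lambda>_. borel)) (\<lambda>z. restrict z J) = P J" if J: "finite J" for J
  proof (rule measure_eqI)
    show "sets (distr ?L (PiM J (\<lambda>_. borel)) (\<lambda>z. restrict z J)) = sets (P J)" using J Pr.sets_P by simp
    fix Z assume "Z \<in> sets (distr ?L (PiM J (\<lambda>_. borel)) (\<lambda>z. restrict z J))"
    then have Z: "Z \<in> sets (PiM J (\<lambda>_. borel))" by simp
    have "emeasure (distr ?L (PiM J (\<lambda>_. borel)) (\<lambda>z. restrict z J)) Z
        = emeasure ?L (prod_emb UNIV (\<lambda>_. borel) J Z)"
      using emeasure_distr[OF rm Z] by (simp add: prod_emb_def space_PiM)
    also have "\<dots> = emeasure (P J) Z" using Z J by (intro Pr.emeasure_lim_emb) auto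
    finally show "emeasure (distr ?L (PiM J (\<lambda>_. borel)) (\<lambda>z. restrict z J)) Z = emeasure (P J) Z" .
  qed
  have chain: "AE z in ?L. norm (z k) = 1 \<and> z (Suc k) ^ a k = z k" for k
  proof -
    let ?J = "{k, Suc k}"
    let ?M = "PiM ?J (\<lambda>_. borel :: complex measure)"
    let ?Q = "\<lambda>z. norm (z k) = 1 \<and> z (Suc k) ^ a k = z k"
    have [measurable]: "(\<lambda>z. z k) \<in> borel_measurable ?M" "(\<lambda>z. z (Suc k)) \<in> borel_measurable ?M"
      by (intro measurable_component_singleton; simp)+
    \<comment> \<open>Both conditions are packed into one inequality between measurable real
      functions.\<close>
    have "{z \<in> space ?M. \<bar>norm (z k) - 1\<bar> + norm (z (Suc k) ^ a k - z k) \<le> 0} \<in> sets ?M" by measurable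
    moreover have "{z \<in> space ?M. \<bar>norm (z k) - 1\<bar> + norm (z (Suc k) ^ a k - z k) \<le> 0} = {z \<in> space ?M. ?Q z}"
      by (auto simp: add_nonneg_eq_0_iff order_antisym_conv)
    ultimately have Q: "{z \<in> space ?M. ?Q z} \<in> sets ?M" by simp
    have pU: "pr (Suc k) ?J \<in> measurable (U (Suc k)) ?M" unfolding Um by (rule prm)
    have "AE w in U (Suc k). ?Q (pr (Suc k) ?J w)"
      using U(3)[of "Suc k"]
    proof eventually_elim
      case (elim w)
      have "D (Suc k) div D k = a k" "D (Suc k) div D (Suc k) = 1" using D_pos[of k] D_pos[of "Suc k"] by (simp_all add: D_Suc)
      then show ?case using elim by (simp add: pr_def norm_power)
    qed
    then have "AE z in distr (U (Suc k)) ?M (pr (Suc k) ?J). ?Q z" unfolding AE_distr_iff[OF pU Q] .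
    moreover have "P ?J = distr (U (Suc k)) ?M (pr (Suc k) ?J)" by (rule P_eq) auto
    moreover have "distr ?L ?M (\<lambda>z. restrict z ?J) = P ?J" by (rule lim_restrict) simp
    ultimately have "AE z in distr ?L ?M (\<lambda>z. restrict z ?J). ?Q z" by (simp only:)
    from AE_distrD[OF rm this] show ?thesis by simp
  qed
  have supp: "AE z in ?L. z \<in> \<Phi> ` carrier G"
    unfolding \<Phi>_image mem_Collect_eq AE_all_countable using chain by blast
  \<comment> \<open>Inverts \<Phi> on its image, which has full measure; the value elsewhere
    concerns a null set only and keeps \<open>g\<close> inside the group.\<close>
  define g where "g z = (if z \<in> \<Phi> ` carrier G then the_inv_into (carrier G) \<Phi> z else \<one>\<^bsub>G\<^esub>)" for z
  have g\<Phi>: "g z \<in> carrier G" "\<Phi> (g z) = z" if "z \<in> \<Phi> ` carrier G" for z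
    unfolding g_def using that the_inv_into_into[OF inj_\<Phi> that subset_refl] f_the_inv_into_f[OF inj_\<Phi> that] by auto
  have gc: "g z \<in> carrier G" for z
    using g\<Phi>(1)[of z] by (cases "z \<in> \<Phi> ` carrier G") (auto simp: g_def)
  have gm: "g \<in> measurable ?L (borel_algebra T)"
    unfolding measurable_T_iff
  proof (intro conjI allI)
    show "g \<in> space ?L \<rightarrow> carrier G" using gc by auto
    fix k
    have "closed (\<Phi> ` carrier G)" using compact_\<Phi> by (rule compact_imp_closed)
    then have S: "\<Phi> ` carrier G \<in> sets borel" by (rule borel_closed)
    have "y k (g z) = (if z \<in> \<Phi> ` carrier G then z k else 1)" for z
      using g\<Phi>(2)[of z] y_one[of k] by (metis \<Phi>_apply g_def)
    then show "(\<lambda>z. y k (g z)) \<in> borel_measurable ?L"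
      unfolding Lm using S by (simp add: measurable_If_set)
  qed
  define m where "m = distr ?L (borel_algebra T) g"
  show ?thesis
  proof (rule that[of m])
    show "distribution_on T m"
      unfolding distribution_on_def m_def using Pr.P.prob_space_distr[OF gm] by simp
    fix r assume r: "r \<in> H"
    then obtain l M where l: "r * real (D l) = of_int M" by (rule H_cases)
    have "(\<integral>x. chr r x \<partial>m) = (\<integral>z. chr r (g z) \<partial>?L)"
      unfolding m_def by (rule integral_distr[OF gm chr_measurable[OF r]])
    also have "\<dots> = (\<integral>z. cpow M (z l) \<partial>?L)"
    proof (rule integral_cong_AE)
      show "(\<lambda>z. chr r (g z)) \<in> borel_measurable ?L"
        by (rule measurable_compose[OF gm chr_measurable[OF r]])
      show "(\<lambda>z. cpow M (z l)) \<in> borel_measurable ?L" unfolding Lm by measurable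
      show "AE z in ?L. chr r (g z) = cpow M (z l)"
        using supp
      proof eventually_elim
        case (elim z)
        have "y l (g z) = z l" using g\<Phi>(2)[OF elim] by (metis \<Phi>_apply)
        then show ?case unfolding chr_eq[OF gc l] by simp
      qed
    qed
    also have "\<dots> = (\<integral>z. cpow M (z l) \<partial>distr ?L (PiM {l} (\<lambda>_. borel)) (\<lambda>z. restrict z {l}))"
      by (subst integral_distr[OF rm]) simp_all
    also have "\<dots> = (\<integral>z. cpow M (z l) \<partial>distr (U l) (PiM {l} (\<lambda>_. borel)) (pr l {l}))"
    proof -
      have "P {l} = distr (U l) (PiM {l} (\<lambda>_. borel)) (pr l {l})" by (rule P_eq) auto
      moreover have "distr ?L (PiM {l} (\<lambda>_. borel)) (\<lambda>z. restrict z {l}) = P {l}" by (rule lim_restrict) simp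
      ultimately show ?thesis by (simp only:)
    qed
    also have "\<dots> = (\<integral>w. cpow M w \<partial>U l)"
      using D_pos[of l] by (subst integral_distr) (simp_all add: Um pr_def)
    also have "\<dots> = (if r \<in> N then 1 else 0)"
    proof -
      have "of_int M / real (D l) = r" unfolding l[symmetric] using D_pos[of l] by simp
      then show ?thesis unfolding U(4) by simp
    qed
    finally show "(\<integral>x. chr r x \<partial>m) = (if r \<in> N then 1 else 0)" .
  qed
qed


section \<open>The dual group, Gaussian distributions and convolutions\<close>

abbreviation "CG \<equiv> character_group G T"

abbreviation "CT \<equiv> character_topology G T"

definition res :: "real \<Rightarrow> (real \<times> (nat \<Rightarrow> nat)) set \<Rightarrow> complex" where
  "res r = restrict (chr r) (carrier G)"

lemma chr_inj:
  assumes "r \<in> H" "s \<in> H" "\<And>x. x \<in> carrier G \<Longrightarrow> chr r x = chr s x"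
  shows "r = s"
  by (rule rate_unique) (use assms(3)[OF line_carrier] in \<open>simp add: chr_line assms(1,2)\<close>)

lemma res_inj: "r \<in> H \<Longrightarrow> s \<in> H \<Longrightarrow> res r = res s \<Longrightarrow> r = s"
  by (rule chr_inj) (auto simp: res_def dest: fun_cong split: if_splits simp: restrict_def)

lemma res_carrier:
  assumes r: "r \<in> H"
  shows "res r \<in> carrier CG"
proof -
  have "res r \<in> hom G circle_group"
    by (rule homI) (simp_all add: res_def circle_group_def norm_chr r chr_mult)
  moreover have "continuous_map T euclidean (res r)"
    by (rule continuous_map_eq[OF chr_continuous[OF r]]) (simp add: res_def)
  ultimately show ?thesis by (simp add: character_group_def res_def)
qed

lemma CG_cases:
  assumes u: "u \<in> carrier CG"
  obtains r where "r \<in> H" "u = res r"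
proof -
  have hom: "u \<in> hom G circle_group" and cont: "continuous_map T euclidean u" and ext: "u \<in> extensional (carrier G)"
    using u by (simp_all add: character_group_def)
  have norm: "norm (u x) = 1" if "x \<in> carrier G" for x
    using hom_in_carrier[OF hom that] by (simp add: circle_group_def)
  have mult: "u (x \<otimes>\<^bsub>G\<^esub> z) = u x * u z" if "x \<in> carrier G" "z \<in> carrier G" for x z
    using hom_mult[OF hom that] by (simp add: circle_group_def)
  obtain r where r: "r \<in> H" "\<And>x. x \<in> carrier G \<Longrightarrow> u x = chr r x"
    using continuous_hom_eq_chr[OF cont mult norm] by blast
  have "u = res r" by (rule extensionalityI[OF ext]) (simp_all add: res_def r(2))
  then show ?thesis using r(1) that by blast
qed

lemma res_mult: "r \<in> H \<Longrightarrow> s \<in> H \<Longrightarrow> res r \<otimes>\<^bsub>CG\<^esub> res s = res (r + s)"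
  by (auto simp: character_group_def res_def chr_add intro!: restrict_ext)

lemma res_one: "\<one>\<^bsub>CG\<^esub> = res 0"
  by (auto simp: character_group_def res_def chr_0 intro!: restrict_ext)

lemma res_inv:
  assumes s: "s \<in> H"
  shows "inv\<^bsub>CG\<^esub> (res s) = res (- s)"
  unfolding m_inv_def
proof (rule the_equality)
  show "res (- s) \<in> carrier CG \<and> res s \<otimes>\<^bsub>CG\<^esub> res (- s) = \<one>\<^bsub>CG\<^esub> \<and> res (- s) \<otimes>\<^bsub>CG\<^esub> res s = \<one>\<^bsub>CG\<^esub>"
    by (simp add: res_carrier res_mult res_one H_minus s)
  fix u assume u: "u \<in> carrier CG \<and> res s \<otimes>\<^bsub>CG\<^esub> u = \<one>\<^bsub>CG\<^esub> \<and> u \<otimes>\<^bsub>CG\<^esub> res s = \<one>\<^bsub>CG\<^esub>"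
  then obtain t where t: "t \<in> H" "u = res t" using CG_cases by blast
  have "res (s + t) = res 0" using u t s by (simp add: res_mult res_one)
  then have "s + t = 0" by (rule res_inj[rotated 2]) (use s t H_0 H_plus in auto)
  then have "t = - s" by linarith
  then show "u = res (- s)" using t(2) by simp
qed

definition rate :: "((real \<times> (nat \<Rightarrow> nat)) set \<Rightarrow> complex) \<Rightarrow> real" where
  "rate u = (THE r. r \<in> H \<and> u = res r)"

lemma rate_res: "r \<in> H \<Longrightarrow> rate (res r) = r"
  unfolding rate_def by (rule the_equality) (auto dest: res_inj)

lemma closedin_preimage:
  assumes "r \<in> H" "closed Z"
  shows "closedin T {x \<in> carrier G. chr r x \<in> Z}"
  using closedin_continuous_map_preimage[OF chr_continuous[OF assms(1)], of Z] assms(2) by simp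

text \<open>The character group is discrete: two distinct characters are at distance 2 somewhere on the
  line \<open>\<real> \<rightarrow> G\<close>, so finitely many compact-open conditions single out one character.\<close>

lemma CT_singleton:
  assumes r: "r \<in> H"
  shows "openin CT {res r}"
proof -
  have "compact (sphere 0 1 :: complex set)" by simp
  then have "\<exists>Z. finite Z \<and> sphere (0::complex) 1 \<subseteq> (\<Union>z\<in>Z. ball z (1 / 4))"
    unfolding compact_eq_totally_bounded by simp
  then obtain Z where Z: "finite Z" "sphere (0::complex) 1 \<subseteq> (\<Union>z\<in>Z. ball z (1 / 4))" by blast
  \<comment> \<open>\<open>Z\<close> is a finite 1/4-net of the circle. A character lying in every
    \<open>O' z\<close> stays within 1/4 + 1/2 < 1 of \<open>chr r\<close>, while distinct
    characters reach distance 2.\<close>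
  define K where "K z = {x \<in> carrier G. chr r x \<in> cball z (1 / 4)}" for z
  define O' where "O' z = {u \<in> carrier CG. u ` K z \<subseteq> ball z (1 / 2)}" for z
  have "compactin T (K z)" for z
    unfolding K_def by (rule closedin_compact_space[OF compact_T closedin_preimage[OF r]]) simp
  then have "openin CT (O' z)" for z
    unfolding character_topology_def O'_def by (intro topology_generated_by_Basis) blast
  moreover have "Z \<noteq> {}" using Z(2) by auto
  ultimately have "openin CT (\<Inter>z\<in>Z. O' z)" using Z(1) by (intro openin_INT2) auto
  moreover have "(\<Inter>z\<in>Z. O' z) = {res r}"
  proof (intro equalityI subsetI)
    fix u assume u: "u \<in> (\<Inter>z\<in>Z. O' z)"
    then have "u \<in> carrier CG" using \<open>Z \<noteq> {}\<close> by (auto simp: O'_def)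
    then obtain s where s: "s \<in> H" "u = res s" by (rule CG_cases)
    have near: "norm (chr s x - chr r x) < 1" if x: "x \<in> carrier G" for x
    proof -
      have "chr r x \<in> sphere 0 1" using norm_chr[OF x r] by simp
      then obtain z where z: "z \<in> Z" "dist z (chr r x) < 1 / 4" using Z(2) by (force simp: mem_ball)
      then have "x \<in> K z" using x by (simp add: K_def)
      then have "res s x \<in> res s ` K z" by (rule imageI)
      then have "res s x \<in> ball z (1 / 2)" using u z(1) s(2) unfolding O'_def by blast
      then have "dist z (chr s x) < 1 / 2" using x by (simp add: res_def)
      then have "dist (chr s x) (chr r x) < 1"
        using z(2) dist_triangle[of "chr s x" "chr r x" z] dist_commute[of z "chr s x"] by linarith
      then show ?thesis by (simp add: dist_norm)
    qed
    have "s = r"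
    proof (rule ccontr)
      assume "s \<noteq> r"
      define t where "t = 1 / (2 * (s - r))"
      have "2 * pi * s * t = 2 * pi * r * t + pi" using \<open>s \<noteq> r\<close> by (simp add: t_def field_simps)
      then have "chr s (line t) = - chr r (line t)"
        unfolding chr_line[OF r] chr_line[OF s(1)] by (simp flip: cis_mult)
      then have "norm (chr s (line t) - chr r (line t)) = norm (2 * chr r (line t))"
        using norm_minus_cancel[of "2 * chr r (line t)"] by simp
      then show False using near[OF line_carrier, of t] norm_chr[OF line_carrier r, of t] by (simp add: norm_mult)
    qed
    then show "u \<in> {res r}" using s by simp
  next
    fix u assume "u \<in> {res r}"
    then show "u \<in> (\<Inter>z\<in>Z. O' z)"
      using res_carrier[OF r] by (auto simp: O'_def K_def res_def)
  qed
  ultimately show ?thesis by simp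
qed

text \<open>Every singleton of the dual is open, so the continuity demanded of the exponent of a
  Gaussian distribution is automatic.\<close>

lemma continuous_on_CG: "continuous_map CT euclideanreal \<phi>"
proof -
  have top: "topspace CT \<subseteq> carrier CG"
    unfolding character_topology_def topology_generated_by_topspace by blast
  show ?thesis unfolding continuous_map_def
  proof (intro conjI allI impI)
    fix U :: "real set"
    have "{u \<in> topspace CT. \<phi> u \<in> U} = \<Union> {{u} | u. u \<in> topspace CT \<and> \<phi> u \<in> U}" by blast
    also have "openin CT \<dots>"
    proof (rule openin_Union)
      fix S assume "S \<in> {{u} | u. u \<in> topspace CT \<and> \<phi> u \<in> U}"
      then obtain u where "S = {u}" "u \<in> carrier CG" using top by blast
      moreover from this obtain r where "r \<in> H" "u = res r" using CG_cases by blast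
      ultimately show "openin CT S" using CT_singleton by simp
    qed
    finally show "openin CT {u \<in> topspace CT. \<phi> u \<in> U}" .
  qed simp
qed

text \<open>The image of the standard normal law under a scaled line translated by
  \<open>x0\<close>: composing a character with the line gives an ordinary exponential, whose mean
  is the normal characteristic function.\<close>

theorem gaussian_exists:
  assumes x0: "x0 \<in> carrier G" and c: "0 \<le> c"
  obtains \<gamma> where "gaussian_distribution G T \<gamma>"
    "\<And>r. r \<in> H \<Longrightarrow> (\<integral>x. chr r x \<partial>\<gamma>) = chr r x0 * of_real (exp (- c * r\<^sup>2))"
proof -
  \<comment> \<open>Frequency \<open>r\<close> sees the normal variable with factor 2 pi r s, so (2
    pi r s)^2 / 2 = c r^2 determines \<open>s\<close>.\<close>
  define s where "s = sqrt (2 * c) / (2 * pi)"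
  let ?N = "std_normal_distribution"
  interpret N: prob_space ?N by (rule prob_space_normal_density) simp
  define g where "g t = x0 \<otimes>\<^bsub>G\<^esub> line (s * t)" for t
  have gm: "g \<in> measurable ?N (borel_algebra T)"
    unfolding measurable_T_iff
  proof (intro conjI allI)
    show "g \<in> space ?N \<rightarrow> carrier G" using x0 by (simp add: g_def)
    fix k
    have "y k (g t) = y k x0 * cis (2 * pi * (s * t / real (D k)))" for t
      by (simp add: g_def y_mult x0 y_line)
    moreover have "(\<lambda>t. y k x0 * cis (2 * pi * (s * t / real (D k)))) \<in> borel_measurable borel"
      by (intro borel_measurable_continuous_onI continuous_intros) (simp add: less_imp_neq[OF D_pos, symmetric])
    ultimately show "(\<lambda>t. y k (g t)) \<in> borel_measurable ?N" by simp
  qed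
  define \<gamma> where "\<gamma> = distr ?N (borel_algebra T) g"
  have dist: "distribution_on T \<gamma>"
    unfolding distribution_on_def \<gamma>_def using N.prob_space_distr[OF gm] by simp
  have int: "(\<integral>x. chr r x \<partial>\<gamma>) = chr r x0 * of_real (exp (- c * r\<^sup>2))" if r: "r \<in> H" for r
  proof -
    have "(\<integral>x. chr r x \<partial>\<gamma>) = (\<integral>t. chr r (g t) \<partial>?N)"
      unfolding \<gamma>_def by (rule integral_distr[OF gm chr_measurable[OF r]])
    also have "\<dots> = (\<integral>t. chr r x0 * exp (\<i> * of_real ((2 * pi * r * s) * t)) \<partial>?N)"
      by (simp add: g_def chr_mult[OF x0 line_carrier r] chr_line[OF r] cis_conv_exp mult.assoc)
    also have "\<dots> = chr r x0 * char ?N (2 * pi * r * s)" by (simp add: char_def)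
    also have "char ?N (2 * pi * r * s) = of_real (exp (- ((2 * pi * r * s)\<^sup>2) / 2))"
      by (simp only: char_std_normal_distribution)
    also have "- ((2 * pi * r * s)\<^sup>2) / 2 = - c * r\<^sup>2"
      using c by (simp add: s_def power_mult_distrib power_divide)
    finally show ?thesis .
  qed
  show ?thesis
  proof (rule that[OF _ int])
    show "gaussian_distribution G T \<gamma>"
      unfolding gaussian_distribution_def
    proof (intro conjI bexI[of _ x0] exI[of _ "\<lambda>u. c * (rate u)\<^sup>2"] ballI)
      fix u v assume uv: "u \<in> carrier CG" "v \<in> carrier CG"
      obtain r where r: "r \<in> H" "u = res r" using uv(1) by (rule CG_cases)
      obtain t where t: "t \<in> H" "v = res t" using uv(2) by (rule CG_cases)
      have "c * (r + t)\<^sup>2 + c * (r - t)\<^sup>2 = 2 * (c * r\<^sup>2 + c * t\<^sup>2)"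
        by (simp add: power2_eq_square algebra_simps)
      then show "c * (rate (u \<otimes>\<^bsub>CG\<^esub> v))\<^sup>2 + c * (rate (u \<otimes>\<^bsub>CG\<^esub> inv\<^bsub>CG\<^esub> v))\<^sup>2 = 2 * (c * (rate u)\<^sup>2 + c * (rate v)\<^sup>2)"
        using H_plus[OF r(1) t(1)] H_plus[OF r(1) H_minus[OF t(1)]]
        by (simp add: r t res_inv res_mult H_minus rate_res)
    next
      fix u assume "u \<in> carrier CG"
      then obtain r where r: "r \<in> H" "u = res r" by (rule CG_cases)
      have "char_function \<gamma> u = (\<integral>x. chr r x \<partial>\<gamma>)"
        unfolding char_function_def r(2)
        by (rule Bochner_Integration.integral_cong) (simp_all add: distribution_space[OF dist] res_def)
      then show "char_function \<gamma> u = u x0 * of_real (exp (- (c * (rate u)\<^sup>2)))"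
      proof -
        have "rate u = r" using r rate_res by simp
        moreover have "u x0 = chr r x0" using x0 by (simp add: r(2) res_def)
        moreover assume "char_function \<gamma> u = (\<integral>x. chr r x \<partial>\<gamma>)"
        ultimately show ?thesis unfolding int[OF r(1)] by simp
      qed
    qed (use dist x0 c continuous_on_CG in auto)
  qed
qed

lemma mult_measurable:
  assumes "distribution_on T \<mu>" "distribution_on T \<nu>"
  shows "(\<lambda>(x, z). x \<otimes>\<^bsub>G\<^esub> z) \<in> measurable (\<mu> \<Otimes>\<^sub>M \<nu>) (borel_algebra T)"
  unfolding measurable_T_iff
proof (intro conjI allI)
  show "(\<lambda>(x, z). x \<otimes>\<^bsub>G\<^esub> z) \<in> space (\<mu> \<Otimes>\<^sub>M \<nu>) \<rightarrow> carrier G"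
    by (auto simp: space_pair_measure distribution_space assms)
  fix k
  have ym: "y k \<in> borel_measurable \<mu>" "y k \<in> borel_measurable \<nu>"
    unfolding distribution_measurable[OF assms(1)] distribution_measurable[OF assms(2)]
    by (intro continuous_imp_measurable continuous_y)+
  have meas: "(\<lambda>w. y k (fst w) * y k (snd w)) \<in> borel_measurable (\<mu> \<Otimes>\<^sub>M \<nu>)"
    using ym by measurable
  have eq: "y k ((\<lambda>(x, z). x \<otimes>\<^bsub>G\<^esub> z) w) = y k (fst w) * y k (snd w)" if "w \<in> space (\<mu> \<Otimes>\<^sub>M \<nu>)" for w
    using that by (auto simp: space_pair_measure distribution_space assms y_mult)
  show "(\<lambda>w. y k ((\<lambda>(x, z). x \<otimes>\<^bsub>G\<^esub> z) w)) \<in> borel_measurable (\<mu> \<Otimes>\<^sub>M \<nu>)"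
    by (rule measurable_cong[THEN iffD2, OF eq meas])
qed

lemma chr_integrable:
  assumes \<mu>: "distribution_on T \<mu>" and r: "r \<in> H"
  shows "integrable \<mu> (chr r)"
proof -
  interpret prob_space \<mu> using \<mu> by (simp add: distribution_on_def)
  show ?thesis
  proof (rule integrable_const_bound[where B = 1])
    show "AE x in \<mu>. norm (chr r x) \<le> 1"
      by (rule AE_I2) (simp add: distribution_space[OF \<mu>] norm_chr r)
    show "chr r \<in> borel_measurable \<mu>"
      unfolding distribution_measurable[OF \<mu>] by (rule chr_measurable[OF r])
  qed
qed

lemma convolution_distribution:
  assumes \<mu>: "distribution_on T \<mu>" and \<nu>: "distribution_on T \<nu>"
  shows "distribution_on T (group_convolution G T \<mu> \<nu>)"
    "r \<in> H \<Longrightarrow> (\<integral>x. chr r x \<partial>group_convolution G T \<mu> \<nu>) = (\<integral>x. chr r x \<partial>\<mu>) * (\<integral>x. chr r x \<partial>\<nu>)"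
proof -
  interpret M: prob_space \<mu> using \<mu> by (simp add: distribution_on_def)
  interpret N: prob_space \<nu> using \<nu> by (simp add: distribution_on_def)
  interpret MN: pair_prob_space \<mu> \<nu> ..
  show "distribution_on T (group_convolution G T \<mu> \<nu>)"
    unfolding distribution_on_def group_convolution_def
    using MN.prob_space_distr[OF mult_measurable[OF \<mu> \<nu>]] by simp
  assume r: "r \<in> H"
  have rm: "chr r \<in> borel_measurable \<mu>" "chr r \<in> borel_measurable \<nu>"
    unfolding distribution_measurable[OF \<mu>] distribution_measurable[OF \<nu>] by (rule chr_measurable[OF r])+
  have "(\<integral>x. chr r x \<partial>group_convolution G T \<mu> \<nu>) = (\<integral>w. chr r ((\<lambda>(x, z). x \<otimes>\<^bsub>G\<^esub> z) w) \<partial>(\<mu> \<Otimes>\<^sub>M \<nu>))"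
    unfolding group_convolution_def by (rule integral_distr[OF mult_measurable[OF \<mu> \<nu>] chr_measurable[OF r]])
  also have "\<dots> = (\<integral>w. chr r (fst w) * chr r (snd w) \<partial>(\<mu> \<Otimes>\<^sub>M \<nu>))"
    by (rule Bochner_Integration.integral_cong)
       (auto simp: space_pair_measure distribution_space \<mu> \<nu> chr_mult r)
  also have "\<dots> = (\<integral>x. (\<integral>z. chr r x * chr r z \<partial>\<nu>) \<partial>\<mu>)"
  proof -
    have "integrable (\<mu> \<Otimes>\<^sub>M \<nu>) (\<lambda>w. chr r (fst w) * chr r (snd w))"
    proof (rule MN.integrable_const_bound[where B = 1])
      show "AE w in \<mu> \<Otimes>\<^sub>M \<nu>. norm (chr r (fst w) * chr r (snd w)) \<le> 1"
        by (rule AE_I2) (auto simp: space_pair_measure distribution_space \<mu> \<nu> norm_chr r norm_mult)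
      show "(\<lambda>w. chr r (fst w) * chr r (snd w)) \<in> borel_measurable (\<mu> \<Otimes>\<^sub>M \<nu>)" using rm by measurable
    qed
    from MN.integral_fst'[OF this] show ?thesis by simp
  qed
  also have "\<dots> = (\<integral>x. chr r x \<partial>\<mu>) * (\<integral>x. chr r x \<partial>\<nu>)" by simp
  finally show "(\<integral>x. chr r x \<partial>group_convolution G T \<mu> \<nu>) = (\<integral>x. chr r x \<partial>\<mu>) * (\<integral>x. chr r x \<partial>\<nu>)" .
qed

section \<open>Annihilators and their Haar distributions\<close>

definition ann :: "real set \<Rightarrow> (real \<times> (nat \<Rightarrow> nat)) set set" where
  "ann N = {x \<in> carrier G. \<forall>r\<in>N. chr r x = 1}"

lemma ann_subgroup: "N \<subseteq> H \<Longrightarrow> subgroup (ann N) G"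
proof (rule G.subgroupI)
  assume N: "N \<subseteq> H"
  show "ann N \<subseteq> carrier G" by (auto simp: ann_def)
  have "\<one>\<^bsub>G\<^esub> \<in> ann N" using N chr_one by (auto simp: ann_def)
  then show "ann N \<noteq> {}" by blast
  show "x \<otimes>\<^bsub>G\<^esub> z \<in> ann N" if "x \<in> ann N" "z \<in> ann N" for x z
    using that N by (auto simp: ann_def chr_mult)
  show "inv\<^bsub>G\<^esub> x \<in> ann N" if x: "x \<in> ann N" for x
  proof -
    have xG: "x \<in> carrier G" using x by (simp add: ann_def)
    have "chr r (inv\<^bsub>G\<^esub> x) = 1" if r: "r \<in> N" for r
    proof -
      have rH: "r \<in> H" using r N by blast
      have "chr r (inv\<^bsub>G\<^esub> x) * chr r x = 1"
        using chr_mult[OF G.inv_closed[OF xG] xG rH] G.l_inv[OF xG] chr_one[OF rH] by simp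
      then show ?thesis using x r by (simp add: ann_def)
    qed
    then show ?thesis using xG by (simp add: ann_def)
  qed
qed

lemma ann_closedin: "N \<subseteq> H \<Longrightarrow> closedin T (ann N)"
proof -
  assume N: "N \<subseteq> H"
  have "ann N = (\<Inter>r\<in>insert 0 N. {x \<in> carrier G. chr r x \<in> {1}})"
    by (auto simp: ann_def chr_0)
  moreover have "closedin T (\<Inter>r\<in>insert 0 N. {x \<in> carrier G. chr r x \<in> {1}})"
  proof (rule closedin_INT)
    fix r assume "r \<in> insert 0 N"
    then have "r \<in> H" using N H_0 by auto
    then show "closedin T {x \<in> carrier G. chr r x \<in> {1}}" by (rule closedin_preimage) simp
  qed simp
  ultimately show ?thesis by simp
qed

lemma ann_compact_subgroup: "N \<subseteq> H \<Longrightarrow> compact_subgroup G T (ann N)"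
  unfolding compact_subgroup_def
  using ann_subgroup closedin_compact_space[OF compact_T ann_closedin] by blast

text \<open>For \<open>r\<close> in \<open>N\<close> the nonnegative function 1 - Re (chr r) has
  mean 0, so \<open>chr r = 1\<close> almost surely; as \<open>N\<close> is countable,
  \<open>m\<close> is carried by the annihilator. Translation by an element k of it multiplies the
  coefficient at \<open>r\<close> by \<open>chr r k\<close>, which is 1 on \<open>N\<close>, and off
  \<open>N\<close> the coefficient is 0.\<close>

theorem ann_haar:
  assumes N: "N \<subseteq> H" and m: "distribution_on T m"
    and int: "\<And>r. r \<in> H \<Longrightarrow> (\<integral>x. chr r x \<partial>m) = (if r \<in> N then 1 else 0)"
  shows "subgroup_haar_distribution G T (ann N) m"
proof -
  interpret prob_space m using m by (simp add: distribution_on_def)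
  let ?K = "ann N"
  have space: "space m = carrier G" by (rule distribution_space[OF m])
  have sets: "sets m = sets (borel_algebra T)" using m by (simp add: distribution_on_def)
  have AE_r: "AE x in m. chr r x = 1" if r: "r \<in> N" for r
  proof -
    have rH: "r \<in> H" using r N by blast
    note i = chr_integrable[OF m rH]
    have le: "Re (chr r x) \<le> 1" if "x \<in> carrier G" for x
      using complex_Re_le_cmod[of "chr r x"] norm_chr[OF that rH] by simp
    have "(\<integral>x. 1 - Re (chr r x) \<partial>m) = 0"
      using i int[OF rH] r by (simp add: prob_space)
    moreover have "integrable m (\<lambda>x. 1 - Re (chr r x))" using i by simp
    moreover have "AE x in m. 0 \<le> 1 - Re (chr r x)" by (rule AE_I2) (use le space in simp)
    ultimately have "AE x in m. 1 - Re (chr r x) = 0"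
      using integral_nonneg_eq_0_iff_AE by blast
    then show ?thesis
    proof (rule AE_mp, intro AE_I2 impI)
      fix x assume x: "x \<in> space m" "1 - Re (chr r x) = 0"
      then have "norm (chr r x) = 1" using norm_chr rH space by blast
      then show "chr r x = 1" using x(2) by (simp add: cmod_def complex_eq_iff)
    qed
  qed
  have "countable N" using N H_Rats countable_rat by (meson countable_subset)
  then have "AE x in m. \<forall>r\<in>N. chr r x = 1" using AE_r by (simp add: AE_ball_countable)
  then have AE_K: "AE x in m. x \<in> ?K" by (rule AE_mp) (intro AE_I2, simp add: ann_def space)
  have Kc: "?K \<subseteq> carrier G" by (auto simp: ann_def)
  have Ks: "?K \<in> sets m"
  proof -
    have "openin T (topspace T - ?K)" using ann_closedin[OF N] by (simp add: closedin_def)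
    then have "carrier G - ?K \<in> sets (borel_algebra T)"
      unfolding borel_algebra_def using openin_subset[of T] by (subst sets_measure_of) auto
    then have "space m - (carrier G - ?K) \<in> sets m" unfolding sets[symmetric] by (rule sets.compl_sets)
    then show ?thesis using Kc by (simp add: space double_diff)
  qed
  \<comment> \<open>Haar measure is defined on the subgroup with its own Borel sets, so
    \<open>m\<close> is restricted and must then be recovered as the image under the
    inclusion.\<close>
  define m0 where "m0 = restrict_space m ?K"
  have sp0: "space m0 = ?K" using Kc by (auto simp: m0_def space_restrict_space space)
  have se0: "sets m0 = sets (borel_algebra (subtopology T ?K))"
  proof -
    have "sets (borel_algebra T) = sigma_sets (carrier G) {U. openin T U}"
      unfolding borel_algebra_def using openin_subset[of T] by (subst sets_measure_of) auto
    then have "sets m0 = (\<inter>) ?K ` sigma_sets (carrier G) {U. openin T U}"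
      unfolding m0_def sets_restrict_space sets by simp
    also have "\<dots> = sigma_sets ?K ((\<inter>) ?K ` {U. openin T U})"
      by (rule sigma_sets_Int) (use Ks Kc \<open>sets (borel_algebra T) = _\<close> sets in auto)
    also have "(\<inter>) ?K ` {U. openin T U} = {U. openin (subtopology T ?K) U}"
      by (auto simp: openin_subtopology Int_commute)
    also have "sigma_sets ?K {U. openin (subtopology T ?K) U} = sets (borel_algebra (subtopology T ?K))"
      unfolding borel_algebra_def using openin_subset[of "subtopology T ?K"] Kc
      by (subst sets_measure_of) (auto simp: Int_absorb1)
    finally show ?thesis .
  qed
  have p0: "prob_space m0" unfolding m0_def
    by (rule prob_space_restrict_space[OF Ks]) (use AE_K Ks emeasure_eq_1_AE in simp)
  have em0: "emeasure m0 A = emeasure m A" if "A \<subseteq> ?K" for A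
    unfolding m0_def by (rule emeasure_restrict_space) (use that Ks in auto)
  have id: "(\<lambda>x. x) \<in> measurable m0 (borel_algebra T)"
    unfolding m0_def by (rule measurable_restrict_space1) (simp add: sets measurable_ident_sets)
  have m_eq: "m = distr m0 (borel_algebra T) (\<lambda>x. x)"
  proof (rule measure_eqI)
    fix A assume A: "A \<in> sets m"
    have "emeasure (distr m0 (borel_algebra T) (\<lambda>x. x)) A = emeasure m0 (A \<inter> ?K)"
      using emeasure_distr[OF id, of A] A by (simp add: sets sp0)
    also have "\<dots> = emeasure m (A \<inter> ?K)" by (rule em0) simp
    also have "\<dots> = emeasure m A"
      by (rule emeasure_eq_AE) (use AE_K A Ks in auto)
    finally show "emeasure m A = emeasure (distr m0 (borel_algebra T) (\<lambda>x. x)) A" ..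
  qed (simp add: sets)
  have inv: "distr m0 (borel_algebra (subtopology T ?K)) (\<lambda>x. k \<otimes>\<^bsub>G\<^esub> x) = m0" if k: "k \<in> ?K" for k
  proof -
    have kG: "k \<in> carrier G" using k Kc by blast
    have tm: "(\<lambda>x. k \<otimes>\<^bsub>G\<^esub> x) \<in> measurable m (borel_algebra T)"
      unfolding measurable_T_iff
    proof (intro conjI allI)
      show "(\<lambda>x. k \<otimes>\<^bsub>G\<^esub> x) \<in> space m \<rightarrow> carrier G" using kG by (simp add: space)
      fix i
      have "y i \<in> borel_measurable m" unfolding distribution_measurable[OF m] by (intro continuous_imp_measurable continuous_y)
      then have "(\<lambda>x. y i k * y i x) \<in> borel_measurable m" by measurable
      then show "(\<lambda>x. y i (k \<otimes>\<^bsub>G\<^esub> x)) \<in> borel_measurable m"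
        by (subst measurable_cong[of m _ "\<lambda>x. y i k * y i x"]) (simp_all add: space y_mult kG)
    qed
    have "distr m (borel_algebra T) (\<lambda>x. k \<otimes>\<^bsub>G\<^esub> x) = m"
    proof (rule distribution_eqI)
      show "distribution_on T (distr m (borel_algebra T) (\<lambda>x. k \<otimes>\<^bsub>G\<^esub> x))"
        unfolding distribution_on_def using prob_space_distr[OF tm] by simp
      fix r assume r: "r \<in> H"
      have "(\<integral>x. chr r x \<partial>distr m (borel_algebra T) (\<lambda>x. k \<otimes>\<^bsub>G\<^esub> x)) = (\<integral>x. chr r (k \<otimes>\<^bsub>G\<^esub> x) \<partial>m)"
        by (rule integral_distr[OF tm chr_measurable[OF r]])
      also have "\<dots> = (\<integral>x. chr r k * chr r x \<partial>m)"
        by (rule Bochner_Integration.integral_cong) (simp_all add: space chr_mult kG r)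
      also have "\<dots> = chr r k * (\<integral>x. chr r x \<partial>m)" by simp
      also have "\<dots> = (\<integral>x. chr r x \<partial>m)" using k int[OF r] by (auto simp: ann_def)
      finally show "(\<integral>x. chr r x \<partial>distr m (borel_algebra T) (\<lambda>x. k \<otimes>\<^bsub>G\<^esub> x)) = (\<integral>x. chr r x \<partial>m)" .
    qed (rule m)
    note inv_m = this
    have closed: "k \<otimes>\<^bsub>G\<^esub> x \<in> ?K" if "x \<in> ?K" for x
      using subgroup.m_closed[OF ann_subgroup[OF N] k that] .
    have "(\<lambda>x. k \<otimes>\<^bsub>G\<^esub> x) \<in> measurable m0 (restrict_space (borel_algebra T) ?K)"
    proof (rule measurable_restrict_space2)
      show "(\<lambda>x. k \<otimes>\<^bsub>G\<^esub> x) \<in> space m0 \<rightarrow> ?K" using closed by (simp add: sp0)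
      show "(\<lambda>x. k \<otimes>\<^bsub>G\<^esub> x) \<in> measurable m0 (borel_algebra T)" unfolding m0_def by (rule measurable_restrict_space1[OF tm])
    qed
    moreover have "sets (restrict_space (borel_algebra T) ?K) = sets (borel_algebra (subtopology T ?K))"
      unfolding se0[symmetric] m0_def sets_restrict_space sets ..
    ultimately have tm0: "(\<lambda>x. k \<otimes>\<^bsub>G\<^esub> x) \<in> measurable m0 (borel_algebra (subtopology T ?K))"
      using measurable_cong_sets by blast
    show ?thesis
    proof (rule measure_eqI)
      fix A assume "A \<in> sets (distr m0 (borel_algebra (subtopology T ?K)) (\<lambda>x. k \<otimes>\<^bsub>G\<^esub> x))"
      then have A: "A \<in> sets (borel_algebra (subtopology T ?K))" by simp
      then have A0: "A \<in> sets m0" by (simp add: se0)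
      then have AK: "A \<subseteq> ?K" using sets.sets_into_space[OF A0] by (simp add: sp0)
      have Am: "A \<in> sets m"
        using A0 Ks unfolding m0_def sets_restrict_space by (auto intro: sets.Int)
      have "emeasure (distr m0 (borel_algebra (subtopology T ?K)) (\<lambda>x. k \<otimes>\<^bsub>G\<^esub> x)) A
          = emeasure m0 ((\<lambda>x. k \<otimes>\<^bsub>G\<^esub> x) -` A \<inter> ?K)"
        using emeasure_distr[OF tm0 A] by (simp add: sp0)
      also have "\<dots> = emeasure m ((\<lambda>x. k \<otimes>\<^bsub>G\<^esub> x) -` A \<inter> ?K)" by (rule em0) simp
      also have "\<dots> = emeasure m ((\<lambda>x. k \<otimes>\<^bsub>G\<^esub> x) -` A \<inter> space m)"
      proof (rule emeasure_eq_AE)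
        have pre: "(\<lambda>x. k \<otimes>\<^bsub>G\<^esub> x) -` A \<inter> space m \<in> sets m"
          by (rule measurable_sets[OF tm]) (use Am sets in simp)
        have "(\<lambda>x. k \<otimes>\<^bsub>G\<^esub> x) -` A \<inter> ?K = ((\<lambda>x. k \<otimes>\<^bsub>G\<^esub> x) -` A \<inter> space m) \<inter> ?K"
          using Kc space by blast
        then show "(\<lambda>x. k \<otimes>\<^bsub>G\<^esub> x) -` A \<inter> ?K \<in> sets m" using sets.Int[OF pre Ks] by simp
        show "(\<lambda>x. k \<otimes>\<^bsub>G\<^esub> x) -` A \<inter> space m \<in> sets m" by (rule pre)
        show "AE x in m. (x \<in> (\<lambda>x. k \<otimes>\<^bsub>G\<^esub> x) -` A \<inter> ?K) = (x \<in> (\<lambda>x. k \<otimes>\<^bsub>G\<^esub> x) -` A \<inter> space m)"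
          using AE_K by (rule AE_mp) (intro AE_I2, simp)
      qed
      also have "\<dots> = emeasure (distr m (borel_algebra T) (\<lambda>x. k \<otimes>\<^bsub>G\<^esub> x)) A"
        using emeasure_distr[OF tm, of A] Am sets by simp
      also have "\<dots> = emeasure m0 A" unfolding inv_m em0[OF AK] ..
      finally show "emeasure (distr m0 (borel_algebra (subtopology T ?K)) (\<lambda>x. k \<otimes>\<^bsub>G\<^esub> x)) A = emeasure m0 A" .
    qed (simp add: se0)
  qed
  have "haar_distribution (G\<lparr>carrier := ?K\<rparr>) (subtopology T ?K) m0"
    unfolding haar_distribution_def distribution_on_def using p0 se0 inv by simp
  then show ?thesis unfolding subgroup_haar_distribution_def using m_eq by blast
qed

end

section \<open>Automorphisms and divisibility\<close>

lemma only_prime_factor_imp_power: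
  fixes v p :: nat
  assumes "0 < v" "Factorial_Ring.prime p" "\<And>q. Factorial_Ring.prime q \<Longrightarrow> q dvd v \<Longrightarrow> q = p"
  obtains k where "v = p ^ k"
proof -
  have "v \<noteq> 0" "\<not> is_unit p" using assms(1,2) by (auto dest: prime_gt_1_nat)
  then obtain w where w: "v = p ^ multiplicity p v * w" "\<not> p dvd w" by (rule multiplicity_decompose')
  have "w = 1"
  proof (rule ccontr)
    assume "w \<noteq> 1"
    then obtain q where q: "Factorial_Ring.prime q" "q dvd w" using prime_factor_nat by blast
    have "q dvd v" by (subst w(1)) (rule dvd_mult[OF q(2)])
    then have "q = p" by (rule assms(3)[OF q(1)])
    then show False using q w(2) by simp
  qed
  then show ?thesis using w(1) that by simp
qed

text \<open>By Bezout, a prime dividing the numerator or the denominator of an automorphism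
  \<open>h \<mapsto> \<lambda> h\<close> of \<open>H\<close> makes \<open>H\<close> divisible by that prime.\<close>

lemma multiplier_eq_inverse_power:
  fixes H :: "real set" and l :: real and p :: nat
  assumes add: "\<And>u v. u \<in> H \<Longrightarrow> v \<in> H \<Longrightarrow> u + v \<in> H" and uminus: "\<And>u. u \<in> H \<Longrightarrow> - u \<in> H"
    and zero: "0 \<in> H"
    and l: "l \<in> \<rat>" "l \<noteq> 0" "\<bar>l\<bar> < 1"
    and mult: "\<And>h. h \<in> H \<Longrightarrow> l * h \<in> H" and div: "\<And>h. h \<in> H \<Longrightarrow> h / l \<in> H"
    and p: "Factorial_Ring.prime p"
    and ndiv: "\<And>q. Factorial_Ring.prime q \<Longrightarrow> q \<noteq> p \<Longrightarrow> \<exists>h\<in>H. h / real q \<notin> H"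
  obtains m where "1 \<le> m" "l = 1 / real p ^ m \<or> l = - 1 / real p ^ m"
proof -
  have nat_mult: "real j * h \<in> H" if "h \<in> H" for j h
    using that by (induction j) (auto simp: zero add distrib_right)
  have int_mult: "of_int j * h \<in> H" if "h \<in> H" for j h
  proof (cases "j \<ge> 0")
    case True
    then show ?thesis using nat_mult[OF that, of "nat j"] by simp
  next
    case False
    then show ?thesis using uminus[OF nat_mult[OF that, of "nat (- j)"]] by simp
  qed
  obtain u v :: int where uv: "v > 0" "coprime u v" "l = of_int u / of_int v"
    using l(1) by (rule Rats_cases') blast
  obtain c d where "c * u + d * v = gcd u v" using bezout_int by blast
  then have "c * u + d * v = 1" using uv(2) by simp
  then have "real_of_int (c * u + d * v) = 1" by simp
  then have bez: "of_int c * of_int u + of_int d * of_int v = (1::real)" by simp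
  have v0: "of_int v \<noteq> (0::real)" using uv(1) by simp
  have u0: "of_int u \<noteq> (0::real)" using l(2) uv(3) by auto
  have num: "q = p" if q: "Factorial_Ring.prime q" "int q dvd u" for q
  proof (rule ccontr)
    assume "q \<noteq> p"
    then obtain h where h: "h \<in> H" "h / real q \<notin> H" using ndiv[OF q(1)] by blast
    obtain w where w: "u = int q * w" using q(2) by (rule dvdE)
    have q0: "real q \<noteq> 0" using prime_gt_0_nat[OF q(1)] by simp
    have uq: "of_int u = real q * of_int w" by (simp add: w)
    \<comment> \<open>The Bezout relation splits h / q into integer multiples of \<open>h\<close>
      and \<open>h / l\<close>, both in \<open>H\<close>, against the choice of
      \<open>h\<close>.\<close>
    have "h / real q = (of_int c * of_int u + of_int d * of_int v) * (h / real q)" by (simp only: bez mult_1)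
    also have "\<dots> = of_int c * (of_int w * h) + of_int d * (of_int v * h / real q)"
      using q0 unfolding uq by (simp add: field_simps)
    also have "of_int v * h / real q = of_int w * (h / l)"
      using q0 u0 v0 by (simp add: uv(3) uq)
    finally have "h / real q \<in> H" using h(1) by (simp only:) (intro add int_mult div)
    then show False using h(2) by contradiction
  qed
  have den: "q = p" if q: "Factorial_Ring.prime q" "int q dvd v" for q
  proof (rule ccontr)
    assume "q \<noteq> p"
    then obtain h where h: "h \<in> H" "h / real q \<notin> H" using ndiv[OF q(1)] by blast
    obtain w where w: "v = int q * w" using q(2) by (rule dvdE)
    have q0: "real q \<noteq> 0" using prime_gt_0_nat[OF q(1)] by simp
    have vq: "of_int v = real q * of_int w" by (simp add: w)
    \<comment> \<open>The same splitting, now with \<open>l * h\<close> in place of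
      \<open>h / l\<close>.\<close>
    have "h / real q = (of_int c * of_int u + of_int d * of_int v) * (h / real q)" by (simp only: bez mult_1)
    also have "\<dots> = of_int c * (of_int u * h / real q) + of_int d * (of_int w * h)"
      using q0 unfolding vq by (simp add: field_simps)
    also have "of_int u * h / real q = of_int w * (l * h)"
      using q0 v0 by (simp add: uv(3) vq)
    finally have "h / real q \<in> H" using h(1) by (simp only:) (intro add int_mult mult)
    then show False using h(2) by contradiction
  qed
  have "\<bar>real_of_int u\<bar> < real_of_int v"
    using l(3) uv(1) by (simp add: uv(3) abs_div_pos[symmetric])
  then have less: "\<bar>u\<bar> < v" by linarith
  have "u \<noteq> 0" using u0 by simp
  obtain k where k: "nat v = p ^ k"
  proof (rule only_prime_factor_imp_power[OF _ p])
    show "0 < nat v" using uv(1) by simp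
    show "q = p" if "Factorial_Ring.prime q" "q dvd nat v" for q
      using den[OF that(1)] that(2) uv(1) by (metis int_dvd_int_iff int_nat_eq less_imp_le)
  qed
  have vk: "v = int p ^ k" using k uv(1) by (metis int_nat_eq less_imp_le of_nat_power)
  have k1: "1 \<le> k" using less \<open>u \<noteq> 0\<close> vk by (cases k) auto
  \<comment> \<open>A prime factor of \<open>u\<close> would have to be \<open>p\<close>, which
    divides \<open>v\<close> because \<open>k\<close> is at least 1; this contradicts
    coprimality.\<close>
  have "nat \<bar>u\<bar> = 1"
  proof (rule ccontr)
    assume "nat \<bar>u\<bar> \<noteq> 1"
    then obtain q where q: "Factorial_Ring.prime q" "q dvd nat \<bar>u\<bar>" using prime_factor_nat by blast
    have qu: "int q dvd u" using q(2) by (metis dvd_abs_iff int_dvd_int_iff int_nat_eq abs_ge_zero)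
    have "q = p" by (rule num[OF q(1) qu])
    then have "int q dvd v" using vk k1 by (simp add: dvd_power)
    with qu uv(2) have "is_unit (int q)" by (meson coprime_common_divisor)
    then show False using prime_gt_1_nat[OF q(1)] by simp
  qed
  then have "u = 1 \<or> u = - 1" by linarith
  then show ?thesis using that[OF k1] uv(3) vk by auto
qed

section \<open>Endomorphisms as multiplications of the frequencies\<close>

context adic
begin

lemma chr_of_nat:
  assumes "x \<in> carrier G" "r \<in> H"
  shows "chr (real n * r) x = chr r x ^ n" "real n * r \<in> H"
proof -
  have "real n * r \<in> H \<and> chr (real n * r) x = chr r x ^ n"
  proof (induction n)
    case 0
    then show ?case by (simp add: H_0 chr_0 assms)
  next
    case (Suc n)
    have "real (Suc n) * r = r + real n * r" by (simp add: distrib_right)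
    then show ?case using Suc assms by (simp add: H_plus chr_add)
  qed
  then show "chr (real n * r) x = chr r x ^ n" "real n * r \<in> H" by auto
qed

lemma H_nat_mult: "r \<in> H \<Longrightarrow> real n * r \<in> H"
  by (rule chr_of_nat(2)[OF G.one_closed])

lemma chr_pow:
  assumes "x \<in> carrier G" "r \<in> H"
  shows "chr r (x [^]\<^bsub>G\<^esub> (n::nat)) = chr (real n * r) x"
proof -
  have "chr r (x [^]\<^bsub>G\<^esub> n) = chr r x ^ n"
    by (induction n) (simp_all add: chr_one chr_mult assms mult.commute)
  then show ?thesis by (simp only: chr_of_nat(1)[OF assms])
qed

text \<open>Composition with \<open>f\<close> carries characters to characters and so defines an
  additive map of \<open>H\<close>. An additive map on a group of rationals containing 1 is
  multiplication by its value at 1.\<close>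

theorem endomorphism_multiplier:
  assumes cont: "continuous_map T T f"
    and mult: "\<And>x z. x \<in> carrier G \<Longrightarrow> z \<in> carrier G \<Longrightarrow> f (x \<otimes>\<^bsub>G\<^esub> z) = f x \<otimes>\<^bsub>G\<^esub> f z"
  shows "\<exists>l. \<forall>r\<in>H. l * r \<in> H \<and> (\<forall>x\<in>carrier G. chr r (f x) = chr (l * r) x)"
proof -
  have fG: "f x \<in> carrier G" if "x \<in> carrier G" for x
    using continuous_map_image_subset_topspace[OF cont] that by auto
  have "\<exists>s. s \<in> H \<and> (\<forall>x\<in>carrier G. chr r (f x) = chr s x)" if r: "r \<in> H" for r
  proof -
    have "continuous_map T euclidean (chr r \<circ> f)"
      by (rule continuous_map_compose[OF cont chr_continuous[OF r]])
    then obtain s where "s \<in> H" "\<And>x. x \<in> carrier G \<Longrightarrow> (chr r \<circ> f) x = chr s x"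
      by (rule continuous_hom_eq_chr) (simp_all add: mult chr_mult norm_chr fG r)
    then show ?thesis by auto
  qed
  then have "\<forall>r\<in>H. \<exists>s. s \<in> H \<and> (\<forall>x\<in>carrier G. chr r (f x) = chr s x)" by blast
  from bchoice[OF this] obtain h where h: "\<forall>r\<in>H. h r \<in> H \<and> (\<forall>x\<in>carrier G. chr r (f x) = chr (h r) x)" ..
  then have hH: "\<And>r. r \<in> H \<Longrightarrow> h r \<in> H" and hc: "\<And>r x. r \<in> H \<Longrightarrow> x \<in> carrier G \<Longrightarrow> chr r (f x) = chr (h r) x"
    by blast+
  have h_add: "h (r + s) = h r + h s" if "r \<in> H" "s \<in> H" for r s
  proof (rule chr_inj)
    show "chr (h (r + s)) x = chr (h r + h s) x" if x: "x \<in> carrier G" for x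
      using hc[OF H_plus[OF \<open>r \<in> H\<close> \<open>s \<in> H\<close>] x] hc[OF \<open>r \<in> H\<close> x] hc[OF \<open>s \<in> H\<close> x]
        chr_add[OF fG[OF x] \<open>r \<in> H\<close> \<open>s \<in> H\<close>] chr_add[OF x hH hH, OF \<open>r \<in> H\<close> \<open>s \<in> H\<close>] by simp
  qed (use that in \<open>auto intro: hH H_plus\<close>)
  have h0: "h 0 = 0" using h_add[OF H_0 H_0] by simp
  have h_minus: "h (- r) = - h r" if "r \<in> H" for r
    using h_add[OF that H_minus[OF that]] h0 by simp
  have h_nat: "h (real n * r) = real n * h r" if r: "r \<in> H" for n r
  proof (induction n)
    case 0
    then show ?case by (simp add: h0)
  next
    case (Suc n)
    have e: "real (Suc n) * r = real n * r + r" by (simp add: distrib_right)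
    show ?case unfolding e h_add[OF H_nat_mult[OF r] r] Suc by (simp add: distrib_right)
  qed
  have h_int: "h (of_int m) = of_int m * h 1" for m
  proof (cases "m \<ge> 0")
    case True
    then show ?thesis using h_nat[OF H_1, of "nat m"] by simp
  next
    case False
    have "h (- (real (nat (- m)) * 1)) = - (real (nat (- m)) * h 1)"
      using h_minus[OF H_nat_mult[OF H_1]] h_nat[OF H_1] by simp
    then show ?thesis using False by simp
  qed
  have lin: "h r = h 1 * r" if r: "r \<in> H" for r
  proof -
    obtain k m where k: "r * real (D k) = of_int m" using r by (rule H_cases)
    have "real (D k) * h r = of_int m * h 1"
      using h_nat[OF r, of "D k"] h_int[of m] k by (simp add: mult.commute)
    also have "\<dots> = real (D k) * (h 1 * r)" unfolding k[symmetric] by simp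
    finally show ?thesis using D_real_nonzero[of k] by (metis mult_left_cancel)
  qed
  show ?thesis
  proof (intro exI[of _ "h 1"] ballI conjI)
    show "h 1 * r \<in> H" if "r \<in> H" for r using hH[OF that] lin[OF that] by simp
    show "chr r (f x) = chr (h 1 * r) x" if "r \<in> H" "x \<in> carrier G" for r x
      using hc[OF that] lin[OF that(1)] by simp
  qed
qed

text \<open>The inverse map is again a continuous endomorphism, with some multiplier k; composing
  the two gives k l = 1, so dividing by \<open>l\<close> means multiplying by k.\<close>

theorem automorphism_multiplier:
  assumes "topological_automorphism G T \<alpha>"
  shows "\<exists>l. l \<noteq> 0 \<and> (\<forall>r\<in>H. l * r \<in> H \<and> r / l \<in> H \<and> (\<forall>x\<in>carrier G. chr r (\<alpha> x) = chr (l * r) x))"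
proof -
  have iso: "\<alpha> \<in> iso G G" and "homeomorphic_map T T \<alpha>"
    using assms by (auto simp: topological_automorphism_def)
  then obtain g where g: "homeomorphic_maps T T \<alpha> g" by (auto simp: homeomorphic_map_maps)
  have ca: "continuous_map T T \<alpha>" and cg: "continuous_map T T g"
    and ga: "\<And>x. x \<in> carrier G \<Longrightarrow> g (\<alpha> x) = x" and ag: "\<And>x. x \<in> carrier G \<Longrightarrow> \<alpha> (g x) = x"
    using g by (auto simp: homeomorphic_maps_def)
  have am: "\<alpha> (x \<otimes>\<^bsub>G\<^esub> z) = \<alpha> x \<otimes>\<^bsub>G\<^esub> \<alpha> z" if "x \<in> carrier G" "z \<in> carrier G" for x z
    using iso that by (auto simp: iso_def hom_mult)
  have gG: "g x \<in> carrier G" if "x \<in> carrier G" for x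
    using continuous_map_image_subset_topspace[OF cg] that by auto
  have gm: "g (x \<otimes>\<^bsub>G\<^esub> z) = g x \<otimes>\<^bsub>G\<^esub> g z" if "x \<in> carrier G" "z \<in> carrier G" for x z
    using ga[OF G.m_closed[OF gG gG]] am[OF gG gG] ag that by metis
  from endomorphism_multiplier[OF ca am] obtain l
    where "\<forall>r\<in>H. l * r \<in> H \<and> (\<forall>x\<in>carrier G. chr r (\<alpha> x) = chr (l * r) x)" by auto
  then have l: "\<And>r. r \<in> H \<Longrightarrow> l * r \<in> H"
    "\<And>r x. r \<in> H \<Longrightarrow> x \<in> carrier G \<Longrightarrow> chr r (\<alpha> x) = chr (l * r) x" by auto
  from endomorphism_multiplier[OF cg gm] obtain k
    where "\<forall>r\<in>H. k * r \<in> H \<and> (\<forall>x\<in>carrier G. chr r (g x) = chr (k * r) x)" by auto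
  then have k: "\<And>r. r \<in> H \<Longrightarrow> k * r \<in> H"
    "\<And>r x. r \<in> H \<Longrightarrow> x \<in> carrier G \<Longrightarrow> chr r (g x) = chr (k * r) x" by auto
  have "1 = k * (l * 1)"
  proof (rule chr_inj[OF H_1 k(1)[OF l(1)[OF H_1]]])
    fix x assume x: "x \<in> carrier G"
    have "chr 1 x = chr 1 (\<alpha> (g x))" by (simp add: ag x)
    also have "\<dots> = chr (l * 1) (g x)" by (rule l(2)[OF H_1 gG[OF x]])
    also have "\<dots> = chr (k * (l * 1)) x" by (rule k(2)[OF l(1)[OF H_1] x])
    finally show "chr 1 x = chr (k * (l * 1)) x" .
  qed
  then have kl: "k * l = 1" by simp
  then have l0: "l \<noteq> 0" by auto
  then have "r / l = k * r" for r using kl by (simp add: divide_eq_eq mult.assoc mult.left_commute[of k r l])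
  then show ?thesis using l0 l k(1) by (intro exI[of _ l]) simp
qed

lemma Hausdorff_T: "Hausdorff_space T"
  by (rule Hausdorff_space_injective_preimage[OF _ continuous_\<Phi>]) (simp_all add: inj_\<Phi> Hausdorff_space_euclidean)

lemma pow_continuous: "continuous_map T T (\<lambda>x. x [^]\<^bsub>G\<^esub> (n::nat))"
  unfolding continuous_map_T_iff
proof (intro conjI allI)
  fix k
  have "continuous_map T euclidean (\<lambda>x. chr (real n * (1 / real (D k))) x)"
    using chr_continuous[OF H_nat_mult[OF inverse_D_H]] .
  then show "continuous_map T euclidean (\<lambda>x. y k (x [^]\<^bsub>G\<^esub> n))"
    by (rule continuous_map_eq) (simp only: topspace_T y_eq_chr[OF G.nat_pow_closed] chr_pow inverse_D_H)
qed simp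

text \<open>The image is compact, hence closed, and it contains the dense line, because
  \<open>line t\<close> is n times \<open>line (t / n)\<close>.\<close>

lemma pow_surj:
  assumes "0 < n"
  shows "(\<lambda>x. x [^]\<^bsub>G\<^esub> (n::nat)) ` carrier G = carrier G"
proof (rule ccontr)
  let ?f = "\<lambda>x. x [^]\<^bsub>G\<^esub> n"
  assume neq: "?f ` carrier G \<noteq> carrier G"
  have "compactin T (?f ` carrier G)"
    using image_compactin[OF _ pow_continuous, of "carrier G"] compact_T by (simp add: compact_space_def)
  then have "closedin T (?f ` carrier G)" by (rule compactin_imp_closedin[OF Hausdorff_T])
  then have o: "openin T (carrier G - ?f ` carrier G)" by (simp add: closedin_def)
  obtain x where x: "x \<in> carrier G - ?f ` carrier G" using neq by auto
  obtain t where t: "line t \<in> carrier G - ?f ` carrier G" using open_contains_line[OF o x] .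
  have "line t = ?f (line (t / real n))"
  proof (rule chr_eqI[OF line_carrier G.nat_pow_closed[OF line_carrier]])
    fix r assume r: "r \<in> H"
    have e: "2 * pi * (real n * r) * (t / real n) = 2 * pi * r * t" using assms by simp
    show "chr r (line t) = chr r (?f (line (t / real n)))"
      unfolding chr_pow[OF line_carrier r] chr_line[OF r] chr_line[OF H_nat_mult[OF r]] e ..
  qed
  then show False using t line_carrier by blast
qed

text \<open>Surjectivity always holds, and a continuous bijection of a compact Hausdorff space is a
  homeomorphism.\<close>

lemma pow_automorphism:
  assumes "0 < n" and inj: "\<And>x. x \<in> carrier G \<Longrightarrow> x [^]\<^bsub>G\<^esub> n = \<one>\<^bsub>G\<^esub> \<Longrightarrow> x = \<one>\<^bsub>G\<^esub>"
  shows "topological_automorphism G T (\<lambda>x. x [^]\<^bsub>G\<^esub> (n::nat))"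
proof -
  let ?f = "\<lambda>x. x [^]\<^bsub>G\<^esub> n"
  have inj_f: "inj_on ?f (carrier G)"
  proof (rule inj_onI)
    fix x z assume xz: "x \<in> carrier G" "z \<in> carrier G" "?f x = ?f z"
    have "?f (x \<otimes>\<^bsub>G\<^esub> inv\<^bsub>G\<^esub> z) = ?f x \<otimes>\<^bsub>G\<^esub> inv\<^bsub>G\<^esub> ?f z"
      using xz by (simp add: G.nat_pow_distrib G.nat_pow_inv)
    also have "\<dots> = \<one>\<^bsub>G\<^esub>" using xz by simp
    finally have "x \<otimes>\<^bsub>G\<^esub> inv\<^bsub>G\<^esub> z = \<one>\<^bsub>G\<^esub>" by (rule inj[rotated]) (use xz in simp)
    then show "x = z" using xz by (metis G.inv_closed G.inv_equality G.inv_inv)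
  qed
  have "?f \<in> iso G G"
    using inj_f pow_surj[OF assms(1)]
    by (auto simp: iso_def bij_betw_def intro!: homI G.nat_pow_distrib)
  moreover have "homeomorphic_map T T ?f"
    by (rule continuous_imp_homeomorphic_map[OF pow_continuous compact_T Hausdorff_T])
       (simp_all add: pow_surj[OF assms(1)] inj_f)
  ultimately show ?thesis by (simp add: topological_automorphism_def)
qed

text \<open>Without elements of order \<open>p\<close>, multiplication by \<open>p\<close> is
  injective and thus an automorphism. Its multiplier is \<open>p\<close>, and \<open>H\<close> is
  closed under division by the multiplier of an automorphism.\<close>

lemma H_divide_prime:
  assumes p: "Factorial_Ring.prime p" and no: "\<not> (\<exists>x\<in>carrier G. group.ord G x = p)" and r: "r \<in> H"
  shows "r / real p \<in> H"
proof -
  have p0: "0 < p" using p by (rule prime_gt_0_nat)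
  have "x = \<one>\<^bsub>G\<^esub>" if x: "x \<in> carrier G" "x [^]\<^bsub>G\<^esub> p = \<one>\<^bsub>G\<^esub>" for x
  proof -
    have "G.ord x dvd p" using x by (simp add: G.pow_eq_id)
    then have "G.ord x = 1 \<or> G.ord x = p" using p by (auto simp: prime_nat_iff)
    then show ?thesis using no x G.ord_eq_1 by blast
  qed
  from automorphism_multiplier[OF pow_automorphism[OF p0 this]]
  obtain l where "\<forall>r\<in>H. l * r \<in> H \<and> r / l \<in> H \<and> (\<forall>x\<in>carrier G. chr r (x [^]\<^bsub>G\<^esub> p) = chr (l * r) x)" by auto
  then have l: "\<And>r. r \<in> H \<Longrightarrow> l * r \<in> H" "\<And>r. r \<in> H \<Longrightarrow> r / l \<in> H"
    "\<And>r x. r \<in> H \<Longrightarrow> x \<in> carrier G \<Longrightarrow> chr r (x [^]\<^bsub>G\<^esub> p) = chr (l * r) x" by auto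
  have "l * 1 = real p * 1"
    by (rule chr_inj[OF l(1)[OF H_1] H_nat_mult[OF H_1]]) (simp only: l(3)[OF H_1, symmetric] chr_pow H_1)
  then show ?thesis using l(2)[OF r] by simp
qed

text \<open>If \<open>H\<close> were divisible by \<open>n\<close>, then chr r x = chr (r / n) (n x)
  = 1 for every \<open>r\<close>, and an \<open>x\<close> of order \<open>n\<close> would be
  trivial.\<close>

lemma H_not_divisible:
  assumes n: "Factorial_Ring.prime n" and x: "x \<in> carrier G" "group.ord G x = n"
  shows "\<exists>h\<in>H. h / real n \<notin> H"
proof (rule ccontr)
  assume "\<not> (\<exists>h\<in>H. h / real n \<notin> H)"
  then have div: "h / real n \<in> H" if "h \<in> H" for h using that by blast
  have n0: "real n \<noteq> 0" using prime_gt_0_nat[OF n] by simp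
  have "x [^]\<^bsub>G\<^esub> n = \<one>\<^bsub>G\<^esub>" using G.pow_ord_eq_1[OF x(1)] x(2) by simp
  have "x = \<one>\<^bsub>G\<^esub>"
  proof (rule chr_eqI[OF x(1) G.one_closed])
    fix r assume r: "r \<in> H"
    have "chr (r / real n) (x [^]\<^bsub>G\<^esub> n) = chr (real n * (r / real n)) x"
      by (rule chr_pow[OF x(1) div[OF r]])
    then show "chr r x = chr r \<one>\<^bsub>G\<^esub>"
      using n0 \<open>x [^]\<^bsub>G\<^esub> n = \<one>\<^bsub>G\<^esub>\<close> by (simp add: chr_one r div)
  qed
  then have "n = 1" using x G.ord_eq_1[OF G.one_closed] by simp
  then show False using prime_gt_1_nat[OF n] by simp
qed

text \<open>A preimage z of an annihilator element x exists in the whole group, and it lies in the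
  annihilator by itself: chr r z = chr (r / p) x = 1, since \<open>r / p\<close> is in
  \<open>N\<close>.\<close>

lemma ann_pow_image:
  assumes N: "N \<subseteq> H" and p: "0 < p" and div: "\<And>r. r \<in> N \<Longrightarrow> r / real p \<in> N"
    and mult: "\<And>r. r \<in> N \<Longrightarrow> real p * r \<in> N"
  shows "(\<lambda>x. x [^]\<^bsub>G\<^esub> (p::nat)) ` ann N = ann N"
proof
  show "(\<lambda>x. x [^]\<^bsub>G\<^esub> p) ` ann N \<subseteq> ann N"
  proof (rule image_subsetI)
    fix x assume x: "x \<in> ann N"
    then show "x [^]\<^bsub>G\<^esub> p \<in> ann N"
      using mult N by (auto simp: ann_def chr_pow)
  qed
  show "ann N \<subseteq> (\<lambda>x. x [^]\<^bsub>G\<^esub> p) ` ann N"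
  proof
    fix x assume x: "x \<in> ann N"
    then have "x \<in> (\<lambda>x. x [^]\<^bsub>G\<^esub> p) ` carrier G" unfolding pow_surj[OF p] by (simp add: ann_def)
    then obtain z where z: "z \<in> carrier G" "x = z [^]\<^bsub>G\<^esub> p" by blast
    have "chr r z = 1" if r: "r \<in> N" for r
    proof -
      have rp: "r / real p \<in> H" using div[OF r] N by blast
      have "chr (r / real p) x = chr (real p * (r / real p)) z" unfolding z(2) by (rule chr_pow[OF z(1) rp])
      also have "real p * (r / real p) = r" using p by simp
      finally show ?thesis using x div[OF r] by (simp add: ann_def)
    qed
    then have "z \<in> ann N" using z(1) by (simp add: ann_def)
    then show "x \<in> (\<lambda>x. x [^]\<^bsub>G\<^esub> p) ` ann N" using z(2) by blast
  qed
qed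

lemma hom_of_int_mult:
  fixes u :: "real \<Rightarrow> complex"
  assumes N: "0 \<in> N" "\<And>r s. r \<in> N \<Longrightarrow> s \<in> N \<Longrightarrow> r + s \<in> N" "\<And>r. r \<in> N \<Longrightarrow> - r \<in> N"
    and u: "\<And>r. r \<in> N \<Longrightarrow> norm (u r) = 1" "\<And>r s. r \<in> N \<Longrightarrow> s \<in> N \<Longrightarrow> u (r + s) = u r * u s"
    and r: "r \<in> N"
  shows "u (of_int j * r) = cpow j (u r)"
proof -
  have u0: "u 0 = 1" using u(2)[OF N(1) N(1)] u(1)[OF N(1)] by auto
  have nat: "real n * r \<in> N \<and> u (real n * r) = u r ^ n" for n
  proof (induction n)
    case 0
    then show ?case using u0 N(1) by simp
  next
    case (Suc n)
    have "real (Suc n) * r = r + real n * r" by (simp add: distrib_right)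
    then show ?case using Suc N(2)[OF r] u(2)[OF r] by simp
  qed
  have um: "u (- s) = cnj (u s)" if s: "s \<in> N" for s
  proof -
    have "u s * u (- s) = 1" using u(2)[OF s N(3)[OF s]] u0 by simp
    moreover have "u s * cnj (u s) = 1" using complex_norm_square[of "u s"] u(1)[OF s] by simp
    moreover have "u s \<noteq> 0" using u(1)[OF s] by auto
    ultimately show ?thesis by (metis mult_left_cancel)
  qed
  show ?thesis
  proof (cases "j \<ge> 0")
    case True
    then show ?thesis using nat[of "nat j"] by (simp add: cpow_def)
  next
    case False
    then have "u (of_int j * r) = u (- (real (nat (- j)) * r))" by simp
    also have "\<dots> = cnj (u (real (nat (- j)) * r))" using nat by (intro um) blast
    also have "\<dots> = cnj (u r) ^ nat (- j)" using nat by simp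
    finally show ?thesis using False by (simp add: cpow_def)
  qed
qed

text \<open>Every partial character is evaluation at a point: on the finitely generated pieces
  \<open>N \<inter> (1 / D k) \<int>\<close>, which are cyclic, a point of the line does, and \<open>G\<close> is compact.\<close>

theorem partial_character_extends:
  fixes u :: "real \<Rightarrow> complex"
  assumes N: "N \<subseteq> H" "0 \<in> N" "\<And>r s. r \<in> N \<Longrightarrow> s \<in> N \<Longrightarrow> r + s \<in> N" "\<And>r. r \<in> N \<Longrightarrow> - r \<in> N"
    and u: "\<And>r. r \<in> N \<Longrightarrow> norm (u r) = 1" "\<And>r s. r \<in> N \<Longrightarrow> s \<in> N \<Longrightarrow> u (r + s) = u r * u s"
  obtains x where "x \<in> carrier G" "\<And>r. r \<in> N \<Longrightarrow> chr r x = u r"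
proof -
  define F where "F k = {x \<in> carrier G. \<forall>r\<in>N. r * real (D k) \<in> \<int> \<longrightarrow> chr r x = u r}" for k
  have "(\<Inter>k. F k) \<noteq> {}"
  proof (rule compact_space_imp_nest[OF compact_T])
    fix k
    let ?I = "{r\<in>N. r * real (D k) \<in> \<int>}"
    have ne: "0 \<in> ?I" using N(2) by simp
    then have "F k = (\<Inter>r\<in>?I. {x \<in> carrier G. chr r x \<in> {u r}})" unfolding F_def by blast
    moreover have "closedin T (\<Inter>r\<in>?I. {x \<in> carrier G. chr r x \<in> {u r}})"
    proof (rule closedin_INT)
      show "?I \<noteq> {}" using ne by blast
      fix r assume "r \<in> ?I"
      then have "r \<in> H" using N(1) by auto
      then show "closedin T {x \<in> carrier G. chr r x \<in> {u r}}" by (rule closedin_preimage) simp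
    qed
    ultimately show "closedin T (F k)" by simp
    have "\<exists>d::nat. \<forall>m. m \<in> {m. of_int m / real (D k) \<in> N} \<longleftrightarrow> int d dvd m"
    proof (rule int_subgroup_generator)
      show "0 \<in> {m::int. of_int m / real (D k) \<in> N}" using N(2) by simp
      show "m + n \<in> {m::int. of_int m / real (D k) \<in> N}"
        if "m \<in> {m. of_int m / real (D k) \<in> N}" "n \<in> {m. of_int m / real (D k) \<in> N}" for m n
        using N(3) that by (simp add: add_divide_distrib)
      show "- m \<in> {m::int. of_int m / real (D k) \<in> N}" if "m \<in> {m. of_int m / real (D k) \<in> N}" for m
        using N(4) that by simp
    qed
    then obtain d :: nat where d: "\<And>m. of_int m / real (D k) \<in> N \<longleftrightarrow> int d dvd m" by auto
    define r0 where "r0 = of_int (int d) / real (D k)"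
    have r0: "r0 \<in> N" unfolding r0_def d by simp
    then have r0H: "r0 \<in> H" using N(1) by blast
    have "\<exists>t. chr r0 (line t) = u r0"
    proof (cases "d = 0")
      case True
      then have "r0 = 0" by (simp add: r0_def)
      moreover have "u 0 = 1" using u(2)[OF N(2,2)] u(1)[OF N(2)] by auto
      ultimately show ?thesis by (simp add: chr_0)
    next
      case False
      then have "r0 \<noteq> 0" using D_pos[of k] by (simp add: r0_def)
      obtain th where th: "u r0 = cis th" using u(1)[OF r0] by (rule norm_1_cis)
      have "chr r0 (line (th / (2 * pi * r0))) = cis th"
        unfolding chr_line[OF r0H] using \<open>r0 \<noteq> 0\<close> by simp
      then show ?thesis unfolding th ..
    qed
    then obtain t where t: "chr r0 (line t) = u r0" ..
    have "line t \<in> F k"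
      unfolding F_def
    proof (intro CollectI conjI ballI impI line_carrier)
      fix r assume r: "r \<in> N" "r * real (D k) \<in> \<int>"
      then obtain m where m: "r * real (D k) = of_int m" by (auto elim: Ints_cases)
      then have rm: "r = of_int m / real (D k)" using D_pos[of k] by (simp add: eq_divide_eq)
      then have "int d dvd m" using r(1) d by blast
      then obtain j where "m = int d * j" by (rule dvdE)
      then have rj: "r = of_int j * r0" unfolding rm r0_def by simp
      have "chr r (line t) = cpow j (chr r0 (line t))"
        unfolding rj by (rule hom_of_int_mult[of H "\<lambda>r. chr r (line t)"])
          (simp_all add: H_0 H_plus H_minus norm_chr chr_add r0H)
      also have "\<dots> = cpow j (u r0)" by (simp only: t)
      also have "\<dots> = u r" unfolding rj by (rule hom_of_int_mult[of N u, OF N(2-4) u r0, symmetric])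
      finally show "chr r (line t) = u r" .
    qed
    then show "F k \<noteq> {}" by blast
  next
    show "decseq F"
    proof (rule decseq_SucI, rule subsetI)
      fix k x assume x: "x \<in> F (Suc k)"
      have "r * real (D (Suc k)) \<in> \<int>" if r: "r * real (D k) \<in> \<int>" for r
      proof -
        obtain m where "r * real (D k) = of_int m" using r by (auto elim: Ints_cases)
        from scale_up[OF this, of "Suc k"] show ?thesis by (simp only: le_Suc_eq order_refl simp_thms Ints_of_int)
      qed
      then show "x \<in> F k" using x unfolding F_def by blast
    qed
  qed
  then obtain x where x: "\<And>k. x \<in> F k" by blast
  show ?thesis
  proof (rule that[of x])
    show "x \<in> carrier G" using x[of 0] by (simp add: F_def)
    fix r assume r: "r \<in> N"
    then obtain k m where "r * real (D k) = of_int m" using N(1) H_cases by blast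
    then have "r * real (D k) \<in> \<int>" by simp
    then show "chr r x = u r" using x[of k] r by (simp add: F_def)
  qed
qed

lemma chr_finprod:
  assumes "finite A" "F \<in> A \<rightarrow> carrier G" "r \<in> H"
  shows "chr r (finprod G F A) = (\<Prod>i\<in>A. chr r (F i))"
  using assms(1,2)
proof (induction A rule: finite_induct)
  case empty
  then show ?case by (simp add: chr_one assms(3))
next
  case (insert i A)
  then have "F \<in> A \<rightarrow> carrier G" "F i \<in> carrier G" by auto
  then show ?case using insert by (simp add: chr_mult G.finprod_closed assms(3))
qed

lemma chr_sum:
  assumes "x \<in> carrier G" "finite A" "\<And>i. i \<in> A \<Longrightarrow> s i \<in> H"
  shows "(\<Sum>i\<in>A. s i) \<in> H" "chr (\<Sum>i\<in>A. s i) x = (\<Prod>i\<in>A. chr (s i) x)"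
proof -
  have "(\<Sum>i\<in>A. s i) \<in> H \<and> chr (\<Sum>i\<in>A. s i) x = (\<Prod>i\<in>A. chr (s i) x)"
    using assms(2,3) by (induction A rule: finite_induct) (simp_all add: H_0 H_plus chr_0 chr_add assms(1))
  then show "(\<Sum>i\<in>A. s i) \<in> H" "chr (\<Sum>i\<in>A. s i) x = (\<Prod>i\<in>A. chr (s i) x)" by auto
qed

lemma chr_rv_measurable:
  assumes "f \<in> measurable M (borel_algebra T)" "r \<in> H"
  shows "(\<lambda>\<omega>. chr r (f \<omega>)) \<in> borel_measurable M"
  by (rule measurable_compose[OF assms(1) chr_measurable[OF assms(2)]])


section \<open>From the random variables to the equation for the characteristic function\<close>

theorem identically_distributed_sum:
  fixes p n :: nat and \<alpha> :: "nat \<Rightarrow> _ \<Rightarrow> _" and M :: "'w measure" and \<xi> :: "nat \<Rightarrow> 'w \<Rightarrow> _"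
  assumes p: "Factorial_Ring.prime p" and no_p: "\<not> (\<exists>x\<in>carrier G. group.ord G x = p)"
    and only_p: "\<And>b :: nat. Factorial_Ring.prime b \<Longrightarrow> \<not> (\<exists>x\<in>carrier G. group.ord G x = b) \<Longrightarrow> b = p"
    and n: "2 \<le> n"
    and \<alpha>: "\<And>j. j \<in> {1..n} \<Longrightarrow> topological_automorphism G T (\<alpha> j)"
    and squares: "\<And>x. x \<in> carrier G \<Longrightarrow> finprod G (\<lambda>j. \<alpha> j (\<alpha> j x)) {1..n} = x"
    and M: "prob_space M"
    and indep: "prob_space.indep_vars M (\<lambda>_. borel_algebra T) \<xi> {1..n}"
    and \<xi>: "\<And>j. j \<in> {1..n} \<Longrightarrow> distr M (borel_algebra T) (\<xi> j) = \<mu>"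
    and sum: "distr M (borel_algebra T) (\<lambda>\<omega>. finprod G (\<lambda>i. \<alpha> i (\<xi> i \<omega>)) {1..n}) = \<mu>"
  shows "\<exists>\<gamma> K m. gaussian_distribution G T \<gamma> \<and>
           compact_subgroup G T K \<and> subgroup_haar_distribution G T K m \<and>
           \<mu> = group_convolution G T \<gamma> m \<and>
           (\<lambda>x. x [^]\<^bsub>G\<^esub> p) ` K = K"
proof -
  interpret M: prob_space M by (rule M)
  let ?J = "{1..n}"
  have one: "1 \<in> ?J" using n by simp
  have p2: "2 \<le> p" using p by (rule prime_ge_2_nat)
  have \<xi>m: "\<xi> j \<in> measurable M (borel_algebra T)" if "j \<in> ?J" for j
    using indep that unfolding M.indep_vars_def by blast
  have \<mu>: "distribution_on T \<mu>"
    unfolding distribution_on_def \<xi>[OF one, symmetric] using M.prob_space_distr[OF \<xi>m[OF one]] by simp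
  have \<alpha>G: "\<alpha> j x \<in> carrier G" if "j \<in> ?J" "x \<in> carrier G" for j x
    using \<alpha>[OF that(1)] that(2) by (auto simp: topological_automorphism_def iso_def hom_def)
  have \<xi>G: "\<xi> j \<omega> \<in> carrier G" if "j \<in> ?J" "\<omega> \<in> space M" for j \<omega>
    using measurable_space[OF \<xi>m[OF that(1)] that(2)] by simp
  have "\<forall>j\<in>?J. \<exists>l. l \<noteq> 0 \<and> (\<forall>r\<in>H. l * r \<in> H \<and> r / l \<in> H \<and> (\<forall>x\<in>carrier G. chr r (\<alpha> j x) = chr (l * r) x))"
    by (intro ballI automorphism_multiplier \<alpha>)
  from bchoice[OF this] obtain l where l0: "\<forall>j\<in>?J. l j \<noteq> 0 \<and>
      (\<forall>r\<in>H. l j * r \<in> H \<and> r / l j \<in> H \<and> (\<forall>x\<in>carrier G. chr r (\<alpha> j x) = chr (l j * r) x))" ..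
  have l: "l j \<noteq> 0" if "j \<in> ?J" for j using l0 that by blast
  have lH: "l j * r \<in> H" and lH': "r / l j \<in> H" if "j \<in> ?J" "r \<in> H" for j r using l0 that by blast+
  have lc: "chr r (\<alpha> j x) = chr (l j * r) x" if "j \<in> ?J" "r \<in> H" "x \<in> carrier G" for j r x
    using l0 that by blast
  have l2H: "l j * (l j * 1) \<in> H" if "j \<in> ?J" for j
    by (intro lH that H_1)
  \<comment> \<open>The relation between the automorphisms is read off at frequency 1, and distinct
    frequencies give distinct characters.\<close>
  have "(\<Sum>j\<in>?J. l j * (l j * 1)) = 1"
  proof (rule chr_inj)
    show "(\<Sum>j\<in>?J. l j * (l j * 1)) \<in> H" by (rule chr_sum(1)[OF G.one_closed]) (simp_all only: finite_atLeastAtMost l2H)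
    show "1 \<in> H" by (rule H_1)
    fix x assume x: "x \<in> carrier G"
    have "chr (\<Sum>j\<in>?J. l j * (l j * 1)) x = (\<Prod>j\<in>?J. chr (l j * (l j * 1)) x)"
      by (rule chr_sum(2)[OF x]) (simp_all only: finite_atLeastAtMost l2H)
    also have "\<dots> = (\<Prod>j\<in>?J. chr 1 (\<alpha> j (\<alpha> j x)))"
      by (intro prod.cong refl) (simp only: lc H_1 lH \<alpha>G x)
    also have "\<dots> = chr 1 (finprod G (\<lambda>j. \<alpha> j (\<alpha> j x)) ?J)"
      by (rule chr_finprod[symmetric]) (auto intro!: \<alpha>G x H_1)
    also have "\<dots> = chr 1 x" by (simp only: squares[OF x])
    finally show "chr (\<Sum>j\<in>?J. l j * (l j * 1)) x = chr 1 x" .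
  qed
  then have sq: "(\<Sum>j\<in>?J. (l j)\<^sup>2) = 1" by (simp add: power2_eq_square)
  \<comment> \<open>As \<open>n\<close> is at least 2 there is a second index, whose nonzero square
    takes up part of the total 1. This excludes \<plusminus>1 and positive powers of
    \<open>p\<close> as multipliers.\<close>
  have less: "\<bar>l j\<bar> < 1" if j: "j \<in> ?J" for j
  proof -
    define i where "i = (if j = 1 then 2 else 1 :: nat)"
    have i: "i \<in> ?J" "i \<noteq> j" using n by (simp_all add: i_def)
    have "(l j)\<^sup>2 + (l i)\<^sup>2 = (\<Sum>k\<in>{j, i}. (l k)\<^sup>2)" using i by simp
    also have "\<dots> \<le> (\<Sum>k\<in>?J. (l k)\<^sup>2)" 
    proof (rule sum_mono2)
      show "{j, i} \<subseteq> ?J" using i(1) j by (simp only: insert_subset empty_subsetI simp_thms)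
    qed simp_all
    finally have "(l j)\<^sup>2 + (l i)\<^sup>2 \<le> 1" unfolding sq .
    moreover have "0 < (l i)\<^sup>2" using l[OF i(1)] by simp
    ultimately have "(l j)\<^sup>2 < 1" by linarith
    then show ?thesis by (simp add: abs_square_less_1)
  qed
  have "\<forall>j\<in>?J. \<exists>m. 1 \<le> m \<and> (l j = 1 / real p ^ m \<or> l j = - 1 / real p ^ m)"
  proof
    fix j assume j: "j \<in> ?J"
    have "l j * 1 \<in> \<rat>" using lH[OF j H_1] H_Rats by blast
    then have Q: "l j \<in> \<rat>" by simp
    show "\<exists>m. 1 \<le> m \<and> (l j = 1 / real p ^ m \<or> l j = - 1 / real p ^ m)"
    proof (rule multiplier_eq_inverse_power[OF H_plus H_minus H_0 Q l[OF j] less[OF j] lH[OF j] lH'[OF j] p])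
      fix b :: nat assume b: "Factorial_Ring.prime b" "b \<noteq> p"
      then obtain x where "x \<in> carrier G" "group.ord G x = b" using only_p by blast
      then show "\<exists>h\<in>H. h / real b \<notin> H" by (rule H_not_divisible[OF b(1)])
    next
      fix m :: nat assume "1 \<le> m" "l j = 1 / real p ^ m \<or> l j = - 1 / real p ^ m"
      then show "\<exists>m. 1 \<le> m \<and> (l j = 1 / real p ^ m \<or> l j = - 1 / real p ^ m)" by (intro exI[of _ m] conjI)
    qed
  qed
  from bchoice[OF this] obtain e where e: "\<forall>j\<in>?J. 1 \<le> e j \<and> (l j = 1 / real p ^ e j \<or> l j = - 1 / real p ^ e j)" ..
  define s where "s j = (if l j = 1 / real p ^ e j then 1 else - 1 :: real)" for j
  have ls: "l j = s j / real p ^ e j" if "j \<in> ?J" for j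
  proof (cases "l j = 1 / real p ^ e j")
    case True then show ?thesis unfolding s_def by (simp only: if_True simp_thms)
  next
    case False
    moreover have "l j = - 1 / real p ^ e j" using bspec[OF e that] False by (simp only: simp_thms)
    ultimately show ?thesis unfolding s_def by (simp only: if_False)
  qed
  have Hp: "u / real p \<in> H" if "u \<in> H" for u by (rule H_divide_prime[OF p no_p that])
  \<comment> \<open>Independence turns the mean of the product into a product of means, and the
    common distribution makes all factors values of a single function.\<close>
  have feq: "(\<integral>x. chr r x \<partial>\<mu>) = (\<Prod>j\<in>?J. \<integral>x. chr (l j * r) x \<partial>\<mu>)" if r: "r \<in> H" for r
  proof -
    let ?S = "\<lambda>\<omega>. finprod G (\<lambda>i. \<alpha> i (\<xi> i \<omega>)) ?J"
    have prod: "chr r' (?S \<omega>) = (\<Prod>i\<in>?J. chr (l i * r') (\<xi> i \<omega>))" if "r' \<in> H" "\<omega> \<in> space M" for r' \<omega>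
    proof -
      have "chr r' (?S \<omega>) = (\<Prod>i\<in>?J. chr r' (\<alpha> i (\<xi> i \<omega>)))"
        by (rule chr_finprod) (auto intro!: \<alpha>G \<xi>G that)
      also have "\<dots> = (\<Prod>i\<in>?J. chr (l i * r') (\<xi> i \<omega>))"
        by (intro prod.cong refl lc \<xi>G that)
      finally show ?thesis .
    qed
    have Sm: "?S \<in> measurable M (borel_algebra T)"
      unfolding measurable_T_iff
    proof (intro conjI allI)
      show SG: "?S \<in> space M \<rightarrow> carrier G" by (auto intro!: G.finprod_closed \<alpha>G \<xi>G)
      fix k
      have eq: "y k (?S \<omega>) = (\<Prod>i\<in>?J. chr (l i * (1 / real (D k))) (\<xi> i \<omega>))" if "\<omega> \<in> space M" for \<omega>
        using prod[OF inverse_D_H that] y_eq_chr[of "?S \<omega>" k] SG that by auto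
      have meas: "(\<lambda>\<omega>. \<Prod>i\<in>?J. chr (l i * (1 / real (D k))) (\<xi> i \<omega>)) \<in> borel_measurable M"
        by (intro borel_measurable_prod chr_rv_measurable \<xi>m lH inverse_D_H)
      show "(\<lambda>\<omega>. y k (?S \<omega>)) \<in> borel_measurable M"
        by (rule measurable_cong[THEN iffD2, OF eq meas])
    qed
    have "(\<integral>x. chr r x \<partial>\<mu>) = (\<integral>\<omega>. chr r (?S \<omega>) \<partial>M)"
      unfolding sum[symmetric] by (rule integral_distr[OF Sm chr_measurable[OF r]])
    also have "\<dots> = (\<integral>\<omega>. (\<Prod>i\<in>?J. chr (l i * r) (\<xi> i \<omega>)) \<partial>M)"
      by (rule Bochner_Integration.integral_cong[OF refl prod[OF r]])
    also have "\<dots> = (\<Prod>i\<in>?J. \<integral>\<omega>. chr (l i * r) (\<xi> i \<omega>) \<partial>M)"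
    proof (rule M.indep_vars_lebesgue_integral)
      show "M.indep_vars (\<lambda>_. borel) (\<lambda>i \<omega>. chr (l i * r) (\<xi> i \<omega>)) ?J"
        by (rule M.indep_vars_compose2[OF indep]) (intro chr_measurable lH r)
      fix i assume i: "i \<in> ?J"
      show "integrable M (\<lambda>\<omega>. chr (l i * r) (\<xi> i \<omega>))"
      proof (rule M.integrable_const_bound[where B = 1])
        show "AE \<omega> in M. norm (chr (l i * r) (\<xi> i \<omega>)) \<le> 1"
          by (rule AE_I2) (simp add: norm_chr[OF \<xi>G[OF i] lH[OF i r]])
        show "(\<lambda>\<omega>. chr (l i * r) (\<xi> i \<omega>)) \<in> borel_measurable M"
          by (rule chr_rv_measurable[OF \<xi>m[OF i] lH[OF i r]])
      qed
    qed simp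
    also have "\<dots> = (\<Prod>i\<in>?J. \<integral>x. chr (l i * r) x \<partial>\<mu>)"
    proof (rule prod.cong[OF refl])
      fix i assume i: "i \<in> ?J"
      show "(\<integral>\<omega>. chr (l i * r) (\<xi> i \<omega>) \<partial>M) = (\<integral>x. chr (l i * r) x \<partial>\<mu>)"
        unfolding \<xi>[OF i, symmetric] by (rule integral_distr[OF \<xi>m[OF i] chr_measurable[OF lH[OF i r]], symmetric])
    qed
    finally show ?thesis .
  qed
  \<comment> \<open>From here the sample space is the solenoid itself with the law
    \<open>\<mu>\<close>, and the characters are the random variables.\<close>
  have fam: "character_family \<mu> H chr p"
  proof (rule character_family.intro)
    show "prob_space \<mu>" using \<mu> by (simp add: distribution_on_def)
    show "character_family_axioms \<mu> H chr p"
    proof (rule character_family_axioms.intro)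
      show "chr u \<in> borel_measurable \<mu>" if "u \<in> H" for u
        unfolding distribution_measurable[OF \<mu>] by (rule chr_measurable[OF that])
      show "norm (chr u \<omega>) = 1" if "u \<in> H" "\<omega> \<in> space \<mu>" for u \<omega>
        using norm_chr that distribution_space[OF \<mu>] by blast
      show "chr (u + v) \<omega> = chr u \<omega> * chr v \<omega>" if "u \<in> H" "v \<in> H" "\<omega> \<in> space \<mu>" for u v \<omega>
        using chr_add that distribution_space[OF \<mu>] by blast
    qed (fact H_0 H_plus H_minus Hp p2)+
  qed
  interpret F: character_family \<mu> H chr p by (rule fam)
  have symm: "symmetrized_family \<mu> H chr p"
    by (rule symmetrized_family.intro[OF fam F.character_family_symm])
  interpret C: character_equation \<mu> H chr p ?J s e
  proof (rule character_equation.intro[OF symm], rule character_equation_axioms.intro)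
    show "finite ?J" by simp
    show "?J \<noteq> {}" using one by blast
    show "s j = 1 \<or> s j = - 1" for j by (simp add: s_def)
    show "1 \<le> e j" if "j \<in> ?J" for j using e that by blast
    have "(l j)\<^sup>2 = 1 / real p ^ (2 * e j)" if "j \<in> ?J" for j
      unfolding ls[OF that] by (simp add: s_def power_divide power_mult[symmetric] mult.commute)
    then show "(\<Sum>j\<in>?J. 1 / real p ^ (2 * e j)) = 1" using sq by simp
    show "F.f u = (\<Prod>j\<in>?J. F.f (s j * u / real p ^ e j))" if "u \<in> H" for u
      unfolding F.f_def feq[OF that] by (intro prod.cong refl) (simp add: ls)
    show "H \<subseteq> \<rat>" by (rule H_Rats)
  qed
  from C.gaussian_on_support obtain c
    where c0: "0 \<le> c" and c: "\<forall>u\<in>C.N. F.f u = sgn (F.f u) * of_real (exp (- c * u\<^sup>2))"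
    by (elim exE conjE)
  have NH: "C.N \<subseteq> H" by (rule subsetI) (rule C.N_H)
  have "\<exists>x\<in>carrier G. \<forall>r\<in>C.N. chr r x = sgn (F.f r)"
  proof (rule partial_character_extends[OF NH C.N_zero C.N_add C.N_uminus, of "\<lambda>r. sgn (F.f r)"])
    show "norm (sgn (F.f r)) = 1" if "r \<in> C.N" for r using that by (simp add: C.N_def norm_sgn)
    show "sgn (F.f (r + t)) = sgn (F.f r) * sgn (F.f t)" if "r \<in> C.N" "t \<in> C.N" for r t
      using that by (rule C.sgn_add)
    fix x assume "x \<in> carrier G" "\<And>r. r \<in> C.N \<Longrightarrow> chr r x = sgn (F.f r)"
    then show ?thesis by (intro bexI[of _ x] ballI)
  qed
  then obtain x0 where x0: "x0 \<in> carrier G" and x0N: "\<forall>r\<in>C.N. chr r x0 = sgn (F.f r)" ..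
  have "\<exists>\<gamma>. gaussian_distribution G T \<gamma> \<and>
      (\<forall>r\<in>H. (\<integral>x. chr r x \<partial>\<gamma>) = chr r x0 * of_real (exp (- c * r\<^sup>2)))"
  proof (rule gaussian_exists[OF x0 c0])
    fix \<gamma> assume "gaussian_distribution G T \<gamma>"
      "\<And>r. r \<in> H \<Longrightarrow> (\<integral>x. chr r x \<partial>\<gamma>) = chr r x0 * of_real (exp (- c * r\<^sup>2))"
    then show ?thesis by (intro exI[of _ \<gamma>] conjI ballI)
  qed
  then obtain \<gamma> where \<gamma>: "gaussian_distribution G T \<gamma>"
    and \<gamma>c: "\<forall>r\<in>H. (\<integral>x. chr r x \<partial>\<gamma>) = chr r x0 * of_real (exp (- c * r\<^sup>2))"
    by (elim exE conjE)
  have "\<exists>m. distribution_on T m \<and> (\<forall>r\<in>H. (\<integral>x. chr r x \<partial>m) = (if r \<in> C.N then 1 else 0))"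
  proof (rule subgroup_indicator_distribution[OF NH C.N_zero C.N_add C.N_uminus])
    fix m assume "distribution_on T m"
      "\<And>r. r \<in> H \<Longrightarrow> (\<integral>x. chr r x \<partial>m) = (if r \<in> C.N then 1 else 0)"
    then show ?thesis by (intro exI[of _ m] conjI ballI)
  qed
  then obtain m where m: "distribution_on T m"
    and mc: "\<forall>r\<in>H. (\<integral>x. chr r x \<partial>m) = (if r \<in> C.N then 1 else 0)"
    by (elim exE conjE)
  have \<gamma>d: "distribution_on T \<gamma>" using \<gamma> by (simp add: gaussian_distribution_def)
  \<comment> \<open>Coefficients are compared: on \<open>C.N\<close> the phase is
    \<open>chr r x0\<close> and the modulus the Gaussian factor, and off \<open>C.N\<close> both
    sides vanish, the right one through \<open>m\<close>.\<close>
  have conv: "\<mu> = group_convolution G T \<gamma> m"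
  proof (rule distribution_eqI[OF \<mu> convolution_distribution(1)[OF \<gamma>d m]])
    fix r assume r: "r \<in> H"
    have "(\<integral>x. chr r x \<partial>\<mu>) = F.f r" by (simp add: F.f_def)
    also have "\<dots> = (chr r x0 * of_real (exp (- c * r\<^sup>2))) * (if r \<in> C.N then 1 else 0)"
    proof (cases "r \<in> C.N")
      case True
      then show ?thesis using bspec[OF c True] bspec[OF x0N True] by (simp only: if_True mult_1_right)
    next
      case False
      then have "F.f r = 0" using r unfolding C.N_def by blast
      then show ?thesis using False by simp
    qed
    also have "\<dots> = (\<integral>x. chr r x \<partial>\<gamma>) * (\<integral>x. chr r x \<partial>m)" by (simp only: bspec[OF \<gamma>c r] bspec[OF mc r])
    also have "\<dots> = (\<integral>x. chr r x \<partial>group_convolution G T \<gamma> m)"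
      by (rule convolution_distribution(2)[OF \<gamma>d m r, symmetric])
    finally show "(\<integral>x. chr r x \<partial>\<mu>) = (\<integral>x. chr r x \<partial>group_convolution G T \<gamma> m)" .
  qed
  have image: "(\<lambda>x. x [^]\<^bsub>G\<^esub> p) ` ann C.N = ann C.N"
    by (rule ann_pow_image[OF NH _ C.N_divide C.N_of_nat_mult]) (use p2 in auto)
  have haar: "subgroup_haar_distribution G T (ann C.N) m"
    by (rule ann_haar[OF NH m]) (rule bspec[OF mc])
  show ?thesis
    by (rule exI[of _ \<gamma>], rule exI[of _ "ann C.N"], rule exI[of _ m])
      (intro conjI \<gamma> ann_compact_subgroup[OF NH] haar conv image)
qed

end

theorem theorem2p1:
  fixes a :: "nat \<Rightarrow> nat"
    and p n :: nat
    and \<alpha> :: "nat \<Rightarrow> (real \<times> (nat \<Rightarrow> nat)) set \<Rightarrow> (real \<times> (nat \<Rightarrow> nat)) set"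
    and M :: "'w measure"
    and \<xi> :: "nat \<Rightarrow> 'w \<Rightarrow> (real \<times> (nat \<Rightarrow> nat)) set"
    and \<mu> :: "(real \<times> (nat \<Rightarrow> nat)) set measure"
  defines "G \<equiv> solenoid a" and "T \<equiv> solenoid_topology a"
  assumes "\<And>j. 1 < a j"
    and "Factorial_Ring.prime p" and "\<not> (\<exists>x\<in>carrier G. group.ord G x = p)"
    and "\<And>q :: nat. Factorial_Ring.prime q \<Longrightarrow> \<not> (\<exists>x\<in>carrier G. group.ord G x = q) \<Longrightarrow> q = p"
    and "2 \<le> n"
    and "\<And>j. j \<in> {1..n} \<Longrightarrow> topological_automorphism G T (\<alpha> j)"
    and "\<And>x. x \<in> carrier G \<Longrightarrow> finprod G (\<lambda>j. \<alpha> j (\<alpha> j x)) {1..n} = x"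
    and "prob_space M"
    and "prob_space.indep_vars M (\<lambda>_. borel_algebra T) \<xi> {1..n}"
    and "\<And>j. j \<in> {1..n} \<Longrightarrow> distr M (borel_algebra T) (\<xi> j) = \<mu>"
    and "\<And>j. j \<in> {1..n} \<Longrightarrow>
           distr M (borel_algebra T) (\<lambda>\<omega>. finprod G (\<lambda>i. \<alpha> i (\<xi> i \<omega>)) {1..n}) =
           distr M (borel_algebra T) (\<xi> j)"
  shows "\<exists>\<gamma> K m. gaussian_distribution G T \<gamma> \<and>
           compact_subgroup G T K \<and> subgroup_haar_distribution G T K m \<and>
           \<mu> = group_convolution G T \<gamma> m \<and>
           (\<lambda>x. x [^]\<^bsub>G\<^esub> p) ` K = K"
proof -
  interpret adic a by (rule adic.intro) (rule assms(3))
  have one: "1 \<in> {1..n}" using assms(7) by simp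
  have "distr M (borel_algebra T) (\<lambda>\<omega>. finprod G (\<lambda>i. \<alpha> i (\<xi> i \<omega>)) {1..n}) = \<mu>"
    using assms(13)[OF one] assms(12)[OF one] by (rule trans)
  note sum = this[unfolded G_def T_def]
  show ?thesis
    unfolding G_def T_def
    by (rule identically_distributed_sum[OF assms(4-12)[unfolded G_def T_def] sum])
qed

end
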